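(* Let $1<\alpha<2$ and $n\geq2$, and let $2^*=2n/(n-\alpha)$. There exists a constant $c=c(\alpha,n)>0$ such that for every $0<r<\infty$ and every $u\in C_c(B_r)$, \[ \mathcal{E}_{B_r}(u)\geq 2^\alpha\kappa_{n,\alpha}\int_{B_r}u^2(x)\,r^\alpha(r^2-|x|^2)^{-\alpha}\,dx + c\Big(\int_{B_r}|u(x)|^{2^*}\,dx\Big)^{2/2^*}. \]
   Context: $B_r=\{x\in\mathbb{R}^n:|x|<r\}$. For open $D\subset\mathbb{R}^n$, $0<\alpha<2$ and $u\in L^2(D)$, $\mathcal{E}_D(u)=\frac12\int_D\int_D\frac{(u(x)-u(y))^2}{|x-y|^{n+\alpha}}\,dx\,dy$. $C_c(D)$ denotes continuous functions with compact support in $D$. The constant \[ \kappa_{n,\alpha}=\pi^{\frac{n-1}{2}}\frac{\Gamma(\frac{1+\alpha}{2})}{\Gamma(\frac{n+\alpha}{2})}\cdot\frac{B\big(\frac{1+\alpha}{2},\frac{2-\alpha}{2}\big)-2^\alpha}{\alpha 2^\alpha}, \] where $B$ is the Euler beta function. *)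

theory Defs
  imports "HOL-Analysis.Analysis"
begin

definition kappa :: "nat \<Rightarrow> real \<Rightarrow> real" where
  "kappa n \<alpha> = pi powr ((real n - 1) / 2) * Gamma ((1 + \<alpha>) / 2) / Gamma ((real n + \<alpha>) / 2)
     * ((Beta ((1 + \<alpha>) / 2) ((2 - \<alpha>) / 2) - 2 powr \<alpha>) / (\<alpha> * 2 powr \<alpha>))"

definition energy :: "'a::euclidean_space set \<Rightarrow> real \<Rightarrow> ('a \<Rightarrow> real) \<Rightarrow> ennreal" where
  "energy D \<alpha> u = ennreal (1/2) *
     (\<integral>\<^sup>+ x. (\<integral>\<^sup>+ y. ennreal ((u x - u y)^2 / norm (x - y) powr (real DIM('a) + \<alpha>))
        * indicator D y \<partial>lborel) * indicator D x \<partial>lborel)"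

definition Cc :: "'a::euclidean_space set \<Rightarrow> ('a \<Rightarrow> real) set" where
  "Cc D = {u. continuous_on UNIV u \<and> (\<exists>K. compact K \<and> K \<subseteq> D \<and> (\<forall>x. x \<notin> K \<longrightarrow> u x = 0))}"

end

theory Submission
  imports Defs
begin

text \<open>
  Write $w(x) = (1 - |x|^2)^{(\alpha-1)/2}$ and $u = v w$ on the unit ball. Expanding the square, the
  energy of $u$ becomes the weighted energy of $v$ with weight $w(x) w(y)$ plus the integral of $u^2 V$,
  where $V(x) = w(x)^{-1} \int (w(x) - w(y)) |x-y|^{-n-\alpha} dy$ as a principal value.

  Writing $|z|^{-n-\alpha}$ as a Gaussian integral over dilations $s > 0$ turns $V$ into a Gaussian average of
  integrals along the rays $x + \eta/s$, and in the variable $s$ the weight $1 - |x + \eta/s|^2$ is, up to the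
  factor $s^{-2}$, a quadratic polynomial; completing the square makes every ray integral explicit. The result is
  $V(x) \ge (2^\alpha \kappa + c (1 - |x|^2)) (1 - |x|^2)^{-\alpha}$, so a multiple of $\int u^2$
  is left over.

  For the Sobolev term, compare $v(x)$ with its mean over a ball of radius $R/2$ that is shifted from $x$ towards
  the centre: there $w$ is not much smaller than $w(x)$. This gives
  $u(x)^2 \le C (R^\alpha G(x) + R^{\alpha-n} \|u\|_q^2)$ for $R \le 1$, where $q = 2^*$ and $G$ is the density of the
  weighted energy. Where $G(x) \ge \|u\|_q^2$ the best $R$ is admissible, elsewhere the left-over
  $\int u^2$ controls the mean over the ball with $R = 1$; integrating $|u|^q$ closes the estimate.
\<close>

section \<open>Gamma and Beta integrals\<close>

text \<open>Neither half of the principal value V converges on its own. All estimates are therefore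
  made for nonnegative extended integrals over \<open>far \<delta>\<close>, with every term on the
  side where it is positive, and \<delta> tends to 0 only at the end. On one ray both truncated
  integrals grow like N^\<alpha>, where N is the upper endpoint. These parts cancel, at the price of
  a convexity argument that needs the directions \<eta> and -\<eta> together, and a multiple of B -
  (1 + |x|)^(\<alpha> - 1) remains, B being half the Beta value in \<open>kappa\<close>.

  On the sphere this is B - 2^(\<alpha> - 1). Multiplied by a Gaussian moment of one coordinate it
  gives the constant of the theorem, and \<open>two_powr_le_Beta\<close> makes it nonnegative.
  Inside the ball the gap between 2^(\<alpha> - 1) and (1 + |x|)^(\<alpha> - 1) is at least a
  multiple of 1 - |x|^2 and pays for the left-over integral of u^2.

  The Sobolev exponent is critical for the kernel: the bound obtained from the best radius is linear
  in G(x), so integrating it brings back the weighted energy.\<close>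

lemma nn_integral_change_of_variables_real:
  fixes f g g' :: "real \<Rightarrow> real"
  assumes S: "S \<in> sets borel"
    and der: "\<And>x. x \<in> S \<Longrightarrow> (g has_field_derivative g' x) (at x within S)"
    and inj: "inj_on g S"
    and nonneg: "\<And>y. y \<in> g ` S \<Longrightarrow> 0 \<le> f y"
    and int: "(f has_integral b) (g ` S)"
  shows "(\<integral>\<^sup>+x. ennreal (\<bar>g' x\<bar> * f (g x)) * indicator S x \<partial>lborel) = ennreal b"
proof -
  \<comment> \<open>Change of variables asks for absolute integrability. For a nonnegative integrand
    it follows from convergence of the gauge integral, the form in which the Gamma and Beta
    integrals are given.\<close>
  have "f absolutely_integrable_on g ` S \<and> integral (g ` S) f = b"
    using int nonneg by (auto intro!: nonnegative_absolutely_integrable_1)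
  then have "(\<lambda>x. \<bar>g' x\<bar> * f (g x)) absolutely_integrable_on S \<and>
      integral S (\<lambda>x. \<bar>g' x\<bar> * f (g x)) = b"
    using has_absolute_integral_change_of_variables_1'[of S g g' f b] S der inj by auto
  then have "((\<lambda>x. \<bar>g' x\<bar> * f (g x)) has_integral b) S"
    by (auto simp: has_integral_iff set_lebesgue_integral_eq_integral)
  then show ?thesis
    using nonneg by (intro nn_integral_has_integral_lebesgue') auto
qed

lemma power2_powr: "0 < x \<Longrightarrow> (x\<^sup>2) powr c = x powr (2 * c)" for x c :: real
  by (simp add: powr_powr flip: powr_numeral)

lemma nn_integral_Gaussian_powr:
  fixes \<beta> :: real
  assumes "0 < \<beta>"
  shows "(\<integral>\<^sup>+s. ennreal (exp (- s\<^sup>2) * s powr (\<beta> - 1)) * indicator {0<..} s \<partial>lborel)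
    = ennreal (Gamma (\<beta> / 2) / 2)"
proof -
  have img: "(\<lambda>s::real. s\<^sup>2) ` {0<..} = {0<..}"
  proof safe
    fix y :: real assume "0 < y"
    then show "y \<in> (\<lambda>s. s\<^sup>2) ` {0<..}" by (intro image_eqI[of _ _ "sqrt y"]) auto
  qed auto
  have "((\<lambda>t. t powr (\<beta> / 2 - 1) / exp t) has_integral Gamma (\<beta> / 2)) {0<..}"
    by (rule iffD1[OF has_integral_spike_set_eq Gamma_integral_real])
       (use assms in \<open>auto intro: negligible_subset[of "{0}"]\<close>)
  then have "((\<lambda>t. t powr (\<beta> / 2 - 1) / exp t / 2) has_integral Gamma (\<beta> / 2) / 2)
      ((\<lambda>s::real. s\<^sup>2) ` {0<..})"
    unfolding img by (rule has_integral_divide)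
  then have "(\<integral>\<^sup>+s. ennreal (\<bar>2 * s\<bar> * ((s\<^sup>2) powr (\<beta> / 2 - 1) / exp (s\<^sup>2) / 2)) * indicator {0<..} s
      \<partial>lborel) = ennreal (Gamma (\<beta> / 2) / 2)"
    by (intro nn_integral_change_of_variables_real)
       (auto intro!: derivative_eq_intros inj_onI simp: power2_eq_iff)
  also have "(\<integral>\<^sup>+s. ennreal (\<bar>2 * s\<bar> * ((s\<^sup>2) powr (\<beta> / 2 - 1) / exp (s\<^sup>2) / 2)) * indicator {0<..} s
      \<partial>lborel) = (\<integral>\<^sup>+s. ennreal (exp (- s\<^sup>2) * s powr (\<beta> - 1)) * indicator {0<..} s \<partial>lborel)"
  proof (intro nn_integral_cong)
    fix s :: real
    show "ennreal (\<bar>2 * s\<bar> * ((s\<^sup>2) powr (\<beta> / 2 - 1) / exp (s\<^sup>2) / 2)) * indicator {0<..} s =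
      ennreal (exp (- s\<^sup>2) * s powr (\<beta> - 1)) * indicator {0<..} s"
    proof (cases "0 < s")
      case True
      have "(s\<^sup>2) powr (\<beta> / 2 - 1) = s powr (\<beta> - 2)"
        using True by (simp add: powr_powr flip: powr_numeral)
      moreover have "s powr (\<beta> - 1) = s * s powr (\<beta> - 2)"
        using True by (simp add: powr_mult_base)
      ultimately show ?thesis using True by (simp add: exp_minus field_simps)
    qed simp
  qed
  finally show ?thesis .
qed

text \<open>Read from right to left, a power of \<rho> becomes a superposition of Gaussians. It is
  applied with \<rho> = \<open>norm y\<close> and \<beta> = n + \<alpha>.\<close>

lemma nn_integral_Gaussian_powr_scaled:
  fixes \<beta> \<rho> :: real
  assumes "0 < \<beta>" "0 < \<rho>"
  shows "(\<integral>\<^sup>+s. ennreal (exp (- (s * \<rho>)\<^sup>2) * s powr (\<beta> - 1)) * indicator {0<..} s \<partial>lborel)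
    = ennreal (Gamma (\<beta> / 2) / 2 * \<rho> powr - \<beta>)"
proof -
  have "(\<integral>\<^sup>+s. ennreal (exp (- (s * \<rho>)\<^sup>2) * s powr (\<beta> - 1)) * indicator {0<..} s \<partial>lborel)
    = \<bar>1 / \<rho>\<bar> * (\<integral>\<^sup>+s. ennreal (exp (- ((0 + 1 / \<rho> * s) * \<rho>)\<^sup>2) * (0 + 1 / \<rho> * s) powr (\<beta> - 1))
       * indicator {0<..} (0 + 1 / \<rho> * s) \<partial>lborel)"
    using assms by (intro nn_integral_real_affine) auto
  also have "(\<integral>\<^sup>+s. ennreal (exp (- ((0 + 1 / \<rho> * s) * \<rho>)\<^sup>2) * (0 + 1 / \<rho> * s) powr (\<beta> - 1))
       * indicator {0<..} (0 + 1 / \<rho> * s) \<partial>lborel) =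
     (\<integral>\<^sup>+s. ennreal (\<rho> powr (1 - \<beta>)) * (ennreal (exp (- s\<^sup>2) * s powr (\<beta> - 1)) * indicator {0<..} s) \<partial>lborel)"
  proof (intro nn_integral_cong)
    fix s :: real
    show "ennreal (exp (- ((0 + 1 / \<rho> * s) * \<rho>)\<^sup>2) * (0 + 1 / \<rho> * s) powr (\<beta> - 1))
       * indicator {0<..} (0 + 1 / \<rho> * s) =
      ennreal (\<rho> powr (1 - \<beta>)) * (ennreal (exp (- s\<^sup>2) * s powr (\<beta> - 1)) * indicator {0<..} s)"
      using assms
      by (cases "0 < s") (auto simp: powr_divide powr_diff field_simps zero_less_divide_iff
          simp flip: ennreal_mult' split: split_indicator)
  qed
  also have "\<bar>1 / \<rho>\<bar> * \<dots> = ennreal (Gamma (\<beta> / 2) / 2 * \<rho> powr - \<beta>)"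
  proof -
    have "1 / \<rho> * (\<rho> powr (1 - \<beta>) * (Gamma (\<beta> / 2) / 2)) = Gamma (\<beta> / 2) / 2 * \<rho> powr - \<beta>"
      using assms by (simp add: powr_diff powr_minus field_simps)
    then show ?thesis
      using assms by (subst nn_integral_cmult) (simp_all add: nn_integral_Gaussian_powr flip: ennreal_mult')
  qed
  finally show ?thesis .
qed

text \<open>The Beta integral after the substitution t = 1 - 1/\<tau>^2. The density on the left is
  what integration by parts leaves of a weighted ray integral, so the Beta value in
  \<open>kappa\<close> originates here.\<close>

lemma nn_integral_Beta_half_line:
  fixes \<alpha> :: real
  assumes "1 < \<alpha>" "\<alpha> < 2"
  shows "(\<integral>\<^sup>+\<tau>. ennreal ((\<tau>\<^sup>2 - 1) powr ((\<alpha> - 1) / 2) / \<tau>\<^sup>2) * indicator {1<..} \<tau> \<partial>lborel)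
    = ennreal (Beta ((1 + \<alpha>) / 2) ((2 - \<alpha>) / 2) / 2)"
proof -
  let ?B = "Beta ((1 + \<alpha>) / 2) ((2 - \<alpha>) / 2)"
  have img: "(\<lambda>\<tau>::real. 1 - 1 / \<tau>\<^sup>2) ` {1<..} = {0<..<1}"
  proof safe
    fix y :: real assume "y \<in> {0<..<1}"
    then show "y \<in> (\<lambda>\<tau>::real. 1 - 1 / \<tau>\<^sup>2) ` {1<..}"
      by (intro image_eqI[of _ _ "1 / sqrt (1 - y)"]) (auto simp: power_divide)
  qed (auto simp: field_simps)
  have inj: "inj_on (\<lambda>\<tau>::real. 1 - 1 / \<tau>\<^sup>2) {1<..}"
    by (rule inj_onI) (simp add: power2_eq_iff)
  have "((\<lambda>t. t powr ((1 + \<alpha>) / 2 - 1) * (1 - t) powr ((2 - \<alpha>) / 2 - 1)) has_integral ?B) {0<..<1}"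
    using has_integral_Beta_real[of "(1 + \<alpha>) / 2" "(2 - \<alpha>) / 2"] assms
    by (simp add: has_integral_Icc_iff_Ioo)
  then have "((\<lambda>t. t powr ((1 + \<alpha>) / 2 - 1) * (1 - t) powr ((2 - \<alpha>) / 2 - 1) / 2) has_integral ?B / 2)
      ((\<lambda>\<tau>::real. 1 - 1 / \<tau>\<^sup>2) ` {1<..})"
    unfolding img by (rule has_integral_divide)
  then have "(\<integral>\<^sup>+\<tau>. ennreal (\<bar>2 / \<tau> ^ 3\<bar> * ((1 - 1 / \<tau>\<^sup>2) powr ((1 + \<alpha>) / 2 - 1) *
      (1 - (1 - 1 / \<tau>\<^sup>2)) powr ((2 - \<alpha>) / 2 - 1) / 2)) * indicator {1<..} \<tau> \<partial>lborel) = ennreal (?B / 2)"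
    by (intro nn_integral_change_of_variables_real[where g = "\<lambda>\<tau>. 1 - 1 / \<tau>\<^sup>2" and g' = "\<lambda>\<tau>. 2 / \<tau> ^ 3"
        and f = "\<lambda>t. t powr ((1 + \<alpha>) / 2 - 1) * (1 - t) powr ((2 - \<alpha>) / 2 - 1) / 2"])
       (use inj in \<open>auto intro!: derivative_eq_intros simp: eval_nat_numeral\<close>)
  also have "(\<integral>\<^sup>+\<tau>. ennreal (\<bar>2 / \<tau> ^ 3\<bar> * ((1 - 1 / \<tau>\<^sup>2) powr ((1 + \<alpha>) / 2 - 1) *
      (1 - (1 - 1 / \<tau>\<^sup>2)) powr ((2 - \<alpha>) / 2 - 1) / 2)) * indicator {1<..} \<tau> \<partial>lborel) =
     (\<integral>\<^sup>+\<tau>. ennreal ((\<tau>\<^sup>2 - 1) powr ((\<alpha> - 1) / 2) / \<tau>\<^sup>2) * indicator {1<..} \<tau> \<partial>lborel)"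
  proof (intro nn_integral_cong)
    fix \<tau> :: real
    show "ennreal (\<bar>2 / \<tau> ^ 3\<bar> * ((1 - 1 / \<tau>\<^sup>2) powr ((1 + \<alpha>) / 2 - 1) *
      (1 - (1 - 1 / \<tau>\<^sup>2)) powr ((2 - \<alpha>) / 2 - 1) / 2)) * indicator {1<..} \<tau> =
      ennreal ((\<tau>\<^sup>2 - 1) powr ((\<alpha> - 1) / 2) / \<tau>\<^sup>2) * indicator {1<..} \<tau>"
    proof (cases "1 < \<tau>")
      case True
      have sq: "1 < \<tau>\<^sup>2" using True by (simp add: one_less_power)
      have eq: "(1 + \<alpha>) / 2 - 1 = (\<alpha> - 1) / 2" "(2 - \<alpha>) / 2 - 1 = - (\<alpha> / 2)" by (auto simp: field_simps)
      have "1 - 1 / \<tau>\<^sup>2 = (\<tau>\<^sup>2 - 1) / \<tau>\<^sup>2" using True by (simp add: field_simps)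
      moreover have "(\<tau>\<^sup>2) powr ((\<alpha> - 1) / 2) = \<tau> powr (\<alpha> - 1)"
        using True by (subst power2_powr) (simp_all add: diff_divide_distrib)
      ultimately have 1: "(1 - 1 / \<tau>\<^sup>2) powr ((\<alpha> - 1) / 2) = (\<tau>\<^sup>2 - 1) powr ((\<alpha> - 1) / 2) / \<tau> powr (\<alpha> - 1)"
        using True sq by (simp add: powr_divide)
      have 2: "(1 - (1 - 1 / \<tau>\<^sup>2)) powr - (\<alpha> / 2) = \<tau> powr \<alpha>"
        using True by (simp add: powr_divide powr_minus_divide powr_powr flip: powr_numeral)
      show ?thesis unfolding eq 1 2 using True
        by (auto simp: powr_diff power3_eq_cube power2_eq_square field_simps)
    qed simp
  qed
  finally show ?thesis .
qed

lemma two_powr_le_Beta: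
  fixes \<alpha> :: real
  assumes "1 < \<alpha>" "\<alpha> < 2"
  shows "2 powr \<alpha> \<le> Beta ((1 + \<alpha>) / 2) ((2 - \<alpha>) / 2)"
proof -
  \<comment> \<open>Up to the constant $\ln \Gamma(3/2)$ this is the logarithm of the quotient of both sides. It is convex, and at
    $t = 1$ both sides agree and its derivative $(\psi(1) - \psi(1/2))/2 - \ln 2$ vanishes.\<close>
  define f where "f t = ln_Gamma ((1 + t) / 2) + ln_Gamma ((2 - t) / 2) - t * ln 2" for t :: real
  have "f 1 \<le> f \<alpha>"
  proof (rule DERIV_nonneg_imp_nondecreasing[where f = f])
    fix t :: real assume t: "1 \<le> t" "t \<le> \<alpha>"
    have "(f has_real_derivative Digamma ((1 + t) / 2) / 2 - Digamma ((2 - t) / 2) / 2 - ln 2) (at t)"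
      unfolding f_def using t assms by (auto intro!: derivative_eq_intros simp: field_simps)
    moreover have "Digamma 1 \<le> Digamma ((1 + t) / 2)" by (rule Digamma_real_mono) (use t in auto)
    moreover have "Digamma ((2 - t) / 2) \<le> Digamma (1 / 2)"
      by (rule Digamma_real_mono) (use t assms in auto)
    moreover have "Digamma (1 :: real) = - euler_mascheroni"
      "Digamma (1 / 2 :: real) = - euler_mascheroni - 2 * ln 2"
      by (simp_all add: Digamma_one_half)
    ultimately have "(f has_real_derivative Digamma ((1 + t) / 2) / 2 - Digamma ((2 - t) / 2) / 2 - ln 2) (at t)"
      "0 \<le> Digamma ((1 + t) / 2) / 2 - Digamma ((2 - t) / 2) / 2 - ln 2"
      by linarith+
    then show "\<exists>y. (f has_real_derivative y) (at t) \<and> 0 \<le> y" by blast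
  qed (use assms in auto)
  then have "exp (f 1) \<le> exp (f \<alpha>)" by simp
  moreover have "exp (f 1) = sqrt pi / 2"
    unfolding f_def by (simp add: exp_add exp_diff Gamma_one_half_real flip: Gamma_real_pos_exp)
  moreover have "exp (f \<alpha>) = Gamma ((1 + \<alpha>) / 2) * Gamma ((2 - \<alpha>) / 2) / 2 powr \<alpha>"
    unfolding f_def using assms by (simp add: exp_add exp_diff powr_def Gamma_real_pos_exp)
  moreover have g32: "Gamma (3 / 2 :: real) = sqrt pi / 2"
    using Gamma_plus1[of "1 / 2 :: real"]
    by (force simp: Gamma_one_half_real dest: nonpos_Ints_nonpos)
  moreover have eq: "(1 + \<alpha>) / 2 + (2 - \<alpha>) / 2 = 3 / 2" by (simp add: field_simps)
  ultimately show ?thesis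
    unfolding Beta_def eq g32 by (simp add: field_simps)
qed

section \<open>Gaussian averages\<close>

lemma nn_integral_lborel_affine:
  fixes t :: "'a::euclidean_space"
  assumes [measurable]: "f \<in> borel_measurable borel" and c: "c \<noteq> 0"
  shows "(\<integral>\<^sup>+x. f x \<partial>lborel) = ennreal (\<bar>c\<bar> ^ DIM('a)) * (\<integral>\<^sup>+x. f (t + c *\<^sub>R x) \<partial>lborel)"
  by (subst lborel_affine[OF c, of t])
     (simp add: nn_integral_density nn_integral_distr nn_integral_cmult)

lemma nn_integral_real_even:
  fixes h :: "real \<Rightarrow> ennreal"
  assumes [measurable]: "h \<in> borel_measurable borel" and even: "\<And>t. h (- t) = h t"
  shows "(\<integral>\<^sup>+t. h t \<partial>lborel) = 2 * (\<integral>\<^sup>+t. h t * indicator {0<..} t \<partial>lborel)"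
proof -
  have "(\<integral>\<^sup>+t. h t * indicator {..<0} t \<partial>lborel) = (\<integral>\<^sup>+t. h t * indicator {0<..} t \<partial>lborel)"
    using nn_integral_real_affine[of "\<lambda>t. h t * indicator {..<0} t" "-1" 0]
    by (simp add: even indicator_def cong: if_cong)
  moreover have "(\<integral>\<^sup>+t. h t \<partial>lborel) =
      (\<integral>\<^sup>+t. h t * indicator {0<..} t + h t * indicator {..<0} t \<partial>lborel)"
    by (intro nn_integral_cong_AE eventually_mono[OF AE_lborel_singleton[of 0]])
       (auto split: split_indicator)
  ultimately show ?thesis by (simp add: nn_integral_add mult_2)
qed

lemma nn_integral_Gaussian_abs_powr:
  fixes \<alpha> :: real
  assumes "- 1 < \<alpha>"
  shows "(\<integral>\<^sup>+t. ennreal (exp (- t\<^sup>2) * \<bar>t\<bar> powr \<alpha>) \<partial>lborel) = ennreal (Gamma ((1 + \<alpha>) / 2))"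
proof -
  have "(\<integral>\<^sup>+t. ennreal (exp (- t\<^sup>2) * \<bar>t\<bar> powr \<alpha>) \<partial>lborel) =
      2 * (\<integral>\<^sup>+t. ennreal (exp (- t\<^sup>2) * \<bar>t\<bar> powr \<alpha>) * indicator {0<..} t \<partial>lborel)"
    by (rule nn_integral_real_even) auto
  also have "(\<integral>\<^sup>+t. ennreal (exp (- t\<^sup>2) * \<bar>t\<bar> powr \<alpha>) * indicator {0<..} t \<partial>lborel) =
      ennreal (Gamma ((1 + \<alpha>) / 2) / 2)"
    using nn_integral_Gaussian_powr[of "1 + \<alpha>"] assms
    by (auto intro!: nn_integral_cong simp: indicator_def simp flip: nn_integral_Gaussian_powr)
  finally show ?thesis
    by (simp flip: ennreal_mult' ennreal_numeral)
qed

lemma nn_integral_Gaussian: "(\<integral>\<^sup>+t. ennreal (exp (- (t::real)\<^sup>2)) \<partial>lborel) = ennreal (sqrt pi)"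
proof -
  have "(\<integral>\<^sup>+t. ennreal (exp (- (t::real)\<^sup>2)) \<partial>lborel) = (\<integral>\<^sup>+t. ennreal (exp (- t\<^sup>2) * \<bar>t\<bar> powr 0) \<partial>lborel)"
    by (intro nn_integral_cong_AE eventually_mono[OF AE_lborel_singleton[of 0]]) auto
  then show ?thesis
    by (simp add: nn_integral_Gaussian_abs_powr Gamma_one_half_real del: powr_zero_eq_one)
qed

text \<open>Rotational invariance of the planar Gaussian in one-dimensional steps. With r =
  \<open>sqrt (a\<^sup>2 + b\<^sup>2)\<close>, the substitution t = (r s - a x) / b turns the
  argument of f into r s; Fubini exchanges x and s, and the x-integral is then a Gaussian in an
  affine variable.\<close>

lemma nn_integral_Gaussian_combine:
  fixes a b :: real
  assumes [measurable]: "f \<in> borel_measurable borel"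
  shows "(\<integral>\<^sup>+x. \<integral>\<^sup>+t. ennreal (exp (- x\<^sup>2)) * ennreal (exp (- t\<^sup>2)) * f (a * x + b * t) \<partial>lborel \<partial>lborel) =
    ennreal (sqrt pi) * (\<integral>\<^sup>+t. ennreal (exp (- t\<^sup>2)) * f (sqrt (a\<^sup>2 + b\<^sup>2) * t) \<partial>lborel)"
proof (cases "b = 0")
  case True
  \<comment> \<open>For b = 0 the square root is the absolute value of a, so a negative a calls for
    a reflection of t.\<close>
  have "(\<integral>\<^sup>+t. ennreal (exp (- t\<^sup>2)) * f (\<bar>a\<bar> * t) \<partial>lborel) = (\<integral>\<^sup>+t. ennreal (exp (- t\<^sup>2)) * f (a * t) \<partial>lborel)"
    using nn_integral_real_affine[of "\<lambda>t. ennreal (exp (- t\<^sup>2)) * f (a * t)" "-1" 0]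
    by (cases "0 \<le> a") auto
  then show ?thesis
    using True by (simp add: mult_ac nn_integral_cmult nn_integral_multc nn_integral_Gaussian)
next
  case False
  define r where "r = sqrt (a\<^sup>2 + b\<^sup>2)"
  have r: "0 < r" "r\<^sup>2 = a\<^sup>2 + b\<^sup>2"
    using False by (auto simp: r_def add_nonneg_pos)
  have rb: "r / b \<noteq> 0" using r False by simp
  have "(\<integral>\<^sup>+t. ennreal (exp (- x\<^sup>2)) * ennreal (exp (- t\<^sup>2)) * f (a * x + b * t) \<partial>lborel) =
      (\<integral>\<^sup>+s. ennreal (exp (- s\<^sup>2)) * f (r * s) *
         (ennreal \<bar>r / b\<bar> * ennreal (exp (- (- (a * s / b) + r / b * x)\<^sup>2))) \<partial>lborel)" for x
  proof -
    have "(\<integral>\<^sup>+t. ennreal (exp (- x\<^sup>2)) * ennreal (exp (- t\<^sup>2)) * f (a * x + b * t) \<partial>lborel) =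
      ennreal \<bar>r / b\<bar> * (\<integral>\<^sup>+s. ennreal (exp (- x\<^sup>2)) * ennreal (exp (- (- (a * x / b) + r / b * s)\<^sup>2))
        * f (a * x + b * (- (a * x / b) + r / b * s)) \<partial>lborel)"
      using rb by (intro nn_integral_real_affine) auto
    also have "\<dots> = (\<integral>\<^sup>+s. ennreal \<bar>r / b\<bar> * (ennreal (exp (- x\<^sup>2)) * ennreal (exp (- (- (a * x / b) + r / b * s)\<^sup>2))
        * f (a * x + b * (- (a * x / b) + r / b * s))) \<partial>lborel)"
      by (rule nn_integral_cmult[symmetric]) measurable
    also have "\<dots> = (\<integral>\<^sup>+s. ennreal (exp (- s\<^sup>2)) * f (r * s) *
         (ennreal \<bar>r / b\<bar> * ennreal (exp (- (- (a * s / b) + r / b * x)\<^sup>2))) \<partial>lborel)"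
    proof (intro nn_integral_cong)
      fix s :: real
      \<comment> \<open>The last summand vanishes for the chosen r. With it the equation holds for
        arbitrary r, so field arithmetic alone proves it.\<close>
      have "x\<^sup>2 + (- (a * x / b) + r / b * s)\<^sup>2 = s\<^sup>2 + (- (a * s / b) + r / b * x)\<^sup>2 +
          (x\<^sup>2 - s\<^sup>2) * (a\<^sup>2 + b\<^sup>2 - r\<^sup>2) / b\<^sup>2"
        using False by (simp add: field_simps power2_eq_square)
      then have "exp (- x\<^sup>2) * exp (- (- (a * x / b) + r / b * s)\<^sup>2) =
          exp (- s\<^sup>2) * exp (- (- (a * s / b) + r / b * x)\<^sup>2)"
        using r by (simp flip: exp_add)
      moreover have "a * x + b * (- (a * x / b) + r / b * s) = r * s"
        using False by (simp add: field_simps)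
      ultimately show "ennreal \<bar>r / b\<bar> * (ennreal (exp (- x\<^sup>2)) * ennreal (exp (- (- (a * x / b) + r / b * s)\<^sup>2))
        * f (a * x + b * (- (a * x / b) + r / b * s))) = ennreal (exp (- s\<^sup>2)) * f (r * s) *
         (ennreal \<bar>r / b\<bar> * ennreal (exp (- (- (a * s / b) + r / b * x)\<^sup>2)))"
        by (simp add: mult_ac flip: ennreal_mult')
    qed
    finally show ?thesis .
  qed
  then have "(\<integral>\<^sup>+x. \<integral>\<^sup>+t. ennreal (exp (- x\<^sup>2)) * ennreal (exp (- t\<^sup>2)) * f (a * x + b * t) \<partial>lborel \<partial>lborel) =
     (\<integral>\<^sup>+x. \<integral>\<^sup>+s. ennreal (exp (- s\<^sup>2)) * f (r * s) *
         (ennreal \<bar>r / b\<bar> * ennreal (exp (- (- (a * s / b) + r / b * x)\<^sup>2))) \<partial>lborel \<partial>lborel)"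
    by simp
  also have "\<dots> = (\<integral>\<^sup>+s. \<integral>\<^sup>+x. ennreal (exp (- s\<^sup>2)) * f (r * s) *
         (ennreal \<bar>r / b\<bar> * ennreal (exp (- (- (a * s / b) + r / b * x)\<^sup>2))) \<partial>lborel \<partial>lborel)"
    by (rule lborel_pair.Fubini') measurable
  also have "\<dots> = (\<integral>\<^sup>+s. ennreal (exp (- s\<^sup>2)) * f (r * s) *
         (ennreal \<bar>r / b\<bar> * (\<integral>\<^sup>+x. ennreal (exp (- (- (a * s / b) + r / b * x)\<^sup>2)) \<partial>lborel)) \<partial>lborel)"
    by (simp add: nn_integral_cmult)
  also have "\<dots> = (\<integral>\<^sup>+s. ennreal (exp (- s\<^sup>2)) * f (r * s) * ennreal (sqrt pi) \<partial>lborel)"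
  proof -
    have "ennreal \<bar>r / b\<bar> * (\<integral>\<^sup>+x. ennreal (exp (- (- (a * s / b) + r / b * x)\<^sup>2)) \<partial>lborel) =
        (\<integral>\<^sup>+x. ennreal (exp (- x\<^sup>2)) \<partial>lborel)" for s
      by (rule nn_integral_real_affine[symmetric]) (use rb in auto)
    then show ?thesis by (simp only: nn_integral_Gaussian)
  qed
  also have "\<dots> = ennreal (sqrt pi) * (\<integral>\<^sup>+s. ennreal (exp (- s\<^sup>2)) * f (r * s) \<partial>lborel)"
    by (subst nn_integral_multc) (auto simp: mult.commute)
  finally show ?thesis by (simp add: r_def)
qed

text \<open>Each new coordinate is merged into the one-dimensional integral by
  \<open>nn_integral_Gaussian_combine\<close>, at the cost of a factor \<open>sqrt pi\<close>. The
  induction varies f because the hypothesis is applied to f shifted by \<open>c j * x\<close>. The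
  integral on the right already accounts for one coordinate, hence the exponent (card I - 1) / 2,
  which is correct for the empty set too.\<close>

lemma nn_integral_PiM_Gaussian_linear:
  fixes c :: "'i \<Rightarrow> real"
  assumes "finite I" and "f \<in> borel_measurable borel"
  shows "(\<integral>\<^sup>+z. ennreal (exp (- (\<Sum>i\<in>I. (z i)\<^sup>2))) * f (\<Sum>i\<in>I. c i * z i) \<partial>(\<Pi>\<^sub>M i\<in>I. lborel)) =
    ennreal (pi powr ((real (card I) - 1) / 2)) *
      (\<integral>\<^sup>+t. ennreal (exp (- t\<^sup>2)) * f (sqrt (\<Sum>i\<in>I. (c i)\<^sup>2) * t) \<partial>lborel)"
  using assms
proof (induction I arbitrary: f rule: finite_induct)
  case empty
  have "pi powr (-1 / 2) * sqrt pi = 1"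
    by (simp add: powr_half_sqrt[symmetric] flip: powr_add)
  then show ?case
    by (simp add: PiM_empty nn_integral_count_space_finite nn_integral_multc nn_integral_Gaussian
        mult.assoc[symmetric] flip: ennreal_mult')
next
  case (insert j I)
  note [measurable] = \<open>f \<in> borel_measurable borel\<close>
  interpret product_sigma_finite "\<lambda>_::'i. lborel :: real measure" by standard
  let ?n = "sqrt (\<Sum>i\<in>I. (c i)\<^sup>2)"
  have "(\<integral>\<^sup>+z. ennreal (exp (- (\<Sum>i\<in>insert j I. (z i)\<^sup>2))) * f (\<Sum>i\<in>insert j I. c i * z i)
      \<partial>(\<Pi>\<^sub>M i\<in>insert j I. lborel)) =
    (\<integral>\<^sup>+x. \<integral>\<^sup>+z. ennreal (exp (- (\<Sum>i\<in>insert j I. ((z(j := x)) i)\<^sup>2))) *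
      f (\<Sum>i\<in>insert j I. c i * (z(j := x)) i) \<partial>(\<Pi>\<^sub>M i\<in>I. lborel) \<partial>lborel)"
    using insert by (intro product_nn_integral_insert_rev) auto
  also have "\<dots> = (\<integral>\<^sup>+x. \<integral>\<^sup>+z. ennreal (exp (- x\<^sup>2)) * (ennreal (exp (- (\<Sum>i\<in>I. (z i)\<^sup>2))) *
      f (c j * x + (\<Sum>i\<in>I. c i * z i))) \<partial>(\<Pi>\<^sub>M i\<in>I. lborel) \<partial>lborel)"
  proof (intro nn_integral_cong)
    fix x :: real and z :: "'i \<Rightarrow> real"
    have "(\<Sum>i\<in>insert j I. ((z(j := x)) i)\<^sup>2) = x\<^sup>2 + (\<Sum>i\<in>I. (z i)\<^sup>2)"
      "(\<Sum>i\<in>insert j I. c i * (z(j := x)) i) = c j * x + (\<Sum>i\<in>I. c i * z i)"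
      using insert.hyps by (auto intro!: sum.cong)
    then show "ennreal (exp (- (\<Sum>i\<in>insert j I. ((z(j := x)) i)\<^sup>2))) *
        f (\<Sum>i\<in>insert j I. c i * (z(j := x)) i) = ennreal (exp (- x\<^sup>2)) *
        (ennreal (exp (- (\<Sum>i\<in>I. (z i)\<^sup>2))) * f (c j * x + (\<Sum>i\<in>I. c i * z i)))"
      by (simp only: minus_add_distrib exp_add ennreal_mult' exp_ge_zero mult.assoc)
  qed
  also have "\<dots> = (\<integral>\<^sup>+x. ennreal (exp (- x\<^sup>2)) * (ennreal (pi powr ((real (card I) - 1) / 2)) *
      (\<integral>\<^sup>+t. ennreal (exp (- t\<^sup>2)) * f (c j * x + ?n * t) \<partial>lborel)) \<partial>lborel)"
    using insert.IH[of "\<lambda>u. f (c j * x + u)" for x] by (simp add: nn_integral_cmult)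
  also have "\<dots> = ennreal (pi powr ((real (card I) - 1) / 2)) *
     (\<integral>\<^sup>+x. \<integral>\<^sup>+t. ennreal (exp (- x\<^sup>2)) * ennreal (exp (- t\<^sup>2)) * f (c j * x + ?n * t) \<partial>lborel \<partial>lborel)"
    by (subst nn_integral_cmult[symmetric])
       (auto intro!: nn_integral_cong simp: nn_integral_cmult mult.assoc
          mult.left_commute[of _ "ennreal (pi powr _)"])
  also have "\<dots> = ennreal (pi powr ((real (card I) - 1) / 2)) * (ennreal (sqrt pi) *
     (\<integral>\<^sup>+t. ennreal (exp (- t\<^sup>2)) * f (sqrt ((c j)\<^sup>2 + ?n\<^sup>2) * t) \<partial>lborel))"
    by (subst nn_integral_Gaussian_combine) auto
  also have "(c j)\<^sup>2 + ?n\<^sup>2 = (\<Sum>i\<in>insert j I. (c i)\<^sup>2)"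
    using insert.hyps by (simp add: sum_nonneg)
  also have "pi powr ((real (card I) - 1) / 2) * sqrt pi = pi powr ((real (card (insert j I)) - 1) / 2)"
    using insert.hyps by (simp add: powr_half_sqrt[symmetric] add_divide_distrib diff_divide_distrib flip: powr_add)
  then have "ennreal (pi powr ((real (card I) - 1) / 2)) * (ennreal (sqrt pi) * X) =
      ennreal (pi powr ((real (card (insert j I)) - 1) / 2)) * X" for X
    by (metis ennreal_mult' mult.assoc powr_ge_zero)
  finally show ?case .
qed

text \<open>\<open>lborel\<close> is a product over \<open>Basis\<close>, so an arbitrary unit
  vector needs no rotation: its coordinates serve as the coefficients of the linear form. This is
  the source of the power of pi in \<open>kappa\<close>; the choice f(t) = |t|^\<alpha> adds the
  factor Gamma((1 + \<alpha>) / 2).\<close>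

lemma nn_integral_Gaussian_inner:
  fixes e :: "'a::euclidean_space"
  assumes e: "norm e = 1" and [measurable]: "f \<in> borel_measurable borel"
  shows "(\<integral>\<^sup>+\<eta>. ennreal (exp (- (norm \<eta>)\<^sup>2)) * f (\<eta> \<bullet> e) \<partial>lborel) =
    ennreal (pi powr ((real DIM('a) - 1) / 2)) * (\<integral>\<^sup>+t. ennreal (exp (- t\<^sup>2)) * f t \<partial>lborel)"
proof -
  have sq: "(norm y)\<^sup>2 = (\<Sum>b\<in>Basis. (y \<bullet> b)\<^sup>2)" for y :: 'a
    unfolding power2_norm_eq_inner by (subst euclidean_inner) (simp add: power2_eq_square)
  have coord: "(\<Sum>b\<in>Basis. \<omega> b *\<^sub>R b) \<bullet> b = \<omega> b" if "b \<in> Basis" for \<omega> and b :: 'a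
    using that by (simp add: inner_sum_left inner_Basis if_distrib sum.delta cong: if_cong)
  have "(\<integral>\<^sup>+\<eta>. ennreal (exp (- (norm \<eta>)\<^sup>2)) * f (\<eta> \<bullet> e) \<partial>lborel) =
     (\<integral>\<^sup>+\<omega>. ennreal (exp (- (\<Sum>b\<in>Basis. (\<omega> b)\<^sup>2))) * f (\<Sum>b\<in>Basis. (e \<bullet> b) * \<omega> b)
       \<partial>(\<Pi>\<^sub>M b\<in>(Basis::'a set). lborel))"
    by (subst lborel_eq, subst nn_integral_distr)
       (auto simp: sq coord inner_commute[of _ e] inner_sum_right mult.commute)
  also have "\<dots> = ennreal (pi powr ((real DIM('a) - 1) / 2)) *
      (\<integral>\<^sup>+t. ennreal (exp (- t\<^sup>2)) * f (sqrt (\<Sum>b\<in>Basis. (e \<bullet> b)\<^sup>2) * t) \<partial>lborel)"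
    by (rule nn_integral_PiM_Gaussian_linear) auto
  finally show ?thesis using sq[of e] e by simp
qed

text \<open>The kernel becomes an integral of Gaussians over s, and y = \<eta> / s gives \<eta> a
  fixed Gaussian law. The Jacobian s^(-n) lowers the exponent of s from n + \<alpha> - 1 to \<alpha>
  - 1. The effect is that of polar coordinates, but the average over directions is a Gaussian
  integral, which factorises over coordinates.\<close>

lemma nn_integral_radial_kernel:
  fixes F :: "'a::euclidean_space \<Rightarrow> ennreal" and \<alpha> :: real
  assumes [measurable]: "F \<in> borel_measurable borel" and "0 < real DIM('a) + \<alpha>"
  shows "(\<integral>\<^sup>+y. F y * ennreal (norm y powr - (real DIM('a) + \<alpha>)) \<partial>lborel) =
    ennreal (2 / Gamma ((real DIM('a) + \<alpha>) / 2)) * (\<integral>\<^sup>+\<eta>. ennreal (exp (- (norm \<eta>)\<^sup>2)) *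
      (\<integral>\<^sup>+s. F ((1 / s) *\<^sub>R \<eta>) * (ennreal (s powr (\<alpha> - 1)) * indicator {0<..} s) \<partial>lborel) \<partial>lborel)"
proof -
  let ?\<beta> = "real DIM('a) + \<alpha>"
  let ?c = "2 / Gamma (?\<beta> / 2)"
  let ?k = "\<lambda>s y::'a. ennreal (exp (- (s * norm y)\<^sup>2) * s powr (?\<beta> - 1)) * indicator {0<..} s"
  have G: "0 < Gamma (?\<beta> / 2)" using assms by (intro Gamma_real_pos) auto
  then have c: "0 \<le> ?c" "Gamma (?\<beta> / 2) \<noteq> 0" by auto
  have "ennreal (norm y powr - ?\<beta>) = ennreal ?c * (\<integral>\<^sup>+s. ?k s y \<partial>lborel)" if "y \<noteq> 0" for y :: 'a
    using that assms c
    by (subst nn_integral_Gaussian_powr_scaled) (auto simp flip: ennreal_mult')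
  then have "(\<integral>\<^sup>+y. F y * ennreal (norm y powr - ?\<beta>) \<partial>lborel) =
      (\<integral>\<^sup>+y. F y * (ennreal ?c * (\<integral>\<^sup>+s. ?k s y \<partial>lborel)) \<partial>lborel)"
    by (intro nn_integral_cong_AE eventually_mono[OF AE_lborel_singleton[of 0]]) auto
  also have "\<dots> = ennreal ?c * (\<integral>\<^sup>+y. \<integral>\<^sup>+s. F y * ?k s y \<partial>lborel \<partial>lborel)"
    by (subst nn_integral_cmult[symmetric])
       (auto intro!: nn_integral_cong simp: nn_integral_cmult mult.left_commute[of _ "ennreal ?c"])
  also have "(\<integral>\<^sup>+y. \<integral>\<^sup>+s. F y * ?k s y \<partial>lborel \<partial>lborel) = (\<integral>\<^sup>+s. \<integral>\<^sup>+y. F y * ?k s y \<partial>lborel \<partial>lborel)"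
    by (rule lborel_pair.Fubini') measurable
  also have "\<dots> = (\<integral>\<^sup>+s. \<integral>\<^sup>+\<eta>. ennreal (exp (- (norm \<eta>)\<^sup>2)) *
      (F ((1 / s) *\<^sub>R \<eta>) * (ennreal (s powr (\<alpha> - 1)) * indicator {0<..} s)) \<partial>lborel \<partial>lborel)"
  proof (rule nn_integral_cong)
    fix s :: real
    show "(\<integral>\<^sup>+y. F y * ?k s y \<partial>lborel) = (\<integral>\<^sup>+\<eta>. ennreal (exp (- (norm \<eta>)\<^sup>2)) *
      (F ((1 / s) *\<^sub>R \<eta>) * (ennreal (s powr (\<alpha> - 1)) * indicator {0<..} s)) \<partial>lborel)"
    proof (cases "0 < s")
      case True
      have pw: "(1 / s) ^ DIM('a) * s powr (?\<beta> - 1) = s powr (\<alpha> - 1)"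
        using True by (simp add: powr_diff powr_add powr_realpow power_divide)
      have "(\<integral>\<^sup>+y. F y * ?k s y \<partial>lborel) = ennreal (\<bar>1 / s\<bar> ^ DIM('a)) *
          (\<integral>\<^sup>+\<eta>. F (0 + (1 / s) *\<^sub>R \<eta>) * ?k s (0 + (1 / s) *\<^sub>R \<eta>) \<partial>lborel)"
        using True by (intro nn_integral_lborel_affine) auto
      also have "\<dots> = (\<integral>\<^sup>+\<eta>. ennreal (\<bar>1 / s\<bar> ^ DIM('a)) *
          (F (0 + (1 / s) *\<^sub>R \<eta>) * ?k s (0 + (1 / s) *\<^sub>R \<eta>)) \<partial>lborel)"
        by (rule nn_integral_cmult[symmetric]) measurable
      also have "\<dots> = (\<integral>\<^sup>+\<eta>. ennreal (exp (- (norm \<eta>)\<^sup>2)) *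
        (F ((1 / s) *\<^sub>R \<eta>) * (ennreal (s powr (\<alpha> - 1)) * indicator {0<..} s)) \<partial>lborel)"
        using True pw
        by (intro nn_integral_cong) (simp add: mult_ac flip: ennreal_mult' pw)
      finally show ?thesis .
    qed simp
  qed
  also have "\<dots> = (\<integral>\<^sup>+\<eta>. \<integral>\<^sup>+s. ennreal (exp (- (norm \<eta>)\<^sup>2)) *
      (F ((1 / s) *\<^sub>R \<eta>) * (ennreal (s powr (\<alpha> - 1)) * indicator {0<..} s)) \<partial>lborel \<partial>lborel)"
    by (rule lborel_pair.Fubini'[symmetric]) measurable
  also have "\<dots> = (\<integral>\<^sup>+\<eta>. ennreal (exp (- (norm \<eta>)\<^sup>2)) *
      (\<integral>\<^sup>+s. F ((1 / s) *\<^sub>R \<eta>) * (ennreal (s powr (\<alpha> - 1)) * indicator {0<..} s) \<partial>lborel) \<partial>lborel)"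
    by (simp add: nn_integral_cmult)
  finally show ?thesis .
qed

section \<open>The one-dimensional inequality\<close>

text \<open>An incomplete Beta integral. T stands for the quotient of the two endpoints of a
  truncated ray and tends to infinity as the truncation is removed.\<close>

definition hardy_tail :: "real \<Rightarrow> real \<Rightarrow> real" where
  "hardy_tail \<alpha> T = integral {1..T} (\<lambda>\<tau>. (\<tau>\<^sup>2 - 1) powr ((\<alpha> - 1) / 2) / \<tau>\<^sup>2)"

lemma hardy_tail_integrable:
  assumes "1 < \<alpha>"
  shows "(\<lambda>\<tau>. (\<tau>\<^sup>2 - 1) powr ((\<alpha> - 1) / 2) / \<tau>\<^sup>2) integrable_on {1..T::real}"
  using assms by (intro integrable_continuous_real continuous_on_divide continuous_on_powr' continuous_intros) auto

lemma nn_integral_hardy_tail: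
  assumes "1 < \<alpha>"
  shows "(\<integral>\<^sup>+\<tau>. ennreal ((\<tau>\<^sup>2 - 1) powr ((\<alpha> - 1) / 2) / \<tau>\<^sup>2) * indicator {1..T} \<tau> \<partial>lborel) =
    ennreal (hardy_tail \<alpha> T)"
  unfolding hardy_tail_def using hardy_tail_integrable[OF assms]
  by (intro nn_integral_has_integral_lebesgue' integrable_integral) auto

lemma hardy_tail_mono:
  assumes "1 < \<alpha>" "S \<le> T"
  shows "hardy_tail \<alpha> S \<le> hardy_tail \<alpha> T"
  unfolding hardy_tail_def using assms hardy_tail_integrable[of \<alpha>]
  by (intro integral_subset_le) auto

lemma hardy_tail_limit:
  assumes "1 < \<alpha>" "\<alpha> < 2"
  shows "(\<lambda>k. hardy_tail \<alpha> (real k)) \<longlonglongrightarrow> Beta ((1 + \<alpha>) / 2) ((2 - \<alpha>) / 2) / 2"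
    and "hardy_tail \<alpha> T \<le> Beta ((1 + \<alpha>) / 2) ((2 - \<alpha>) / 2) / 2"
proof -
  let ?f = "\<lambda>\<tau>::real. ennreal ((\<tau>\<^sup>2 - 1) powr ((\<alpha> - 1) / 2) / \<tau>\<^sup>2)"
  let ?B = "Beta ((1 + \<alpha>) / 2) ((2 - \<alpha>) / 2) / 2"
  have B0: "0 \<le> ?B"
    using two_powr_le_Beta[OF assms] by (smt (verit) powr_ge_zero divide_nonneg_pos)
  have nn: "0 \<le> hardy_tail \<alpha> T" for T
    unfolding hardy_tail_def by (rule integral_nonneg) (use hardy_tail_integrable assms in auto)
  have lim: "(\<lambda>k. \<integral>\<^sup>+\<tau>. ?f \<tau> * indicator {1..real k} \<tau> \<partial>lborel) \<longlonglongrightarrow>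
      (\<integral>\<^sup>+\<tau>. ?f \<tau> * indicator {1..} \<tau> \<partial>lborel)"
  proof (rule nn_integral_LIMSEQ)
    show "incseq (\<lambda>k \<tau>. ?f \<tau> * indicator {1..real k} \<tau>)"
      by (auto simp: incseq_def le_fun_def split: split_indicator)
    show "(\<lambda>k. ?f \<tau> * indicator {1..real k} \<tau>) \<longlonglongrightarrow> ?f \<tau> * indicator {1..} \<tau>" for \<tau>
    proof (rule tendsto_eventually)
      show "\<forall>\<^sub>F k in sequentially. ?f \<tau> * indicator {1..real k} \<tau> = ?f \<tau> * indicator {1..} \<tau>"
        using eventually_ge_at_top[of "nat \<lceil>\<tau>\<rceil>"]
        by eventually_elim (auto split: split_indicator simp: nat_le_iff ceiling_le_iff)
    qed
  qed auto
  moreover have tot: "(\<integral>\<^sup>+\<tau>. ?f \<tau> * indicator {1..} \<tau> \<partial>lborel) = ennreal ?B"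
    unfolding nn_integral_Beta_half_line[OF assms, symmetric]
    by (intro nn_integral_cong_AE eventually_mono[OF AE_lborel_singleton[of 1]])
       (auto split: split_indicator)
  ultimately have "(\<lambda>k. ennreal (hardy_tail \<alpha> (real k))) \<longlonglongrightarrow> ennreal ?B"
    using assms by (simp add: nn_integral_hardy_tail)
  then show "(\<lambda>k. hardy_tail \<alpha> (real k)) \<longlonglongrightarrow> ?B"
    using nn B0 by (subst (asm) tendsto_ennreal_iff) auto
  have "ennreal (hardy_tail \<alpha> T) \<le> ennreal ?B"
    unfolding nn_integral_hardy_tail[OF assms(1), symmetric] tot[symmetric]
    by (intro nn_integral_mono) (auto split: split_indicator)
  then show "hardy_tail \<alpha> T \<le> ?B" using B0 by (simp add: ennreal_le_iff)
qed

text \<open>Integration by parts: with p = (\<alpha> - 1) / 2 and h = (\<tau>^2 - 1)^p, the function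
  (\<tau>^2 - 1)^(p + 1) / \<tau> has derivative \<alpha> h + h / \<tau>^2, since 2 p + 1 =
  \<alpha>. The integral of h, unbounded in T, is thus traded for the bounded
  \<open>hardy_tail\<close> and a boundary term of at most T^\<alpha>.\<close>

lemma nn_integral_power2_minus_one_le:
  fixes \<alpha> T :: real
  assumes "1 < \<alpha>" "1 < T"
  shows "\<exists>J\<ge>0. (\<integral>\<^sup>+\<tau>. ennreal ((\<tau>\<^sup>2 - 1) powr ((\<alpha> - 1) / 2)) * indicator {1<..<T} \<tau> \<partial>lborel) = ennreal J \<and>
    \<alpha> * J + hardy_tail \<alpha> T \<le> T powr \<alpha>"
proof -
  let ?p = "(\<alpha> - 1) / 2"
  let ?h = "\<lambda>\<tau>::real. (\<tau>\<^sup>2 - 1) powr ?p"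
  let ?F = "\<lambda>\<tau>::real. (\<tau>\<^sup>2 - 1) powr (?p + 1) / \<tau>"
  have int: "?h integrable_on {1..T}"
    using assms by (intro integrable_continuous_real continuous_on_powr' continuous_intros) auto
  define J where "J = integral {1..T} ?h"
  have "((\<lambda>\<tau>. \<alpha> * ?h \<tau> + ?h \<tau> / \<tau>\<^sup>2) has_integral ?F T - ?F 1) {1..T}"
  proof (rule fundamental_theorem_of_calculus_interior)
    show "continuous_on {1..T} ?F"
      using assms
      by (intro continuous_on_divide continuous_on_powr' continuous_intros) (auto intro: add_pos_pos)
    show "(?F has_vector_derivative \<alpha> * ?h \<tau> + ?h \<tau> / \<tau>\<^sup>2) (at \<tau>)" if "\<tau> \<in> {1<..<T}" for \<tau>
    proof -
      have "1 < \<tau>\<^sup>2" using that by (simp add: one_less_power)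
      then have "(\<tau>\<^sup>2 - 1) powr (?p + 1) = (\<tau>\<^sup>2 - 1) * ?h \<tau>"
        by (simp add: powr_mult_base add.commute)
      moreover have "(?F has_real_derivative ((?p + 1) * (\<tau>\<^sup>2 - 1) powr (?p + 1 - 1) * (2 * \<tau>) * \<tau> -
          (\<tau>\<^sup>2 - 1) powr (?p + 1)) / \<tau>\<^sup>2) (at \<tau>)"
        using that \<open>1 < \<tau>\<^sup>2\<close> by (auto intro!: derivative_eq_intros simp: power2_eq_square)
      moreover have "?p + 1 - 1 = ?p" by simp
      ultimately have "(?F has_real_derivative ((?p + 1) * ?h \<tau> * (2 * \<tau>) * \<tau> -
          (\<tau>\<^sup>2 - 1) * ?h \<tau>) / \<tau>\<^sup>2) (at \<tau>)" by simp
      moreover have "((?p + 1) * H * (2 * \<tau>) * \<tau> - (\<tau>\<^sup>2 - 1) * H) / \<tau>\<^sup>2 = \<alpha> * H + H / \<tau>\<^sup>2" for H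
        using that by (simp add: field_simps power2_eq_square)
      ultimately show ?thesis by (simp add: has_real_derivative_iff_has_vector_derivative)
    qed
  qed (use assms in auto)
  moreover have "((\<lambda>\<tau>. \<alpha> * ?h \<tau> + ?h \<tau> / \<tau>\<^sup>2) has_integral \<alpha> * J + hardy_tail \<alpha> T) {1..T}"
    unfolding J_def hardy_tail_def
    by (intro has_integral_add has_integral_mult_right integrable_integral int hardy_tail_integrable assms)
  ultimately have "\<alpha> * J + hardy_tail \<alpha> T = ?F T - ?F 1" by (rule has_integral_unique[symmetric])
  also have "\<dots> \<le> (T\<^sup>2) powr (?p + 1) / T"
    using assms by (auto intro!: divide_right_mono powr_mono2)
  also have "\<dots> = T powr \<alpha>"
    using assms by (simp add: power2_powr add_divide_distrib diff_divide_distrib powr_add powr_diff)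
  finally have le: "\<alpha> * J + hardy_tail \<alpha> T \<le> T powr \<alpha>" .
  have "(\<integral>\<^sup>+\<tau>. ennreal (?h \<tau>) * indicator {1<..<T} \<tau> \<partial>lborel) = ennreal J"
    unfolding J_def using int
    by (intro nn_integral_has_integral_lebesgue') (auto simp: has_integral_Icc_iff_Ioo[symmetric])
  moreover have "0 \<le> J" unfolding J_def by (rule integral_nonneg) (use int in auto)
  ultimately show ?thesis using le by blast
qed

lemma two_mult_powr_le:
  fixes N \<beta> \<alpha> :: real
  assumes "1 < \<alpha>" "\<bar>\<beta>\<bar> < N"
  shows "2 * N powr \<alpha> \<le> (N + \<beta>) powr \<alpha> + (N - \<beta>) powr \<alpha>"
proof -
  have "convex_on {0<..} (\<lambda>x::real. x powr \<alpha>)"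
    using assms by (intro powr_convex) auto
  from convex_onD[OF this, of "1 / 2" "N + \<beta>" "N - \<beta>"] assms
  show ?thesis by (simp add: field_simps)
qed

text \<open>In each t^\<alpha> = t * t^(\<alpha> - 1) the second factor is replaced by its largest
  value; the remaining factors m + \<beta> and m - \<beta> add up to 2 m. Equality holds for
  |\<beta>| = m, the configuration approached at the sphere, so the constant does not
  suffer.\<close>

lemma sum_powr_le:
  fixes m \<beta> \<alpha> :: real
  assumes "1 < \<alpha>" "\<bar>\<beta>\<bar> \<le> m"
  shows "(m + \<beta>) powr \<alpha> + (m - \<beta>) powr \<alpha> \<le> 2 * m * (m + \<bar>\<beta>\<bar>) powr (\<alpha> - 1)"
proof -
  have *: "t powr \<alpha> \<le> t * (m + \<bar>\<beta>\<bar>) powr (\<alpha> - 1)" if "0 \<le> t" "t \<le> m + \<bar>\<beta>\<bar>" for t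
  proof -
    have "t powr \<alpha> = t * t powr (\<alpha> - 1)" using that by (cases "t = 0") (auto simp: powr_mult_base)
    also have "\<dots> \<le> t * (m + \<bar>\<beta>\<bar>) powr (\<alpha> - 1)"
      using that assms by (intro mult_left_mono powr_mono2) auto
    finally show ?thesis .
  qed
  have "(m + \<beta>) powr \<alpha> \<le> (m + \<beta>) * (m + \<bar>\<beta>\<bar>) powr (\<alpha> - 1)"
    "(m - \<beta>) powr \<alpha> \<le> (m - \<beta>) * (m + \<bar>\<beta>\<bar>) powr (\<alpha> - 1)"
    by (rule *; use assms in linarith)+
  then show ?thesis by (simp add: algebra_simps)
qed

text \<open>J1 is the kernel integral over a pair of opposite rays; 2 J2 is the same with the weight
  relative to its value at the starting point. Both contain 2 N^\<alpha> / \<alpha>: as a lower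
  bound in J1 by convexity, as an upper bound in 2 J2 by integration by parts with \<sigma> = m
  \<tau>. These cancel in J1 - 2 J2, and only contributions of order m^\<alpha> are left.\<close>

lemma one_dim_hardy:
  fixes \<alpha> m N \<beta> :: real
  assumes \<alpha>: "1 < \<alpha>" "\<alpha> < 2" and m: "0 < m" "m < N" and \<beta>: "\<bar>\<beta>\<bar> \<le> m"
  obtains J1 J2 where
    "(\<integral>\<^sup>+\<sigma>. ennreal ((\<sigma> + \<beta>) powr (\<alpha> - 1) + (\<sigma> - \<beta>) powr (\<alpha> - 1)) * indicator {m<..<N} \<sigma> \<partial>lborel) = ennreal J1"
    "(\<integral>\<^sup>+\<sigma>. ennreal ((\<sigma>\<^sup>2 - m\<^sup>2) powr ((\<alpha> - 1) / 2)) * indicator {m<..<N} \<sigma> \<partial>lborel) = ennreal J2"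
    "0 \<le> J1" "0 \<le> J2" "J2 \<le> N powr \<alpha> / \<alpha>"
    "2 * J2 + 2 / \<alpha> * m powr \<alpha> * (hardy_tail \<alpha> (N / m) - (1 + \<bar>\<beta>\<bar> / m) powr (\<alpha> - 1)) \<le> J1"
proof -
  let ?p = "(\<alpha> - 1) / 2"
  let ?g = "\<lambda>\<sigma>. (\<sigma> + \<beta>) powr (\<alpha> - 1) + (\<sigma> - \<beta>) powr (\<alpha> - 1)"
  let ?F = "\<lambda>\<sigma>. ((\<sigma> + \<beta>) powr \<alpha> + (\<sigma> - \<beta>) powr \<alpha>) / \<alpha>"
  define J1 where "J1 = ?F N - ?F m"
  have "(?g has_integral J1) {m..N}"
    unfolding J1_def
  proof (rule fundamental_theorem_of_calculus_interior)
    show "continuous_on {m..N} ?F"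
      using \<alpha> \<beta> by (intro continuous_on_divide continuous_on_add continuous_on_powr' continuous_intros) auto
    show "(?F has_vector_derivative ?g \<sigma>) (at \<sigma>)" if "\<sigma> \<in> {m<..<N}" for \<sigma>
      unfolding has_real_derivative_iff_has_vector_derivative[symmetric]
      using that \<alpha> \<beta> by (auto intro!: derivative_eq_intros simp: field_simps)
  qed (use m in auto)
  then have int: "(?g has_integral J1) {m<..<N}" by (simp add: has_integral_Icc_iff_Ioo)
  have 1: "(\<integral>\<^sup>+\<sigma>. ennreal (?g \<sigma>) * indicator {m<..<N} \<sigma> \<partial>lborel) = ennreal J1"
    by (rule nn_integral_has_integral_lebesgue'[OF _ int]) simp
  have J1: "0 \<le> J1"
    by (rule has_integral_nonneg[OF int]) simp
  have T: "1 < N / m" using m by simp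
  from nn_integral_power2_minus_one_le[OF \<alpha>(1) T] obtain J where J: "0 \<le> J"
    "(\<integral>\<^sup>+\<tau>. ennreal ((\<tau>\<^sup>2 - 1) powr ?p) * indicator {1<..<N / m} \<tau> \<partial>lborel) = ennreal J"
    "\<alpha> * J + hardy_tail \<alpha> (N / m) \<le> (N / m) powr \<alpha>" by blast
  define J2 where "J2 = m powr \<alpha> * J"
  have "(\<integral>\<^sup>+\<sigma>. ennreal ((\<sigma>\<^sup>2 - m\<^sup>2) powr ?p) * indicator {m<..<N} \<sigma> \<partial>lborel) =
    ennreal \<bar>m\<bar> * (\<integral>\<^sup>+\<tau>. ennreal (((0 + m * \<tau>)\<^sup>2 - m\<^sup>2) powr ?p) * indicator {m<..<N} (0 + m * \<tau>) \<partial>lborel)"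
    using m by (intro nn_integral_real_affine) auto
  also have "\<dots> = ennreal \<bar>m\<bar> * (\<integral>\<^sup>+\<tau>. ennreal (m powr (\<alpha> - 1)) *
      (ennreal ((\<tau>\<^sup>2 - 1) powr ?p) * indicator {1<..<N / m} \<tau>) \<partial>lborel)"
  proof (rule arg_cong[where f = "times (ennreal \<bar>m\<bar>)"], rule nn_integral_cong)
    fix \<tau> :: real
    show "ennreal (((0 + m * \<tau>)\<^sup>2 - m\<^sup>2) powr ?p) * indicator {m<..<N} (0 + m * \<tau>) =
      ennreal (m powr (\<alpha> - 1)) * (ennreal ((\<tau>\<^sup>2 - 1) powr ?p) * indicator {1<..<N / m} \<tau>)"
    proof (cases "1 < \<tau>")
      case True
      have "1 < \<tau>\<^sup>2" using True by (simp add: one_less_power)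
      moreover have "(0 + m * \<tau>)\<^sup>2 - m\<^sup>2 = m\<^sup>2 * (\<tau>\<^sup>2 - 1)" by (simp add: field_simps)
      moreover have "(m\<^sup>2) powr ?p = m powr (\<alpha> - 1)"
        using m by (subst power2_powr) (simp_all add: diff_divide_distrib)
      ultimately have "((0 + m * \<tau>)\<^sup>2 - m\<^sup>2) powr ?p = m powr (\<alpha> - 1) * (\<tau>\<^sup>2 - 1) powr ?p"
        by (simp add: powr_mult)
      then show ?thesis
        using m True by (auto simp: ennreal_mult' field_simps split: split_indicator)
    next
      case False
      then show ?thesis using m by (auto split: split_indicator)
    qed
  qed
  also have "\<dots> = ennreal J2"
    using m J by (simp add: nn_integral_cmult J2_def powr_diff flip: ennreal_mult')
  finally have 2: "(\<integral>\<^sup>+\<sigma>. ennreal ((\<sigma>\<^sup>2 - m\<^sup>2) powr ?p) * indicator {m<..<N} \<sigma> \<partial>lborel) = ennreal J2" .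
  have J2: "0 \<le> J2" using J m by (simp add: J2_def)
  have "\<alpha> * J2 + m powr \<alpha> * hardy_tail \<alpha> (N / m) \<le> m powr \<alpha> * (N / m) powr \<alpha>"
    using mult_left_mono[OF J(3), of "m powr \<alpha>"] by (simp add: J2_def algebra_simps)
  then have b2: "\<alpha> * J2 + m powr \<alpha> * hardy_tail \<alpha> (N / m) \<le> N powr \<alpha>"
    using m by (simp add: powr_divide)
  have "0 \<le> hardy_tail \<alpha> (N / m)"
    unfolding hardy_tail_def by (rule integral_nonneg) (use hardy_tail_integrable \<alpha> in auto)
  then have "\<alpha> * J2 \<le> N powr \<alpha>" using b2 by (smt (verit) mult_nonneg_nonneg powr_ge_zero)
  then have 3: "J2 \<le> N powr \<alpha> / \<alpha>" using \<alpha> by (simp add: field_simps)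
  have "\<alpha> * J1 = ((N + \<beta>) powr \<alpha> + (N - \<beta>) powr \<alpha>) - ((m + \<beta>) powr \<alpha> + (m - \<beta>) powr \<alpha>)"
    using \<alpha> by (simp add: J1_def field_simps)
  also have "\<dots> \<ge> 2 * N powr \<alpha> - 2 * m * (m + \<bar>\<beta>\<bar>) powr (\<alpha> - 1)"
    using two_mult_powr_le[of \<alpha> \<beta> N] sum_powr_le[of \<alpha> \<beta> m] assms by auto
  finally have "2 * N powr \<alpha> - 2 * m * (m + \<bar>\<beta>\<bar>) powr (\<alpha> - 1) \<le> \<alpha> * J1" .
  moreover have "m * (m + \<bar>\<beta>\<bar>) powr (\<alpha> - 1) = m powr \<alpha> * (1 + \<bar>\<beta>\<bar> / m) powr (\<alpha> - 1)"
  proof -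
    have "(m + \<bar>\<beta>\<bar>) = m * (1 + \<bar>\<beta>\<bar> / m)" using m by (simp add: field_simps)
    then have "(m + \<bar>\<beta>\<bar>) powr (\<alpha> - 1) = m powr (\<alpha> - 1) * (1 + \<bar>\<beta>\<bar> / m) powr (\<alpha> - 1)"
      using m by (metis powr_mult)
    then show ?thesis using m by (simp add: powr_diff)
  qed
  ultimately have "\<alpha> * (2 * J2 + 2 / \<alpha> * m powr \<alpha> * (hardy_tail \<alpha> (N / m) - (1 + \<bar>\<beta>\<bar> / m) powr (\<alpha> - 1))) \<le> \<alpha> * J1"
    using b2 \<alpha> by (simp add: algebra_simps)
  then have 4: "2 * J2 + 2 / \<alpha> * m powr \<alpha> * (hardy_tail \<alpha> (N / m) - (1 + \<bar>\<beta>\<bar> / m) powr (\<alpha> - 1)) \<le> J1"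
    using \<alpha> by simp
  from that[OF 1 2 J1 J2 3 4] show ?thesis .
qed

section \<open>Rays from a point of the ball\<close>

definition ball_weight :: "real \<Rightarrow> 'a::euclidean_space \<Rightarrow> real" where
  "ball_weight \<alpha> x = (1 - (norm x)\<^sup>2) powr ((\<alpha> - 1) / 2)"

text \<open>The truncation of the singular kernel is by hyperbolic distance: it is symmetric in the two points, and on
  each ray it is symmetric about the centre of the completed square.\<close>

definition far :: "real \<Rightarrow> ('a::euclidean_space \<times> 'a) set" where
  "far \<delta> = {(x, y). norm x < 1 \<and> norm y < 1 \<and>
     \<delta> * (1 - (norm x)\<^sup>2) * (1 - (norm y)\<^sup>2) < (norm (x - y))\<^sup>2}"

text \<open>Serves the indicators of intervals whose endpoints depend on the direction
  \<eta>.\<close>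

lemma pred_greaterThanLessThan [measurable (raw)]:
  fixes f g h :: "'b \<Rightarrow> real"
  assumes [measurable]: "f \<in> borel_measurable M" "g \<in> borel_measurable M" "h \<in> borel_measurable M"
  shows "Measurable.pred M (\<lambda>z. h z \<in> {f z<..<g z})"
  unfolding greaterThanLessThan_iff by measurable

text \<open>For $s > 0$, the point $x + \eta/s$ lies in the unit ball if and only if $s - m$ exceeds \<open>chord_lo\<close>, where
  $m$ is \<open>chord_mid\<close>; such a point is far from $x$ if and only if $s - m$ is less than \<open>chord_hi\<close>.\<close>

definition chord_mid :: "'a::euclidean_space \<Rightarrow> 'a \<Rightarrow> real" where
  "chord_mid x \<eta> = (x \<bullet> \<eta>) / (1 - (norm x)\<^sup>2)"

definition chord_lo :: "'a::euclidean_space \<Rightarrow> 'a \<Rightarrow> real" where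
  "chord_lo x \<eta> = sqrt ((1 - (norm x)\<^sup>2) * (norm \<eta>)\<^sup>2 + (x \<bullet> \<eta>)\<^sup>2) / (1 - (norm x)\<^sup>2)"

definition chord_hi :: "real \<Rightarrow> 'a::euclidean_space \<Rightarrow> 'a \<Rightarrow> real" where
  "chord_hi \<delta> x \<eta> = sqrt ((chord_lo x \<eta>)\<^sup>2 + (norm \<eta>)\<^sup>2 / (\<delta> * (1 - (norm x)\<^sup>2)\<^sup>2))"

lemma ball_weight_measurable [measurable]: "ball_weight \<alpha> \<in> borel_measurable borel"
  unfolding ball_weight_def by measurable

lemma far_measurable [measurable]: "far \<delta> \<in> sets (borel \<Otimes>\<^sub>M borel)"
proof -
  have "far \<delta> = {z \<in> space (borel \<Otimes>\<^sub>M borel). norm (fst z) < 1 \<and> norm (snd z) < 1 \<and>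
     \<delta> * (1 - (norm (fst z))\<^sup>2) * (1 - (norm (snd z))\<^sup>2) < (norm (fst z - snd z))\<^sup>2}"
    by (auto simp: far_def space_pair_measure)
  also have "\<dots> \<in> sets (borel \<Otimes>\<^sub>M borel)" by measurable
  finally show ?thesis .
qed

lemma far_sym: "(x, y) \<in> far \<delta> \<longleftrightarrow> (y, x) \<in> far \<delta>"
  by (auto simp: far_def norm_minus_commute mult_ac)

lemma chord_measurable [measurable]:
  "chord_mid x \<in> borel_measurable borel"
  "chord_lo x \<in> borel_measurable borel"
  "chord_hi \<delta> x \<in> borel_measurable borel"
  unfolding chord_mid_def chord_lo_def chord_hi_def by measurable

section \<open>Algebra of the completed square\<close>

lemma one_minus_norm_sq_pos: "norm x < 1 \<Longrightarrow> 0 < 1 - (norm x)\<^sup>2"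
  by (simp add: power_less_one_iff)

lemma chord_lo_sq:
  assumes "norm x < 1"
  shows "(1 - (norm x)\<^sup>2)\<^sup>2 * (chord_lo x \<eta>)\<^sup>2 = (1 - (norm x)\<^sup>2) * (norm \<eta>)\<^sup>2 + (x \<bullet> \<eta>)\<^sup>2"
  using one_minus_norm_sq_pos[OF assms] by (simp add: chord_lo_def power_divide)

lemma chord_mid_sq:
  assumes "norm x < 1"
  shows "(1 - (norm x)\<^sup>2)\<^sup>2 * (chord_mid x \<eta>)\<^sup>2 = (x \<bullet> \<eta>)\<^sup>2"
  using one_minus_norm_sq_pos[OF assms] by (simp add: chord_mid_def power_divide)

lemma chord_lo_nonneg: "norm x < 1 \<Longrightarrow> 0 \<le> chord_lo x \<eta>"
  using one_minus_norm_sq_pos[of x] by (simp add: chord_lo_def)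

lemma chord_lo_pos: "norm x < 1 \<Longrightarrow> \<eta> \<noteq> 0 \<Longrightarrow> 0 < chord_lo x \<eta>"
  using one_minus_norm_sq_pos[of x] by (simp add: chord_lo_def add_pos_nonneg)

lemma inner_sq_le: "(x \<bullet> y)\<^sup>2 \<le> (norm x)\<^sup>2 * (norm y)\<^sup>2"
  using Cauchy_Schwarz_ineq[of x y] by (simp add: power2_norm_eq_inner)

text \<open>Cauchy-Schwarz. The factor \<open>norm x\<close>, in place of 1, is what later produces
  \<open>(1 + norm x) powr (\<alpha> - 1)\<close> instead of \<open>2 powr (\<alpha> - 1)\<close>
  and so the left-over integral of u^2.\<close>

lemma abs_chord_mid_le:
  assumes "norm x < 1"
  shows "\<bar>chord_mid x \<eta>\<bar> \<le> norm x * chord_lo x \<eta>"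
proof -
  have a: "0 < 1 - (norm x)\<^sup>2" by (rule one_minus_norm_sq_pos[OF assms])
  have "(1 - (norm x)\<^sup>2) * (x \<bullet> \<eta>)\<^sup>2 \<le> (1 - (norm x)\<^sup>2) * ((norm x)\<^sup>2 * (norm \<eta>)\<^sup>2)"
    using a inner_sq_le[of x \<eta>] by (intro mult_left_mono) auto
  then have "(1 - (norm x)\<^sup>2)\<^sup>2 * (chord_mid x \<eta>)\<^sup>2 \<le> (1 - (norm x)\<^sup>2)\<^sup>2 * (norm x * chord_lo x \<eta>)\<^sup>2"
    unfolding power_mult_distrib
    by (subst mult.left_commute, subst chord_lo_sq[OF assms], subst chord_mid_sq[OF assms])
       (simp add: algebra_simps)
  then have "(chord_mid x \<eta>)\<^sup>2 \<le> (norm x * chord_lo x \<eta>)\<^sup>2" using a by simp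
  then show ?thesis
    using chord_lo_nonneg[OF assms, of \<eta>] by (simp add: abs_le_square_iff[symmetric] abs_mult)
qed

lemma abs_chord_mid_le': "norm x < 1 \<Longrightarrow> \<bar>chord_mid x \<eta>\<bar> \<le> chord_lo x \<eta>"
  using abs_chord_mid_le[of x \<eta>] chord_lo_nonneg[of x \<eta>]
    mult_right_mono[of "norm x" 1 "chord_lo x \<eta>"] by auto

lemma chord_lo_sq_le:
  assumes "norm x < 1"
  shows "(1 - (norm x)\<^sup>2)\<^sup>2 * (chord_lo x \<eta>)\<^sup>2 \<le> (norm \<eta>)\<^sup>2"
  unfolding chord_lo_sq[OF assms] using inner_sq_le[of x \<eta>] by (simp add: algebra_simps)

lemma chord_identity:
  fixes x \<eta> :: "'a::euclidean_space"
  assumes "norm x < 1" "0 < s"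
  shows "s\<^sup>2 * (1 - (norm (x + (1 / s) *\<^sub>R \<eta>))\<^sup>2) =
    (1 - (norm x)\<^sup>2) * ((s - chord_mid x \<eta>)\<^sup>2 - (chord_lo x \<eta>)\<^sup>2)"
proof -
  let ?a = "1 - (norm x)\<^sup>2" and ?b = "x \<bullet> \<eta>"
  have a: "0 < ?a" by (rule one_minus_norm_sq_pos[OF assms(1)])
  have "(norm (x + (1 / s) *\<^sub>R \<eta>))\<^sup>2 = (norm x)\<^sup>2 + 2 * ?b / s + (norm \<eta>)\<^sup>2 / s\<^sup>2"
    using assms(2) unfolding power2_norm_eq_inner
    by (simp add: inner_add_left inner_add_right inner_commute[of \<eta> x] power2_eq_square field_simps)
  then have 1: "s\<^sup>2 * (1 - (norm (x + (1 / s) *\<^sub>R \<eta>))\<^sup>2) = ?a * s\<^sup>2 - 2 * ?b * s - (norm \<eta>)\<^sup>2"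
    using assms(2) by (simp add: field_simps power2_eq_square)
  have mid: "?a * chord_mid x \<eta> = ?b" using a by (simp add: chord_mid_def)
  have "?a * (?a * ((s - chord_mid x \<eta>)\<^sup>2 - (chord_lo x \<eta>)\<^sup>2)) =
      ?a * (?a * s\<^sup>2) - 2 * ?a * s * (?a * chord_mid x \<eta>) + (?a\<^sup>2 * (chord_mid x \<eta>)\<^sup>2 - ?a\<^sup>2 * (chord_lo x \<eta>)\<^sup>2)"
    by (simp add: power2_eq_square algebra_simps)
  also have "\<dots> = ?a * (?a * s\<^sup>2 - 2 * ?b * s - (norm \<eta>)\<^sup>2)"
    unfolding chord_lo_sq[OF assms(1)] chord_mid_sq[OF assms(1)] mid by (simp add: algebra_simps)
  finally show ?thesis using a 1 by simp
qed

text \<open>Multiplied by s^2, the two conditions bound \<sigma>^2 from below and from above, where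
  \<sigma> = s - \<open>chord_mid x \<eta>\<close>. Since s > 0 and \<open>chord_mid\<close> is at
  most \<open>chord_lo\<close> in absolute value, \<sigma> > -\<open>chord_lo x \<eta>\<close>, so
  the negative branch of the lower condition never occurs and one interval remains.\<close>

lemma far_chord_iff:
  fixes x \<eta> :: "'a::euclidean_space"
  assumes "norm x < 1" "0 < s" "0 < \<delta>"
  shows "(x, x + (1 / s) *\<^sub>R \<eta>) \<in> far \<delta> \<longleftrightarrow>
    chord_lo x \<eta> < s - chord_mid x \<eta> \<and> s - chord_mid x \<eta> < chord_hi \<delta> x \<eta>"
proof -
  let ?a = "1 - (norm x)\<^sup>2" and ?y = "x + (1 / s) *\<^sub>R \<eta>"
  let ?\<sigma> = "s - chord_mid x \<eta>" and ?m = "chord_lo x \<eta>"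
  have a: "0 < ?a" by (rule one_minus_norm_sq_pos[OF assms(1)])
  have m: "0 \<le> ?m" "- ?m < ?\<sigma>"
    using abs_chord_mid_le'[OF assms(1), of \<eta>] chord_lo_nonneg[OF assms(1), of \<eta>] assms(2) by auto
  have "norm ?y < 1 \<longleftrightarrow> 0 < s\<^sup>2 * (1 - (norm ?y)\<^sup>2)"
    using assms(2)
    by (auto simp: zero_less_mult_iff power2_less_1_iff intro: less_le_trans[OF _ norm_ge_zero])
  also have "\<dots> \<longleftrightarrow> ?m\<^sup>2 < ?\<sigma>\<^sup>2"
    unfolding chord_identity[OF assms(1,2)] using a by (simp add: zero_less_mult_iff)
  also have "\<dots> \<longleftrightarrow> \<bar>?m\<bar> < \<bar>?\<sigma>\<bar>" by (simp flip: abs_le_square_iff not_le)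
  also have "\<dots> \<longleftrightarrow> ?m < ?\<sigma>" using m by auto
  finally have 1: "norm ?y < 1 \<longleftrightarrow> ?m < ?\<sigma>" .
  have "\<delta> * ?a * (1 - (norm ?y)\<^sup>2) < (norm (x - ?y))\<^sup>2 \<longleftrightarrow>
     s\<^sup>2 * (\<delta> * ?a * (1 - (norm ?y)\<^sup>2)) < s\<^sup>2 * (norm (x - ?y))\<^sup>2"
    using assms(2) by (simp only: mult_less_cancel_left_pos zero_less_power)
  also have "s\<^sup>2 * (norm (x - ?y))\<^sup>2 = (norm \<eta>)\<^sup>2"
    using assms(2) by (simp add: power_divide)
  also have "s\<^sup>2 * (\<delta> * ?a * (1 - (norm ?y)\<^sup>2)) = \<delta> * ?a * (?a * (?\<sigma>\<^sup>2 - ?m\<^sup>2))"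
    unfolding chord_identity[OF assms(1,2), symmetric] by (simp only: mult_ac)
  also have "\<delta> * ?a * (?a * (?\<sigma>\<^sup>2 - ?m\<^sup>2)) < (norm \<eta>)\<^sup>2 \<longleftrightarrow> ?\<sigma>\<^sup>2 < ?m\<^sup>2 + (norm \<eta>)\<^sup>2 / (\<delta> * ?a\<^sup>2)"
  proof -
    have "\<delta> * A * (A * (S - M)) < G \<longleftrightarrow> S < M + G / (\<delta> * A\<^sup>2)" if "0 < A" for A S M G :: real
      using that assms(3) by (simp add: field_simps power2_eq_square)
    then show ?thesis using a by blast
  qed
  also have "\<dots> \<longleftrightarrow> sqrt (?\<sigma>\<^sup>2) < chord_hi \<delta> x \<eta>"
    unfolding chord_hi_def by (simp only: real_sqrt_less_iff)
  finally have 2: "\<delta> * ?a * (1 - (norm ?y)\<^sup>2) < (norm (x - ?y))\<^sup>2 \<longleftrightarrow> \<bar>?\<sigma>\<bar> < chord_hi \<delta> x \<eta>" by simp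
  show ?thesis using 1 2 assms(1) m by (auto simp: far_def)
qed

text \<open>\<open>chord_identity\<close> raised to the power (\<alpha> - 1) / 2. There s^2 turns
  into s^(\<alpha> - 1), exactly the factor that \<open>nn_integral_radial_kernel\<close> attaches
  to a ray; this dictates the exponent in \<open>ball_weight\<close>.\<close>

lemma ball_weight_chord:
  fixes x \<eta> :: "'a::euclidean_space"
  assumes "norm x < 1" "0 < s" "chord_lo x \<eta> < s - chord_mid x \<eta>"
  shows "ball_weight \<alpha> (x + (1 / s) *\<^sub>R \<eta>) * s powr (\<alpha> - 1) =
    ball_weight \<alpha> x * ((s - chord_mid x \<eta>)\<^sup>2 - (chord_lo x \<eta>)\<^sup>2) powr ((\<alpha> - 1) / 2)"
proof -
  let ?p = "(\<alpha> - 1) / 2" and ?w = "1 - (norm (x + (1 / s) *\<^sub>R \<eta>))\<^sup>2"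
  let ?q = "(s - chord_mid x \<eta>)\<^sup>2 - (chord_lo x \<eta>)\<^sup>2"
  have "0 < ?q" using assms chord_lo_nonneg[OF assms(1), of \<eta>] by (simp add: power_strict_mono)
  moreover have "0 < s\<^sup>2 * ?w"
    unfolding chord_identity[OF assms(1,2)]
    using one_minus_norm_sq_pos[OF assms(1)] calculation by simp
  then have "0 < ?w" using assms(2) by (simp add: zero_less_mult_iff)
  moreover have "(s\<^sup>2) powr ?p = s powr (\<alpha> - 1)"
    using assms(2) by (subst power2_powr) (simp_all add: diff_divide_distrib)
  ultimately show ?thesis
    using arg_cong[OF chord_identity[OF assms(1,2), of \<eta>], of "\<lambda>t. t powr ?p"]
      one_minus_norm_sq_pos[OF assms(1)]
    by (simp add: ball_weight_def powr_mult mult.commute)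
qed

text \<open>The shift s = \<sigma> + \<open>chord_mid x \<eta>\<close> centres every ray at its
  completed square. F = 1 gives the kernel integral and F = \<open>ball_weight \<alpha>\<close> the
  weighted one, over the same interval of \<sigma>.\<close>

lemma nn_integral_far:
  fixes x :: "'a::euclidean_space"
  assumes x: "norm x < 1" and \<delta>: "0 < \<delta>" and \<alpha>: "0 < real DIM('a) + \<alpha>"
    and [measurable]: "F \<in> borel_measurable borel"
  shows "(\<integral>\<^sup>+y. F y * ennreal (norm (x - y) powr - (real DIM('a) + \<alpha>)) * indicator (far \<delta>) (x, y) \<partial>lborel) =
    ennreal (2 / Gamma ((real DIM('a) + \<alpha>) / 2)) * (\<integral>\<^sup>+\<eta>. ennreal (exp (- (norm \<eta>)\<^sup>2)) *
      (\<integral>\<^sup>+\<sigma>. F (x + (1 / (\<sigma> + chord_mid x \<eta>)) *\<^sub>R \<eta>) * ennreal ((\<sigma> + chord_mid x \<eta>) powr (\<alpha> - 1)) *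
        indicator {chord_lo x \<eta><..<chord_hi \<delta> x \<eta>} \<sigma> \<partial>lborel) \<partial>lborel)"
proof -
  let ?k = "\<lambda>z::'a. ennreal (norm z powr - (real DIM('a) + \<alpha>))"
  let ?G = "\<lambda>z. F (x + z) * indicator (far \<delta>) (x, x + z)"
  have "(\<integral>\<^sup>+y. F y * ?k (x - y) * indicator (far \<delta>) (x, y) \<partial>lborel) =
      ennreal (\<bar>1\<bar> ^ DIM('a)) * (\<integral>\<^sup>+z. F (x + 1 *\<^sub>R z) * ?k (x - (x + 1 *\<^sub>R z)) *
        indicator (far \<delta>) (x, x + 1 *\<^sub>R z) \<partial>lborel)"
    by (rule nn_integral_lborel_affine) auto
  also have "\<dots> = (\<integral>\<^sup>+z. ?G z * ?k z \<partial>lborel)"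
    by (simp add: mult_ac)
  also have "\<dots> = ennreal (2 / Gamma ((real DIM('a) + \<alpha>) / 2)) * (\<integral>\<^sup>+\<eta>. ennreal (exp (- (norm \<eta>)\<^sup>2)) *
      (\<integral>\<^sup>+s. ?G ((1 / s) *\<^sub>R \<eta>) * (ennreal (s powr (\<alpha> - 1)) * indicator {0<..} s) \<partial>lborel) \<partial>lborel)"
    by (rule nn_integral_radial_kernel) (use \<alpha> in auto)
  also have "(\<lambda>\<eta>. \<integral>\<^sup>+s. ?G ((1 / s) *\<^sub>R \<eta>) * (ennreal (s powr (\<alpha> - 1)) * indicator {0<..} s) \<partial>lborel) =
    (\<lambda>\<eta>. \<integral>\<^sup>+\<sigma>. F (x + (1 / (\<sigma> + chord_mid x \<eta>)) *\<^sub>R \<eta>) * ennreal ((\<sigma> + chord_mid x \<eta>) powr (\<alpha> - 1)) *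
        indicator {chord_lo x \<eta><..<chord_hi \<delta> x \<eta>} \<sigma> \<partial>lborel)"
  proof
    fix \<eta> :: 'a
    let ?f = "\<lambda>s. F (x + (1 / s) *\<^sub>R \<eta>) * ennreal (s powr (\<alpha> - 1)) *
        indicator {chord_lo x \<eta><..<chord_hi \<delta> x \<eta>} (s - chord_mid x \<eta>)"
    have "(\<integral>\<^sup>+s. ?G ((1 / s) *\<^sub>R \<eta>) * (ennreal (s powr (\<alpha> - 1)) * indicator {0<..} s) \<partial>lborel) =
       (\<integral>\<^sup>+s. ?f s \<partial>lborel)"
    proof (rule nn_integral_cong)
      fix s :: real
      show "?G ((1 / s) *\<^sub>R \<eta>) * (ennreal (s powr (\<alpha> - 1)) * indicator {0<..} s) = ?f s"
      proof (cases "0 < s")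
        case True
        then show ?thesis
          using far_chord_iff[OF x True \<delta>, of \<eta>] by (auto simp: indicator_def mult_ac)
      next
        case False
        then show ?thesis
          using abs_chord_mid_le'[OF x, of \<eta>] by (auto simp: indicator_def)
      qed
    qed
    also have "\<dots> = ennreal \<bar>1\<bar> * (\<integral>\<^sup>+\<sigma>. ?f (chord_mid x \<eta> + 1 * \<sigma>) \<partial>lborel)"
      by (rule nn_integral_real_affine) auto
    finally show "(\<integral>\<^sup>+s. ?G ((1 / s) *\<^sub>R \<eta>) * (ennreal (s powr (\<alpha> - 1)) * indicator {0<..} s) \<partial>lborel) =
      (\<integral>\<^sup>+\<sigma>. F (x + (1 / (\<sigma> + chord_mid x \<eta>)) *\<^sub>R \<eta>) * ennreal ((\<sigma> + chord_mid x \<eta>) powr (\<alpha> - 1)) *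
        indicator {chord_lo x \<eta><..<chord_hi \<delta> x \<eta>} \<sigma> \<partial>lborel)"
      by (simp add: add.commute)
  qed
  finally show ?thesis .
qed

text \<open>Averaging over \<eta> and -\<eta>: \<open>chord_mid\<close> is odd in \<eta> while both
  endpoints are even. Only the symmetrised integrand is open to the convexity argument in
  \<open>one_dim_hardy\<close>, and halving the sum turns the constant 2 / Gamma into 1 /
  Gamma.\<close>

lemma nn_integral_far_kernel:
  fixes x :: "'a::euclidean_space"
  assumes x: "norm x < 1" and \<delta>: "0 < \<delta>" and \<alpha>: "0 < real DIM('a) + \<alpha>"
  shows "(\<integral>\<^sup>+y. ennreal (norm (x - y) powr - (real DIM('a) + \<alpha>)) * indicator (far \<delta>) (x, y) \<partial>lborel) =
    ennreal (1 / Gamma ((real DIM('a) + \<alpha>) / 2)) * (\<integral>\<^sup>+\<eta>. ennreal (exp (- (norm \<eta>)\<^sup>2)) *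
      (\<integral>\<^sup>+\<sigma>. ennreal ((\<sigma> + chord_mid x \<eta>) powr (\<alpha> - 1) + (\<sigma> - chord_mid x \<eta>) powr (\<alpha> - 1)) *
        indicator {chord_lo x \<eta><..<chord_hi \<delta> x \<eta>} \<sigma> \<partial>lborel) \<partial>lborel)"
proof -
  define h where "h \<eta> = ennreal (exp (- (norm \<eta>)\<^sup>2)) *
      (\<integral>\<^sup>+\<sigma>. ennreal ((\<sigma> + chord_mid x \<eta>) powr (\<alpha> - 1)) *
        indicator {chord_lo x \<eta><..<chord_hi \<delta> x \<eta>} \<sigma> \<partial>lborel)" for \<eta>
  have [measurable]: "h \<in> borel_measurable borel" unfolding h_def by measurable
  have G: "0 < Gamma ((real DIM('a) + \<alpha>) / 2)" using \<alpha> by (intro Gamma_real_pos) auto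
  have mid: "chord_mid x (- \<eta>) = - chord_mid x \<eta>" "chord_lo x (- \<eta>) = chord_lo x \<eta>"
    "chord_hi \<delta> x (- \<eta>) = chord_hi \<delta> x \<eta>" for \<eta>
    by (auto simp: chord_mid_def chord_lo_def chord_hi_def)
  have refl: "(\<integral>\<^sup>+\<eta>. h \<eta> \<partial>lborel) = (\<integral>\<^sup>+\<eta>. h (- \<eta>) \<partial>lborel)"
    using nn_integral_lborel_affine[of h "-1" 0] by simp
  have sum: "h \<eta> + h (- \<eta>) = ennreal (exp (- (norm \<eta>)\<^sup>2)) *
      (\<integral>\<^sup>+\<sigma>. ennreal ((\<sigma> + chord_mid x \<eta>) powr (\<alpha> - 1) + (\<sigma> - chord_mid x \<eta>) powr (\<alpha> - 1)) *
        indicator {chord_lo x \<eta><..<chord_hi \<delta> x \<eta>} \<sigma> \<partial>lborel)" for \<eta>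
    unfolding h_def mid norm_minus_cancel
    by (subst distrib_left[symmetric], subst nn_integral_add[symmetric])
       (auto simp: distrib_right)
  have "(\<integral>\<^sup>+y. ennreal (norm (x - y) powr - (real DIM('a) + \<alpha>)) * indicator (far \<delta>) (x, y) \<partial>lborel) =
      ennreal (2 / Gamma ((real DIM('a) + \<alpha>) / 2)) * (\<integral>\<^sup>+\<eta>. h \<eta> \<partial>lborel)"
    using nn_integral_far[OF x \<delta> \<alpha>, of "\<lambda>_. 1"] by (simp add: h_def)
  also have "\<dots> = ennreal (1 / Gamma ((real DIM('a) + \<alpha>) / 2)) * (2 * (\<integral>\<^sup>+\<eta>. h \<eta> \<partial>lborel))"
    using G by (simp add: mult.assoc[symmetric] flip: ennreal_mult' ennreal_numeral)
  also have "2 * (\<integral>\<^sup>+\<eta>. h \<eta> \<partial>lborel) = (\<integral>\<^sup>+\<eta>. h \<eta> + h (- \<eta>) \<partial>lborel)"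
    by (subst nn_integral_add) (auto simp: mult_2 simp flip: refl)
  finally show ?thesis by (simp only: sum)
qed

text \<open>By \<open>ball_weight_chord\<close> the integrand depends on \<sigma> only through
  \<sigma>^2 - \<open>chord_lo\<close>^2, so it is already even in \<eta>. The factor 2 is kept
  apart to match the two summands of \<open>nn_integral_far_kernel\<close>.\<close>

lemma nn_integral_far_weight:
  fixes x :: "'a::euclidean_space"
  assumes x: "norm x < 1" and \<delta>: "0 < \<delta>" and \<alpha>: "0 < real DIM('a) + \<alpha>"
  shows "(\<integral>\<^sup>+y. ennreal (ball_weight \<alpha> y) * ennreal (norm (x - y) powr - (real DIM('a) + \<alpha>)) *
      indicator (far \<delta>) (x, y) \<partial>lborel) =
    ennreal (1 / Gamma ((real DIM('a) + \<alpha>) / 2)) * (\<integral>\<^sup>+\<eta>. ennreal (exp (- (norm \<eta>)\<^sup>2)) *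
      (ennreal (ball_weight \<alpha> x) * (2 * (\<integral>\<^sup>+\<sigma>. ennreal ((\<sigma>\<^sup>2 - (chord_lo x \<eta>)\<^sup>2) powr ((\<alpha> - 1) / 2)) *
        indicator {chord_lo x \<eta><..<chord_hi \<delta> x \<eta>} \<sigma> \<partial>lborel))) \<partial>lborel)"
proof -
  have G: "0 < Gamma ((real DIM('a) + \<alpha>) / 2)" using \<alpha> by (intro Gamma_real_pos) auto
  have w: "0 \<le> ball_weight \<alpha> x" by (simp add: ball_weight_def)
  have *: "ennreal (ball_weight \<alpha> (x + (1 / (\<sigma> + chord_mid x \<eta>)) *\<^sub>R \<eta>)) *
      ennreal ((\<sigma> + chord_mid x \<eta>) powr (\<alpha> - 1)) * indicator {chord_lo x \<eta><..<chord_hi \<delta> x \<eta>} \<sigma> =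
      ennreal (ball_weight \<alpha> x) * (ennreal ((\<sigma>\<^sup>2 - (chord_lo x \<eta>)\<^sup>2) powr ((\<alpha> - 1) / 2)) *
        indicator {chord_lo x \<eta><..<chord_hi \<delta> x \<eta>} \<sigma>)" for \<sigma> \<eta>
  proof (cases "chord_lo x \<eta> < \<sigma>")
    case True
    then have "0 < \<sigma> + chord_mid x \<eta>" using abs_chord_mid_le'[OF x, of \<eta>] by linarith
    from ball_weight_chord[OF x this, of \<eta> \<alpha>] True show ?thesis
      by (simp add: mult.assoc[symmetric] flip: ennreal_mult'')
  qed simp
  have "(\<integral>\<^sup>+\<eta>. ennreal (exp (- (norm \<eta>)\<^sup>2)) *
      (ennreal (ball_weight \<alpha> x) * (2 * (\<integral>\<^sup>+\<sigma>. ennreal ((\<sigma>\<^sup>2 - (chord_lo x \<eta>)\<^sup>2) powr ((\<alpha> - 1) / 2)) *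
        indicator {chord_lo x \<eta><..<chord_hi \<delta> x \<eta>} \<sigma> \<partial>lborel))) \<partial>lborel) =
    2 * (\<integral>\<^sup>+\<eta>. ennreal (exp (- (norm \<eta>)\<^sup>2)) *
      (\<integral>\<^sup>+\<sigma>. ennreal (ball_weight \<alpha> x) * (ennreal ((\<sigma>\<^sup>2 - (chord_lo x \<eta>)\<^sup>2) powr ((\<alpha> - 1) / 2)) *
        indicator {chord_lo x \<eta><..<chord_hi \<delta> x \<eta>} \<sigma>) \<partial>lborel) \<partial>lborel)"
    by (subst nn_integral_cmult[symmetric], measurable)
       (auto intro!: nn_integral_cong simp: nn_integral_cmult mult_ac)
  then show ?thesis
    using G by (subst nn_integral_far[OF x \<delta> \<alpha>], measurable)
       (simp add: * mult.assoc[symmetric] flip: ennreal_mult' ennreal_numeral)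
qed

text \<open>\<open>one_dim_hardy\<close> with all dependence on \<eta> made explicit. With a = 1 -
  |x|^2 and m = \<open>chord_lo x \<eta>\<close>, the product a m lies between the component of
  \<eta> along x and the norm of \<eta>. The main term uses the lower bound, which becomes an
  equality in the limit |x| = 1 and so does not spoil the constant; the truncation error uses the
  upper one.\<close>

lemma chord_inequality:
  fixes x \<eta> e :: "'a::euclidean_space"
  assumes \<alpha>: "1 < \<alpha>" "\<alpha> < 2" and x: "norm x < 1" and \<delta>: "0 < \<delta>" and \<eta>: "\<eta> \<noteq> 0"
    and e: "norm e = 1" "x = norm x *\<^sub>R e"
  defines "B \<equiv> Beta ((1 + \<alpha>) / 2) ((2 - \<alpha>) / 2) / 2"
  obtains J1 J2 where
    "(\<integral>\<^sup>+\<sigma>. ennreal ((\<sigma> + chord_mid x \<eta>) powr (\<alpha> - 1) + (\<sigma> - chord_mid x \<eta>) powr (\<alpha> - 1)) *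
        indicator {chord_lo x \<eta><..<chord_hi \<delta> x \<eta>} \<sigma> \<partial>lborel) = ennreal J1"
    "(\<integral>\<^sup>+\<sigma>. ennreal ((\<sigma>\<^sup>2 - (chord_lo x \<eta>)\<^sup>2) powr ((\<alpha> - 1) / 2)) *
        indicator {chord_lo x \<eta><..<chord_hi \<delta> x \<eta>} \<sigma> \<partial>lborel) = ennreal J2"
    "0 \<le> J1" "0 \<le> J2"
    "J2 \<le> (1 - (norm x)\<^sup>2) powr - \<alpha> * norm \<eta> powr \<alpha> * ((1 + 1 / \<delta>) powr (\<alpha> / 2) / \<alpha>)"
    "2 * J2 + 2 / \<alpha> * (1 - (norm x)\<^sup>2) powr - \<alpha> * \<bar>\<eta> \<bullet> e\<bar> powr \<alpha> * (B - (1 + norm x) powr (\<alpha> - 1)) \<le>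
      J1 + 2 / \<alpha> * (1 - (norm x)\<^sup>2) powr - \<alpha> * norm \<eta> powr \<alpha> * (B - hardy_tail \<alpha> (sqrt (1 + 1 / \<delta>)))"
proof -
  let ?a = "1 - (norm x)\<^sup>2" and ?m = "chord_lo x \<eta>" and ?N = "chord_hi \<delta> x \<eta>" and ?\<beta> = "chord_mid x \<eta>"
  let ?T = "sqrt (1 + 1 / \<delta>)"
  have a: "0 < ?a" by (rule one_minus_norm_sq_pos[OF x])
  have m: "0 < ?m" by (rule chord_lo_pos[OF x \<eta>])
  have g: "0 < norm \<eta>" using \<eta> by simp
  have Nsq: "?N\<^sup>2 = ?m\<^sup>2 + (norm \<eta>)\<^sup>2 / (\<delta> * ?a\<^sup>2)" and N0: "0 \<le> ?N"
    using \<delta> by (auto simp: chord_hi_def)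
  have "?m\<^sup>2 < ?N\<^sup>2" unfolding Nsq using a g \<delta> by simp
  then have mN: "?m < ?N" using N0 by (rule power_less_imp_less_base)
  have mle: "?m\<^sup>2 \<le> (norm \<eta>)\<^sup>2 / ?a\<^sup>2"
    using chord_lo_sq_le[OF x, of \<eta>] a by (simp add: field_simps)
  have m_up: "?m \<le> norm \<eta> / ?a"
    by (rule power2_le_imp_le) (use mle a in \<open>auto simp: power_divide\<close>)
  have N_up: "?N \<le> norm \<eta> / ?a * ?T"
  proof (rule power2_le_imp_le)
    show "?N\<^sup>2 \<le> (norm \<eta> / ?a * ?T)\<^sup>2"
    proof -
      have "X / A * (1 + 1 / \<delta>) = X / A + X / (\<delta> * A)" for X A :: real
        by (simp add: distrib_left mult.commute)
      then show ?thesis unfolding Nsq using mle \<delta> by (simp add: power_mult_distrib power_divide)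
    qed
  qed (use a \<delta> in auto)
  \<comment> \<open>By definition N^2 = m^2 + |\<eta>|^2 / (\<delta> a^2), and m is at most |\<eta>|
    / a. The quotient N / m thus has a lower bound depending on \<delta> alone, and a single value
    of \<open>hardy_tail\<close> serves all x and \<eta>.\<close>
  have "(1 + 1 / \<delta>) * ?m\<^sup>2 \<le> ?N\<^sup>2"
    unfolding Nsq using divide_right_mono[OF mle, of \<delta>] \<delta>
    by (simp add: distrib_right mult.commute[of "?a\<^sup>2"])
  then have "(?T * ?m)\<^sup>2 \<le> ?N\<^sup>2" using \<delta> by (simp add: power_mult_distrib)
  then have "?T * ?m \<le> ?N" by (rule power2_le_imp_le[OF _ N0])
  then have T: "?T \<le> ?N / ?m" using m by (simp add: field_simps)
  have in_e: "x \<bullet> \<eta> = norm x * (\<eta> \<bullet> e)" using arg_cong[OF e(2), of "\<lambda>z. z \<bullet> \<eta>"] by (simp only: inner_scaleR_left inner_commute[of e])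
  have "(\<eta> \<bullet> e)\<^sup>2 \<le> (norm \<eta>)\<^sup>2" using inner_sq_le[of \<eta> e] e(1) by simp
  then have "?a * (\<eta> \<bullet> e)\<^sup>2 \<le> ?a * (norm \<eta>)\<^sup>2" using a by (intro mult_left_mono) auto
  then have "(\<eta> \<bullet> e)\<^sup>2 \<le> ?a\<^sup>2 * ?m\<^sup>2"
    unfolding chord_lo_sq[OF x] in_e by (simp add: power_mult_distrib algebra_simps)
  then have "(\<bar>\<eta> \<bullet> e\<bar> / ?a)\<^sup>2 \<le> ?m\<^sup>2"
    using a by (simp add: power_divide field_simps)
  then have "\<bar>\<eta> \<bullet> e\<bar> / ?a \<le> ?m" by (rule power2_le_imp_le[OF _ less_imp_le[OF m]])
  then have m_lo: "?a powr - \<alpha> * \<bar>\<eta> \<bullet> e\<bar> powr \<alpha> \<le> ?m powr \<alpha>"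
    using powr_mono2[of \<alpha> "\<bar>\<eta> \<bullet> e\<bar> / ?a" ?m] a \<alpha> by (simp add: powr_divide powr_minus field_simps)
  have m_up': "?m powr \<alpha> \<le> ?a powr - \<alpha> * norm \<eta> powr \<alpha>"
    using powr_mono2[OF _ _ m_up, of \<alpha>] m a \<alpha> by (simp add: powr_divide powr_minus field_simps)
  have N_up': "?N powr \<alpha> \<le> ?a powr - \<alpha> * norm \<eta> powr \<alpha> * (1 + 1 / \<delta>) powr (\<alpha> / 2)"
  proof -
    have "?T powr \<alpha> = (1 + 1 / \<delta>) powr (\<alpha> / 2)"
      using \<delta> by (simp add: powr_half_sqrt[symmetric] powr_powr)
    moreover have "(norm \<eta> / ?a * ?T) powr \<alpha> = ?a powr - \<alpha> * norm \<eta> powr \<alpha> * ?T powr \<alpha>"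
      using a \<delta> by (subst powr_mult) (auto simp: powr_divide powr_minus_divide)
    ultimately show ?thesis
      using powr_mono2[OF _ N0 N_up, of \<alpha>] \<alpha> by simp
  qed
  obtain J1 J2 where J:
    "(\<integral>\<^sup>+\<sigma>. ennreal ((\<sigma> + ?\<beta>) powr (\<alpha> - 1) + (\<sigma> - ?\<beta>) powr (\<alpha> - 1)) * indicator {?m<..<?N} \<sigma> \<partial>lborel) = ennreal J1"
    "(\<integral>\<^sup>+\<sigma>. ennreal ((\<sigma>\<^sup>2 - ?m\<^sup>2) powr ((\<alpha> - 1) / 2)) * indicator {?m<..<?N} \<sigma> \<partial>lborel) = ennreal J2"
    "0 \<le> J1" "0 \<le> J2" "J2 \<le> ?N powr \<alpha> / \<alpha>"
    "2 * J2 + 2 / \<alpha> * ?m powr \<alpha> * (hardy_tail \<alpha> (?N / ?m) - (1 + \<bar>?\<beta>\<bar> / ?m) powr (\<alpha> - 1)) \<le> J1"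
    by (rule one_dim_hardy[OF \<alpha> m mN abs_chord_mid_le'[OF x]]) (rule that; assumption)
  have J2: "J2 \<le> ?a powr - \<alpha> * norm \<eta> powr \<alpha> * ((1 + 1 / \<delta>) powr (\<alpha> / 2) / \<alpha>)"
    using J(5) divide_right_mono[OF N_up', of \<alpha>] \<alpha> by simp
  define err where "err = B - hardy_tail \<alpha> ?T"
  have err: "0 \<le> err" using hardy_tail_limit(2)[OF \<alpha>, of ?T] by (simp add: err_def B_def)
  have "hardy_tail \<alpha> ?T \<le> hardy_tail \<alpha> (?N / ?m)" by (rule hardy_tail_mono[OF \<alpha>(1) T])
  moreover have "(1 + \<bar>?\<beta>\<bar> / ?m) powr (\<alpha> - 1) \<le> (1 + norm x) powr (\<alpha> - 1)"
    using abs_chord_mid_le[OF x, of \<eta>] m \<alpha> by (intro powr_mono2) (auto simp: field_simps)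
  ultimately have "B - (1 + norm x) powr (\<alpha> - 1) - err \<le>
      hardy_tail \<alpha> (?N / ?m) - (1 + \<bar>?\<beta>\<bar> / ?m) powr (\<alpha> - 1)"
    by (simp add: err_def)
  then have "2 / \<alpha> * ?m powr \<alpha> * (B - (1 + norm x) powr (\<alpha> - 1) - err) \<le>
      2 / \<alpha> * ?m powr \<alpha> * (hardy_tail \<alpha> (?N / ?m) - (1 + \<bar>?\<beta>\<bar> / ?m) powr (\<alpha> - 1))"
    using \<alpha> by (intro mult_left_mono) auto
  \<comment> \<open>The coefficient has to be nonnegative before \<open>?m powr \<alpha>\<close> may
    be replaced by its lower bound.\<close>
  moreover have "(1 + norm x) powr (\<alpha> - 1) \<le> B"
  proof -
    have "(1 + norm x) powr (\<alpha> - 1) \<le> 2 powr (\<alpha> - 1)" using x \<alpha> by (intro powr_mono2) auto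
    also have "\<dots> \<le> B" using two_powr_le_Beta[OF \<alpha>] by (simp add: B_def powr_diff)
    finally show ?thesis .
  qed
  then have "2 / \<alpha> * (?a powr - \<alpha> * \<bar>\<eta> \<bullet> e\<bar> powr \<alpha>) * (B - (1 + norm x) powr (\<alpha> - 1)) \<le>
      2 / \<alpha> * ?m powr \<alpha> * (B - (1 + norm x) powr (\<alpha> - 1))"
    using m_lo \<alpha> by (intro mult_left_mono mult_right_mono) auto
  moreover have "2 / \<alpha> * ?m powr \<alpha> * err \<le> 2 / \<alpha> * (?a powr - \<alpha> * norm \<eta> powr \<alpha>) * err"
    using m_up' \<alpha> err by (intro mult_left_mono mult_right_mono) auto
  ultimately have "2 * J2 + 2 / \<alpha> * ?a powr - \<alpha> * \<bar>\<eta> \<bullet> e\<bar> powr \<alpha> * (B - (1 + norm x) powr (\<alpha> - 1)) \<le>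
      J1 + 2 / \<alpha> * ?a powr - \<alpha> * norm \<eta> powr \<alpha> * err"
    using J(6) right_diff_distrib[of "2 / \<alpha> * ?m powr \<alpha>" "B - (1 + norm x) powr (\<alpha> - 1)" err]
    unfolding mult.assoc by linarith
  from that[OF J(1,2,3,4) J2 this[unfolded err_def]] show ?thesis .
qed

text \<open>Only finiteness matters: the value enters an error that vanishes with \<delta> and a
  bound that justifies a cancellation. Up to a constant the power \<alpha> is dominated by the
  square, which splits into coordinate moments.\<close>

lemma Gaussian_norm_moment_finite:
  assumes "0 \<le> \<alpha>" "\<alpha> \<le> 2"
  obtains K where "0 \<le> K"
    "(\<integral>\<^sup>+\<eta>. ennreal (exp (- (norm \<eta>)\<^sup>2)) * ennreal (norm \<eta> powr \<alpha>) \<partial>(lborel :: 'a::euclidean_space measure)) = ennreal K"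
proof -
  let ?e = "\<lambda>\<eta>::'a. ennreal (exp (- (norm \<eta>)\<^sup>2))"
  obtain b0 :: 'a where b0: "b0 \<in> Basis" using nonempty_Basis by blast
  have m0: "(\<integral>\<^sup>+\<eta>. ?e \<eta> * 1 \<partial>lborel) < \<infinity>"
    using nn_integral_Gaussian_inner[of b0 "\<lambda>_. 1"] b0
    by (simp add: nn_integral_Gaussian ennreal_mult_less_top)
  have m2: "(\<integral>\<^sup>+\<eta>. ?e \<eta> * ennreal ((\<eta> \<bullet> b)\<^sup>2) \<partial>lborel) < \<infinity>" if "b \<in> Basis" for b
  proof -
    have "(\<integral>\<^sup>+t. ennreal (exp (- t\<^sup>2)) * ennreal (t\<^sup>2) \<partial>lborel) = ennreal (Gamma ((1 + 2) / 2))"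
      using nn_integral_Gaussian_abs_powr[of 2]
      by (simp add: ennreal_mult' powr_numeral)
    then show ?thesis
      using nn_integral_Gaussian_inner[of b "\<lambda>t. ennreal (t\<^sup>2)"] that
      by (simp add: ennreal_mult_less_top)
  qed
  have "(\<integral>\<^sup>+\<eta>. ?e \<eta> * ennreal (norm \<eta> powr \<alpha>) \<partial>lborel) \<le>
      (\<integral>\<^sup>+\<eta>. ?e \<eta> * 1 + (\<Sum>b\<in>Basis. ?e \<eta> * ennreal ((\<eta> \<bullet> b)\<^sup>2)) \<partial>lborel)"
  proof (rule nn_integral_mono)
    fix \<eta> :: 'a
    have "norm \<eta> powr \<alpha> \<le> 1 + (norm \<eta>)\<^sup>2"
    proof (cases "norm \<eta> \<le> 1")
      case True
      then have "norm \<eta> powr \<alpha> \<le> 1 powr \<alpha>" using assms by (intro powr_mono2) auto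
      then show ?thesis by (simp add: add_increasing2)
    next
      case False
      then have "norm \<eta> powr \<alpha> \<le> norm \<eta> powr 2" using assms by (intro powr_mono) auto
      then show ?thesis using False by (simp add: powr_numeral)
    qed
    also have "(norm \<eta>)\<^sup>2 = (\<Sum>b\<in>Basis. (\<eta> \<bullet> b)\<^sup>2)"
      unfolding power2_norm_eq_inner by (subst euclidean_inner) (simp add: power2_eq_square)
    finally have "ennreal (norm \<eta> powr \<alpha>) \<le> ennreal (1 + (\<Sum>b\<in>Basis. (\<eta> \<bullet> b)\<^sup>2))"
      by (rule ennreal_leI)
    also have "\<dots> = 1 + (\<Sum>b\<in>Basis. ennreal ((\<eta> \<bullet> b)\<^sup>2))"
      by (simp add: sum_nonneg sum_ennreal)
    finally show "?e \<eta> * ennreal (norm \<eta> powr \<alpha>) \<le> ?e \<eta> * 1 + (\<Sum>b\<in>Basis. ?e \<eta> * ennreal ((\<eta> \<bullet> b)\<^sup>2))"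
      unfolding sum_distrib_left[symmetric] distrib_left[symmetric] by (rule mult_left_mono) simp
  qed
  also have "\<dots> < \<infinity>"
    using m0 m2 by (subst nn_integral_add) (auto simp: nn_integral_sum ennreal_add_less_top less_top)
  finally show ?thesis using that by (cases "\<integral>\<^sup>+\<eta>. ?e \<eta> * ennreal (norm \<eta> powr \<alpha>) \<partial>lborel") auto
qed

text \<open>The Gaussian average of \<open>chord_inequality\<close>; c carries the moment of order
  \<alpha> of one coordinate. The estimate is additive because the untruncated integrals need not be
  finite. The separate upper bound on the weighted integral makes it possible to cancel that
  integral later.\<close>

lemma hardy_potential:
  fixes \<alpha> :: real
  assumes \<alpha>: "1 < \<alpha>" "\<alpha> < 2"
  defines "B \<equiv> Beta ((1 + \<alpha>) / 2) ((2 - \<alpha>) / 2) / 2"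
    and "c \<equiv> 2 / \<alpha> * (pi powr ((real DIM('a::euclidean_space) - 1) / 2) * Gamma ((1 + \<alpha>) / 2) /
      Gamma ((real DIM('a) + \<alpha>) / 2))"
  obtains K where "0 \<le> K"
    "\<And>(x::'a) \<delta>. norm x < 1 \<Longrightarrow> 0 < \<delta> \<Longrightarrow>
      (\<integral>\<^sup>+y. ennreal (ball_weight \<alpha> y) * ennreal (norm (x - y) powr - (real DIM('a) + \<alpha>)) *
        indicator (far \<delta>) (x, y) \<partial>lborel) \<le>
      ennreal (ball_weight \<alpha> x * (1 - (norm x)\<^sup>2) powr - \<alpha> * (K * (1 + 1 / \<delta>) powr (\<alpha> / 2)))"
    "\<And>(x::'a) \<delta>. norm x < 1 \<Longrightarrow> 0 < \<delta> \<Longrightarrow>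
      (\<integral>\<^sup>+y. ennreal (ball_weight \<alpha> y) * ennreal (norm (x - y) powr - (real DIM('a) + \<alpha>)) *
        indicator (far \<delta>) (x, y) \<partial>lborel) +
      ennreal (ball_weight \<alpha> x * (1 - (norm x)\<^sup>2) powr - \<alpha> * (c * (B - (1 + norm x) powr (\<alpha> - 1)))) \<le>
      ennreal (ball_weight \<alpha> x) * (\<integral>\<^sup>+y. ennreal (norm (x - y) powr - (real DIM('a) + \<alpha>)) *
        indicator (far \<delta>) (x, y) \<partial>lborel) +
      ennreal (ball_weight \<alpha> x * (1 - (norm x)\<^sup>2) powr - \<alpha> *
        (K * (B - hardy_tail \<alpha> (sqrt (1 + 1 / \<delta>)))))"
proof -
  let ?\<beta> = "real DIM('a) + \<alpha>"
  let ?e = "\<lambda>\<eta>::'a. ennreal (exp (- (norm \<eta>)\<^sup>2))"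
  define G where "G = Gamma (?\<beta> / 2)"
  have G: "0 < G" unfolding G_def using \<alpha> by (intro Gamma_real_pos) auto
  have \<beta>: "0 < ?\<beta>" using \<alpha> by simp
  obtain K0 where K0: "0 \<le> K0" "(\<integral>\<^sup>+\<eta>. ?e \<eta> * ennreal (norm \<eta> powr \<alpha>) \<partial>lborel) = ennreal K0"
    using Gaussian_norm_moment_finite[of \<alpha>] \<alpha> by auto
  define K where "K = 2 / \<alpha> * K0 / G"
  have K: "0 \<le> K" using K0 G \<alpha> by (simp add: K_def)
  define Kg where "Kg = pi powr ((real DIM('a) - 1) / 2) * Gamma ((1 + \<alpha>) / 2)"
  have c: "c = 2 / \<alpha> * Kg / G" by (simp add: c_def Kg_def G_def)
  have Kg: "(\<integral>\<^sup>+\<eta>. ?e \<eta> * ennreal (\<bar>\<eta> \<bullet> e\<bar> powr \<alpha>) \<partial>lborel) = ennreal Kg" if "norm e = 1" for e :: 'a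
    using nn_integral_Gaussian_inner[OF that, of "\<lambda>t. ennreal (\<bar>t\<bar> powr \<alpha>)"]
      nn_integral_Gaussian_abs_powr[of \<alpha>] \<alpha>
    by (simp add: Kg_def ennreal_mult' Gamma_real_nonneg)
  have Kg0: "0 \<le> Kg" using \<alpha> by (auto simp: Kg_def intro!: mult_nonneg_nonneg Gamma_real_nonneg)
  have w0: "0 \<le> ball_weight \<alpha> x" for x :: 'a by (simp add: ball_weight_def)
  have basis: "\<exists>e::'a. norm e = 1 \<and> x = norm x *\<^sub>R e" for x
  proof (cases "x = 0")
    case True
    obtain b :: 'a where "b \<in> Basis" using nonempty_Basis by blast
    then show ?thesis using True by (intro exI[of _ b]) auto
  next
    case False
    then show ?thesis by (intro exI[of _ "x /\<^sub>R norm x"]) auto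
  qed
  have 1: "(\<integral>\<^sup>+y. ennreal (ball_weight \<alpha> y) * ennreal (norm (x - y) powr - ?\<beta>) *
        indicator (far \<delta>) (x, y) \<partial>lborel) \<le>
      ennreal (ball_weight \<alpha> x * (1 - (norm x)\<^sup>2) powr - \<alpha> * (K * (1 + 1 / \<delta>) powr (\<alpha> / 2)))"
    if x: "norm x < 1" and \<delta>: "0 < \<delta>" for x :: 'a and \<delta>
  proof -
    obtain e :: 'a where e: "norm e = 1" "x = norm x *\<^sub>R e" using basis by blast
    let ?A = "(1 - (norm x)\<^sup>2) powr - \<alpha>" and ?D = "(1 + 1 / \<delta>) powr (\<alpha> / 2)"
    let ?C = "ball_weight \<alpha> x * (2 / \<alpha> * ?A * ?D)"
    have "(\<integral>\<^sup>+\<eta>. ?e \<eta> *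
      (ennreal (ball_weight \<alpha> x) * (2 * (\<integral>\<^sup>+\<sigma>. ennreal ((\<sigma>\<^sup>2 - (chord_lo x \<eta>)\<^sup>2) powr ((\<alpha> - 1) / 2)) *
        indicator {chord_lo x \<eta><..<chord_hi \<delta> x \<eta>} \<sigma> \<partial>lborel))) \<partial>lborel) \<le>
      (\<integral>\<^sup>+\<eta>. ennreal ?C * (?e \<eta> * ennreal (norm \<eta> powr \<alpha>)) \<partial>lborel)"
    proof (intro nn_integral_mono_AE eventually_mono[OF AE_lborel_singleton[of 0]])
      fix \<eta> :: 'a assume \<eta>: "\<eta> \<noteq> 0"
      obtain J1 J2 where
        J: "(\<integral>\<^sup>+\<sigma>. ennreal ((\<sigma>\<^sup>2 - (chord_lo x \<eta>)\<^sup>2) powr ((\<alpha> - 1) / 2)) *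
          indicator {chord_lo x \<eta><..<chord_hi \<delta> x \<eta>} \<sigma> \<partial>lborel) = ennreal J2" "0 \<le> J2"
          "J2 \<le> ?A * norm \<eta> powr \<alpha> * (?D / \<alpha>)"
        by (rule chord_inequality[OF \<alpha> x \<delta> \<eta> e]) (rule that; assumption)
      have "ball_weight \<alpha> x * (2 * J2) \<le> ball_weight \<alpha> x * (2 * (?A * norm \<eta> powr \<alpha> * (?D / \<alpha>)))"
        using J w0[of x] by (intro mult_left_mono) auto
      also have "\<dots> = ?C * norm \<eta> powr \<alpha>" by simp
      finally have "ennreal (ball_weight \<alpha> x) * (2 * ennreal J2) \<le> ennreal ?C * ennreal (norm \<eta> powr \<alpha>)"
        using w0[of x] J \<alpha> by (simp add: ennreal_leI flip: ennreal_mult' ennreal_numeral)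
      from mult_left_mono[OF this, of "?e \<eta>"]
      show "?e \<eta> * (ennreal (ball_weight \<alpha> x) * (2 * (\<integral>\<^sup>+\<sigma>. ennreal ((\<sigma>\<^sup>2 - (chord_lo x \<eta>)\<^sup>2) powr ((\<alpha> - 1) / 2)) *
        indicator {chord_lo x \<eta><..<chord_hi \<delta> x \<eta>} \<sigma> \<partial>lborel))) \<le> ennreal ?C * (?e \<eta> * ennreal (norm \<eta> powr \<alpha>))"
        unfolding J(1) by (simp add: mult.left_commute)
    qed
    also have "\<dots> = ennreal ?C * ennreal K0" by (simp add: nn_integral_cmult K0)
    finally have "(\<integral>\<^sup>+y. ennreal (ball_weight \<alpha> y) * ennreal (norm (x - y) powr - ?\<beta>) *
        indicator (far \<delta>) (x, y) \<partial>lborel) \<le> ennreal (1 / G) * (ennreal ?C * ennreal K0)"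
      unfolding nn_integral_far_weight[OF x \<delta> \<beta>] G_def by (rule mult_left_mono) simp
    also have "\<dots> = ennreal (1 / G * (?C * K0))"
      using G K0 w0[of x] \<alpha> by (simp flip: ennreal_mult')
    also have "1 / G * (?C * K0) = ball_weight \<alpha> x * ?A * (K * ?D)"
      by (simp add: K_def mult_ac)
    finally show ?thesis .
  qed
  have 2: "(\<integral>\<^sup>+y. ennreal (ball_weight \<alpha> y) * ennreal (norm (x - y) powr - ?\<beta>) *
        indicator (far \<delta>) (x, y) \<partial>lborel) +
      ennreal (ball_weight \<alpha> x * (1 - (norm x)\<^sup>2) powr - \<alpha> * (c * (B - (1 + norm x) powr (\<alpha> - 1)))) \<le>
      ennreal (ball_weight \<alpha> x) * (\<integral>\<^sup>+y. ennreal (norm (x - y) powr - ?\<beta>) *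
        indicator (far \<delta>) (x, y) \<partial>lborel) +
      ennreal (ball_weight \<alpha> x * (1 - (norm x)\<^sup>2) powr - \<alpha> *
        (K * (B - hardy_tail \<alpha> (sqrt (1 + 1 / \<delta>)))))"
    if x: "norm x < 1" and \<delta>: "0 < \<delta>" for x :: 'a and \<delta>
  proof -
    obtain e :: 'a where e: "norm e = 1" "x = norm x *\<^sub>R e" using basis by blast
    let ?A = "(1 - (norm x)\<^sup>2) powr - \<alpha>" and ?w = "ball_weight \<alpha> x"
    define E1 where "E1 = B - (1 + norm x) powr (\<alpha> - 1)"
    define E2 where "E2 = B - hardy_tail \<alpha> (sqrt (1 + 1 / \<delta>))"
    have "(1 + norm x) powr (\<alpha> - 1) \<le> 2 powr (\<alpha> - 1)" using x \<alpha> by (intro powr_mono2) auto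
    also have "\<dots> \<le> B" using two_powr_le_Beta[OF \<alpha>] by (simp add: B_def powr_diff)
    finally have E1: "0 \<le> E1" by (simp add: E1_def)
    have E2: "0 \<le> E2"
      using hardy_tail_limit(2)[OF \<alpha>, of "sqrt (1 + 1 / \<delta>)"] by (simp add: E2_def B_def)
    let ?j1 = "\<lambda>\<eta>. \<integral>\<^sup>+\<sigma>. ennreal ((\<sigma> + chord_mid x \<eta>) powr (\<alpha> - 1) + (\<sigma> - chord_mid x \<eta>) powr (\<alpha> - 1)) *
        indicator {chord_lo x \<eta><..<chord_hi \<delta> x \<eta>} \<sigma> \<partial>lborel"
    let ?j2 = "\<lambda>\<eta>. \<integral>\<^sup>+\<sigma>. ennreal ((\<sigma>\<^sup>2 - (chord_lo x \<eta>)\<^sup>2) powr ((\<alpha> - 1) / 2)) *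
        indicator {chord_lo x \<eta><..<chord_hi \<delta> x \<eta>} \<sigma> \<partial>lborel"
    let ?C1 = "?w * (2 / \<alpha> * ?A * E1)" and ?C2 = "?w * (2 / \<alpha> * ?A * E2)"
    have C: "0 \<le> ?C1" "0 \<le> ?C2" using E1 E2 w0[of x] \<alpha> by auto
    have "(\<integral>\<^sup>+\<eta>. ?e \<eta> * (ennreal ?w * (2 * ?j2 \<eta>)) + ennreal ?C1 * (?e \<eta> * ennreal (\<bar>\<eta> \<bullet> e\<bar> powr \<alpha>)) \<partial>lborel) \<le>
      (\<integral>\<^sup>+\<eta>. ennreal ?w * (?e \<eta> * ?j1 \<eta>) + ennreal ?C2 * (?e \<eta> * ennreal (norm \<eta> powr \<alpha>)) \<partial>lborel)"
    proof (intro nn_integral_mono_AE eventually_mono[OF AE_lborel_singleton[of 0]])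
      fix \<eta> :: 'a assume \<eta>: "\<eta> \<noteq> 0"
      obtain J1 J2 where J: "?j1 \<eta> = ennreal J1" "?j2 \<eta> = ennreal J2" "0 \<le> J1" "0 \<le> J2"
        "2 * J2 + 2 / \<alpha> * ?A * \<bar>\<eta> \<bullet> e\<bar> powr \<alpha> * E1 \<le> J1 + 2 / \<alpha> * ?A * norm \<eta> powr \<alpha> * E2"
        by (rule chord_inequality[OF \<alpha> x \<delta> \<eta> e, folded B_def, folded E1_def E2_def]) (rule that; assumption)
      have "?w * (2 * J2) + ?C1 * \<bar>\<eta> \<bullet> e\<bar> powr \<alpha> = ?w * (2 * J2 + 2 / \<alpha> * ?A * \<bar>\<eta> \<bullet> e\<bar> powr \<alpha> * E1)"
        by (simp add: distrib_left)
      also have "\<dots> \<le> ?w * (J1 + 2 / \<alpha> * ?A * norm \<eta> powr \<alpha> * E2)"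
        by (rule mult_left_mono[OF J(5) w0])
      also have "\<dots> = ?w * J1 + ?C2 * norm \<eta> powr \<alpha>"
        by (simp add: distrib_left)
      finally have *: "ennreal (?w * (2 * J2) + ?C1 * \<bar>\<eta> \<bullet> e\<bar> powr \<alpha>) \<le> ennreal (?w * J1 + ?C2 * norm \<eta> powr \<alpha>)"
        by (rule ennreal_leI)
      then have "ennreal ?w * (2 * ennreal J2) + ennreal ?C1 * ennreal (\<bar>\<eta> \<bullet> e\<bar> powr \<alpha>) \<le>
          ennreal ?w * ennreal J1 + ennreal ?C2 * ennreal (norm \<eta> powr \<alpha>)"
      proof -
        have "ennreal (w * j + C * z) = ennreal w * ennreal j + ennreal C * ennreal z"
          if "0 \<le> w" "0 \<le> j" "0 \<le> C" "0 \<le> z" for w j C z :: real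
          using that by (simp add: ennreal_mult)
        from this[OF w0 _ C(1)] this[OF w0 _ C(2)] * J(3,4) show ?thesis
          by (simp only: ennreal_mult[symmetric] ennreal_numeral[symmetric] mult_nonneg_nonneg zero_le_numeral powr_ge_zero)
      qed
      from mult_left_mono[OF this, of "?e \<eta>"]
      show "?e \<eta> * (ennreal ?w * (2 * ?j2 \<eta>)) + ennreal ?C1 * (?e \<eta> * ennreal (\<bar>\<eta> \<bullet> e\<bar> powr \<alpha>)) \<le>
          ennreal ?w * (?e \<eta> * ?j1 \<eta>) + ennreal ?C2 * (?e \<eta> * ennreal (norm \<eta> powr \<alpha>))"
        unfolding J(1,2) by (simp only: distrib_left mult.left_commute[of "?e \<eta>"] zero_le)
    qed
    then have "(\<integral>\<^sup>+\<eta>. ?e \<eta> * (ennreal ?w * (2 * ?j2 \<eta>)) \<partial>lborel) + ennreal ?C1 * ennreal Kg \<le>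
        ennreal ?w * (\<integral>\<^sup>+\<eta>. ?e \<eta> * ?j1 \<eta> \<partial>lborel) + ennreal ?C2 * ennreal K0"
      by (simp add: nn_integral_add nn_integral_cmult Kg[OF e(1)] K0)
    then have "ennreal (1 / G) * ((\<integral>\<^sup>+\<eta>. ?e \<eta> * (ennreal ?w * (2 * ?j2 \<eta>)) \<partial>lborel) + ennreal ?C1 * ennreal Kg) \<le>
        ennreal (1 / G) * (ennreal ?w * (\<integral>\<^sup>+\<eta>. ?e \<eta> * ?j1 \<eta> \<partial>lborel) + ennreal ?C2 * ennreal K0)"
      by (rule mult_left_mono) simp
    moreover have "ennreal (1 / G) * (ennreal ?C1 * ennreal Kg) = ennreal (?w * ?A * (c * E1))"
      using C Kg0 G by (simp add: c mult_ac flip: ennreal_mult')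
    moreover have "ennreal (1 / G) * (ennreal ?C2 * ennreal K0) = ennreal (?w * ?A * (K * E2))"
      using C K0 G by (simp add: K_def mult_ac flip: ennreal_mult')
    ultimately show ?thesis
      unfolding nn_integral_far_weight[OF x \<delta> \<beta>] nn_integral_far_kernel[OF x \<delta> \<beta>]
        G_def[symmetric] E1_def[symmetric] E2_def[symmetric]
      by (simp only: distrib_left mult.left_commute[of "ennreal ?w"])
  qed
  show ?thesis by (rule that[OF K 1 2])
qed

section \<open>Ground state representation\<close>

definition ground_form :: "real \<Rightarrow> ('a::euclidean_space \<Rightarrow> real) \<Rightarrow> 'a \<Rightarrow> ennreal" where
  "ground_form \<alpha> u x = (\<integral>\<^sup>+y. ennreal ((u x / ball_weight \<alpha> x - u y / ball_weight \<alpha> y)\<^sup>2 *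
     (ball_weight \<alpha> x * ball_weight \<alpha> y) * norm (x - y) powr - (real DIM('a) + \<alpha>)) *
     indicator (ball 0 1) y \<partial>lborel)"

section \<open>Test functions in the unit ball\<close>

lemma Cc_measurable: "u \<in> Cc D \<Longrightarrow> u \<in> borel_measurable borel"
  by (auto simp: Cc_def intro: borel_measurable_continuous_onI)

lemma Cc_ball_bounded:
  assumes "u \<in> Cc (ball 0 1)"
  obtains M r where "0 \<le> M" "\<And>x. \<bar>u x\<bar> \<le> M" "0 \<le> r" "r < 1" "\<And>x. r < norm x \<Longrightarrow> u x = 0"
proof -
  from assms obtain K where u: "continuous_on UNIV u" and K: "compact K" "K \<subseteq> ball 0 1" "\<And>x. x \<notin> K \<Longrightarrow> u x = 0"
    by (auto simp: Cc_def)
  have "compact (u ` K)" by (rule compact_continuous_image[OF continuous_on_subset[OF u] K(1)]) simp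
  then obtain M where M: "0 < M" "\<And>x. x \<in> K \<Longrightarrow> \<bar>u x\<bar> \<le> M"
    using compact_imp_bounded bounded_pos[of "u ` K"] by (auto simp: image_iff)
  have "\<exists>r\<ge>0. r < 1 \<and> (\<forall>x\<in>K. norm x \<le> r)"
  proof (cases "K = {}")
    case False
    then obtain z where "z \<in> K" "\<And>x. x \<in> K \<Longrightarrow> norm x \<le> norm z"
      using continuous_attains_sup[OF K(1) False, of norm] by (auto intro: continuous_intros)
    then show ?thesis using K(2) by (intro exI[of _ "norm z"]) auto
  qed (auto intro: exI[of _ 0])
  then obtain r where r: "0 \<le> r" "r < 1" "\<And>x. x \<in> K \<Longrightarrow> norm x \<le> r" by blast
  have "\<bar>u x\<bar> \<le> M" for x using M K(3) by (cases "x \<in> K") auto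
  moreover have "u x = 0" if "r < norm x" for x using r K(3) that by force
  ultimately show ?thesis using that[of M r] M r by auto
qed

text \<open>The support keeps a positive distance from the sphere, so the singular weight is bounded
  on it. The exponent 0 is included in order to cover the integral of u^2.\<close>

lemma hardy_integral_finite:
  fixes u :: "'a::euclidean_space \<Rightarrow> real"
  assumes "u \<in> Cc (ball 0 1)" "0 \<le> \<alpha>"
  shows "(\<integral>\<^sup>+x. ennreal ((u x)\<^sup>2 * (1 - (norm x)\<^sup>2) powr - \<alpha>) \<partial>lborel) < \<infinity>"
proof -
  obtain M r where M: "0 \<le> M" "\<And>x. \<bar>u x\<bar> \<le> M" "0 \<le> r" "r < 1" "\<And>x. r < norm x \<Longrightarrow> u x = 0"
    using Cc_ball_bounded[OF assms(1)] by blast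
  have r: "0 < 1 - r\<^sup>2" using M by (simp add: power_less_one_iff)
  have "(\<integral>\<^sup>+x. ennreal ((u x)\<^sup>2 * (1 - (norm x)\<^sup>2) powr - \<alpha>) \<partial>lborel) \<le>
      (\<integral>\<^sup>+x. ennreal (M\<^sup>2 * (1 - r\<^sup>2) powr - \<alpha>) * indicator (ball (0::'a) 1) x \<partial>lborel)"
  proof (rule nn_integral_mono)
    fix x :: 'a
    show "ennreal ((u x)\<^sup>2 * (1 - (norm x)\<^sup>2) powr - \<alpha>) \<le>
        ennreal (M\<^sup>2 * (1 - r\<^sup>2) powr - \<alpha>) * indicator (ball 0 1) x"
    proof (cases "norm x \<le> r")
      case True
      then have "(norm x)\<^sup>2 \<le> r\<^sup>2" by (intro power_mono) auto
      then have "(1 - (norm x)\<^sup>2) powr - \<alpha> \<le> (1 - r\<^sup>2) powr - \<alpha>"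
        using r assms by (intro powr_mono2') auto
      moreover have "(u x)\<^sup>2 \<le> M\<^sup>2" using M(2)[of x] M(1) by (simp add: abs_le_square_iff[symmetric])
      ultimately show ?thesis
        using True M by (auto intro!: ennreal_leI mult_mono)
    qed (simp add: M)
  qed
  also have "\<dots> < \<infinity>"
    using emeasure_bounded_finite[OF bounded_ball, of "0::'a" 1]
    by (simp add: nn_integral_cmult_indicator ennreal_mult_less_top)
  finally show ?thesis .
qed

text \<open>By concavity y^\<beta> lies below its tangent at 1, here as Young's inequality with
  second factor 1 and y = (1 + t) / 2. With \<beta> = \<alpha> - 1 and t = |x| it quantifies how far
  the potential exceeds its value at the sphere.\<close>

lemma powr_gap:
  fixes \<beta> t :: real
  assumes "0 < \<beta>" "\<beta> < 1" "0 \<le> t" "t \<le> 1"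
  shows "\<beta> / 4 * (1 - t\<^sup>2) \<le> 2 powr \<beta> - (1 + t) powr \<beta>"
proof -
  have "((1 + t) / 2) powr \<beta> * 1 powr (1 - \<beta>) \<le> \<beta> * ((1 + t) / 2) + (1 - \<beta>) * 1"
    by (rule Youngs_inequality_0) (use assms in auto)
  then have "\<beta> * (1 - t) / 2 \<le> 1 - ((1 + t) / 2) powr \<beta>" by (simp add: field_simps)
  also have "\<dots> \<le> 2 powr \<beta> * (1 - ((1 + t) / 2) powr \<beta>)"
  proof -
    have "((1 + t) / 2) powr \<beta> \<le> 1" using assms by (intro powr_le1) auto
    moreover have "1 \<le> 2 powr \<beta>" using assms by (simp add: ge_one_powr_ge_zero)
    ultimately show ?thesis using mult_right_mono[of 1 "2 powr \<beta>" "1 - ((1 + t) / 2) powr \<beta>"] by simp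
  qed
  also have "\<dots> = 2 powr \<beta> - (1 + t) powr \<beta>"
    using assms by (simp add: powr_divide right_diff_distrib)
  finally have "\<beta> * (1 - t) / 2 \<le> 2 powr \<beta> - (1 + t) powr \<beta>" .
  moreover have "\<beta> / 4 * (1 - t\<^sup>2) \<le> \<beta> * (1 - t) / 2"
  proof -
    have "\<beta> / 4 * ((1 - t) * (1 + t)) \<le> \<beta> / 4 * ((1 - t) * 2)"
      using assms by (intro mult_left_mono) auto
    then show ?thesis by (simp add: power2_eq_square algebra_simps)
  qed
  ultimately show ?thesis by simp
qed

text \<open>The mixed term is -2 a b on both sides. The other terms are placed so that all summands
  are nonnegative and the identity can be integrated without subtraction.\<close>

lemma ground_state_identity:
  fixes a b p q :: real
  assumes "0 < p" "0 < q"
  shows "(a - b)\<^sup>2 + a\<^sup>2 / p * q + b\<^sup>2 / q * p = (a / p - b / q)\<^sup>2 * (p * q) + a\<^sup>2 + b\<^sup>2"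
  using assms by (simp add: field_simps power2_eq_square)

text \<open>The kernel and \<open>far \<delta>\<close> are symmetric, so by Fubini the two
  single-variable terms on each side have equal integrals; hence the factors 2. As an equation in
  extended reals it presupposes no finiteness.\<close>

lemma ground_state_truncated:
  fixes u :: "'a::euclidean_space \<Rightarrow> real" and \<alpha> :: real
  assumes [measurable]: "u \<in> borel_measurable borel"
  defines "k \<equiv> \<lambda>x y::'a. ennreal (norm (x - y) powr - (real DIM('a) + \<alpha>))"
    and "w \<equiv> ball_weight \<alpha>"
  shows "(\<integral>\<^sup>+x. \<integral>\<^sup>+y. ennreal ((u x - u y)\<^sup>2) * k x y * indicator (far \<delta>) (x, y) \<partial>lborel \<partial>lborel) +
      2 * (\<integral>\<^sup>+x. ennreal ((u x)\<^sup>2 / w x) * (\<integral>\<^sup>+y. ennreal (w y) * k x y * indicator (far \<delta>) (x, y) \<partial>lborel) \<partial>lborel) =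
    (\<integral>\<^sup>+x. \<integral>\<^sup>+y. ennreal ((u x / w x - u y / w y)\<^sup>2 * (w x * w y)) * k x y * indicator (far \<delta>) (x, y) \<partial>lborel \<partial>lborel) +
      2 * (\<integral>\<^sup>+x. ennreal ((u x)\<^sup>2) * (\<integral>\<^sup>+y. k x y * indicator (far \<delta>) (x, y) \<partial>lborel) \<partial>lborel)"
proof -
  have [measurable]: "w \<in> borel_measurable borel" by (simp add: w_def)
  have [measurable]: "(\<lambda>(x, y). k x y) \<in> borel_measurable (borel \<Otimes>\<^sub>M borel)"
    unfolding k_def by measurable
  have wpos: "0 < w x" if "norm x < 1" for x
    using one_minus_norm_sq_pos[OF that] by (simp add: w_def ball_weight_def)
  have w0: "0 \<le> w x" for x by (simp add: w_def ball_weight_def)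
  have ksym: "k x y = k y x" for x y by (simp add: k_def norm_minus_commute)
  have isym: "indicator (far \<delta>) (x, y) = (indicator (far \<delta>) (y, x) :: ennreal)" for x y :: 'a
    using far_sym[of x y \<delta>] by (simp add: indicator_def)
  let ?i = "\<lambda>x y. k x y * indicator (far \<delta>) (x, y)"
  let ?E = "\<lambda>x y. ennreal ((u x - u y)\<^sup>2) * ?i x y"
  let ?D = "\<lambda>x y. ennreal ((u x / w x - u y / w y)\<^sup>2 * (w x * w y)) * ?i x y"
  let ?A = "\<lambda>x y. ennreal ((u x)\<^sup>2 / w x) * ennreal (w y) * ?i x y"
  let ?P = "\<lambda>x y. ennreal ((u x)\<^sup>2) * ?i x y"
  let ?I = "\<lambda>f. \<integral>\<^sup>+x. \<integral>\<^sup>+y. f x y \<partial>lborel \<partial>lborel"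
  have swap: "?I (\<lambda>x y. f y x) = ?I f" if [measurable]: "(\<lambda>(x, y). f x y) \<in> borel_measurable (borel \<Otimes>\<^sub>M borel)"
    for f :: "'a \<Rightarrow> 'a \<Rightarrow> ennreal"
    using that by (intro lborel_pair.Fubini'[symmetric]) (simp add: split_beta')
  have mA [measurable]: "(\<lambda>(x, y). ?A x y) \<in> borel_measurable (borel \<Otimes>\<^sub>M borel)"
    and mP [measurable]: "(\<lambda>(x, y). ?P x y) \<in> borel_measurable (borel \<Otimes>\<^sub>M borel)" by measurable
  have pt: "?E x y + ?A x y + ?A y x = ?D x y + ?P x y + ?P y x" for x y
  proof (cases "(x, y) \<in> far \<delta>")
    case True
    then have p: "0 < w x" "0 < w y" by (auto simp: far_def wpos)
    have "ennreal ((u x - u y)\<^sup>2) + ennreal ((u x)\<^sup>2 / w x) * ennreal (w y) + ennreal ((u y)\<^sup>2 / w y) * ennreal (w x) =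
        ennreal ((u x - u y)\<^sup>2 + (u x)\<^sup>2 / w x * w y + (u y)\<^sup>2 / w y * w x)"
      using p by (simp add: less_imp_le flip: ennreal_mult')
    also have "\<dots> = ennreal ((u x / w x - u y / w y)\<^sup>2 * (w x * w y)) + ennreal ((u x)\<^sup>2) + ennreal ((u y)\<^sup>2)"
      unfolding ground_state_identity[OF p] using p by (simp add: less_imp_le)
    finally have "(ennreal ((u x - u y)\<^sup>2) + ennreal ((u x)\<^sup>2 / w x) * ennreal (w y) +
        ennreal ((u y)\<^sup>2 / w y) * ennreal (w x)) * ?i x y =
       (ennreal ((u x / w x - u y / w y)\<^sup>2 * (w x * w y)) + ennreal ((u x)\<^sup>2) + ennreal ((u y)\<^sup>2)) * ?i x y"
      by simp
    then show ?thesis by (simp only: distrib_right ksym[of y x] isym[of y x])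
  qed (simp add: isym[of y x])
  have "?I (\<lambda>x y. ?E x y + ?A x y + ?A y x) = ?I (\<lambda>x y. ?D x y + ?P x y + ?P y x)"
    by (simp only: pt)
  then have "?I ?E + ?I ?A + ?I (\<lambda>x y. ?A y x) = ?I ?D + ?I ?P + ?I (\<lambda>x y. ?P y x)"
    by (simp add: nn_integral_add)
  then have "?I ?E + 2 * ?I ?A = ?I ?D + 2 * ?I ?P"
    by (simp only: swap[OF mA] swap[OF mP] mult_2 add.assoc)
  then show ?thesis by (simp add: mult.assoc nn_integral_cmult)
qed

text \<open>For fixed \<delta> the weighted term A is finite and cancels from
  \<open>ground_state_truncated\<close>. Monotone convergence then removes the truncation from the
  weighted energy, while the error, a multiple of (B - \<open>hardy_tail\<close>) times the Hardy
  integral H, tends to 0 because H is finite for compactly supported u.\<close>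

lemma hardy_ground_state:
  fixes \<alpha> :: real
  assumes \<alpha>: "1 < \<alpha>" "\<alpha> < 2"
  obtains c0 where "0 < c0" "\<And>u::'a::euclidean_space \<Rightarrow> real. u \<in> Cc (ball 0 1) \<Longrightarrow>
    ennreal (1 / 2) * (\<integral>\<^sup>+x. ground_form \<alpha> u x * indicator (ball 0 1) x \<partial>lborel) +
    ennreal (2 powr \<alpha> * kappa DIM('a) \<alpha>) * (\<integral>\<^sup>+x. ennreal ((u x)\<^sup>2 * (1 - (norm x)\<^sup>2) powr - \<alpha>) \<partial>lborel) +
    ennreal c0 * (\<integral>\<^sup>+x. ennreal ((u x)\<^sup>2) \<partial>lborel) \<le> energy (ball 0 1) \<alpha> u"
proof -
  let ?\<beta> = "real DIM('a) + \<alpha>"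
  define B where "B = Beta ((1 + \<alpha>) / 2) ((2 - \<alpha>) / 2) / 2"
  define c where "c = 2 / \<alpha> * (pi powr ((real DIM('a) - 1) / 2) * Gamma ((1 + \<alpha>) / 2) / Gamma (?\<beta> / 2))"
  have c: "0 < c" using \<alpha> by (auto simp: c_def intro!: divide_pos_pos mult_pos_pos Gamma_real_pos)
  have B: "2 powr (\<alpha> - 1) \<le> B" using two_powr_le_Beta[OF \<alpha>] by (simp add: B_def powr_diff)
  \<comment> \<open>The coefficient c (B - (1 + |x|)^(\<alpha> - 1)) of the potential, taken at |x|
    = 1, is the constant of the theorem.\<close>
  have kappa: "2 powr \<alpha> * kappa DIM('a) \<alpha> = c * (B - 2 powr (\<alpha> - 1))"
  proof -
    have "t * (Q * ((b - t) / (\<alpha> * t))) = 2 / \<alpha> * Q * (b / 2 - t / 2)" if "t \<noteq> 0" for t Q b :: real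
      using that \<alpha> by (simp add: field_simps)
    moreover have "2 powr (\<alpha> - 1) = 2 powr \<alpha> / 2" by (simp add: powr_diff)
    ultimately show ?thesis unfolding kappa_def c_def B_def by (metis powr_eq_0_iff zero_neq_numeral)
  qed
  define k where "k x y = ennreal (norm (x - y) powr - ?\<beta>)" for x y :: 'a
  have [measurable]: "(\<lambda>(x, y). k x y) \<in> borel_measurable (borel \<Otimes>\<^sub>M borel)"
    unfolding k_def by measurable
  define w where "w = (ball_weight \<alpha> :: 'a \<Rightarrow> real)"
  have [measurable]: "w \<in> borel_measurable borel" by (simp add: w_def)
  obtain K where K: "0 \<le> K"
    "\<And>(x::'a) \<delta>. norm x < 1 \<Longrightarrow> 0 < \<delta> \<Longrightarrow> (\<integral>\<^sup>+y. ennreal (w y) * k x y * indicator (far \<delta>) (x, y) \<partial>lborel) \<le>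
      ennreal (w x * (1 - (norm x)\<^sup>2) powr - \<alpha> * (K * (1 + 1 / \<delta>) powr (\<alpha> / 2)))"
    "\<And>(x::'a) \<delta>. norm x < 1 \<Longrightarrow> 0 < \<delta> \<Longrightarrow> (\<integral>\<^sup>+y. ennreal (w y) * k x y * indicator (far \<delta>) (x, y) \<partial>lborel) +
      ennreal (w x * (1 - (norm x)\<^sup>2) powr - \<alpha> * (c * (B - (1 + norm x) powr (\<alpha> - 1)))) \<le>
      ennreal (w x) * (\<integral>\<^sup>+y. k x y * indicator (far \<delta>) (x, y) \<partial>lborel) +
      ennreal (w x * (1 - (norm x)\<^sup>2) powr - \<alpha> * (K * (B - hardy_tail \<alpha> (sqrt (1 + 1 / \<delta>)))))"
    by (rule hardy_potential[where 'a = 'a, OF \<alpha>, folded w_def k_def B_def c_def]) (rule that; assumption)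
  have wpos: "0 < w x" if "norm x < 1" for x
    using one_minus_norm_sq_pos[OF that] by (simp add: w_def ball_weight_def)
  \<comment> \<open>The factor (\<alpha> - 1) / 4 is the one from \<open>powr_gap\<close> with
    \<beta> = \<alpha> - 1.\<close>
  define c0 where "c0 = c * ((\<alpha> - 1) / 4)"
  have c0: "0 < c0" using c \<alpha> by (simp add: c0_def)
  have "ennreal (1 / 2) * (\<integral>\<^sup>+x. ground_form \<alpha> u x * indicator (ball 0 1) x \<partial>lborel) +
    ennreal (2 powr \<alpha> * kappa DIM('a) \<alpha>) * (\<integral>\<^sup>+x. ennreal ((u x)\<^sup>2 * (1 - (norm x)\<^sup>2) powr - \<alpha>) \<partial>lborel) +
    ennreal c0 * (\<integral>\<^sup>+x. ennreal ((u x)\<^sup>2) \<partial>lborel) \<le> energy (ball 0 1) \<alpha> u"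
    if u: "u \<in> Cc (ball 0 1)" for u :: "'a \<Rightarrow> real"
  proof -
    have [measurable]: "u \<in> borel_measurable borel" by (rule Cc_measurable[OF u])
    have u0: "u x = 0" if "\<not> norm x < 1" for x using u that by (force simp: Cc_def)
    define H where "H = (\<integral>\<^sup>+x. ennreal ((u x)\<^sup>2 * (1 - (norm x)\<^sup>2) powr - \<alpha>) \<partial>lborel)"
    have "H < \<infinity>" unfolding H_def by (rule hardy_integral_finite[OF u]) (use \<alpha> in simp)
    then obtain h where h: "0 \<le> h" "H = ennreal h" by (cases H) auto
    define M where "M = (\<integral>\<^sup>+x. ennreal ((u x)\<^sup>2 * (1 - (norm x)\<^sup>2) powr - \<alpha> * (c * (B - (1 + norm x) powr (\<alpha> - 1)))) \<partial>lborel)"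
    define E where "E = (\<integral>\<^sup>+x. \<integral>\<^sup>+y. ennreal ((u x - u y)\<^sup>2) * k x y * indicator (ball 0 1) y * indicator (ball 0 1) x \<partial>lborel \<partial>lborel)"
    define d where "d x y = ennreal ((u x / w x - u y / w y)\<^sup>2 * (w x * w y)) * k x y" for x y
    have [measurable]: "(\<lambda>(x, y). d x y) \<in> borel_measurable (borel \<Otimes>\<^sub>M borel)"
      unfolding d_def by measurable
    define D where "D = (\<integral>\<^sup>+x. \<integral>\<^sup>+y. d x y * indicator (ball 0 1) y * indicator (ball 0 1) x \<partial>lborel \<partial>lborel)"
    have trunc: "(\<integral>\<^sup>+x. \<integral>\<^sup>+y. d x y * indicator (far \<delta>) (x, y) \<partial>lborel \<partial>lborel) + 2 * M \<le>
        E + ennreal (2 * (K * (B - hardy_tail \<alpha> (sqrt (1 + 1 / \<delta>)))) * h)" if \<delta>: "0 < \<delta>" for \<delta>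
    proof -
      define A where "A = (\<integral>\<^sup>+x. ennreal ((u x)\<^sup>2 / w x) * (\<integral>\<^sup>+y. ennreal (w y) * k x y * indicator (far \<delta>) (x, y) \<partial>lborel) \<partial>lborel)"
      define P where "P = (\<integral>\<^sup>+x. ennreal ((u x)\<^sup>2) * (\<integral>\<^sup>+y. k x y * indicator (far \<delta>) (x, y) \<partial>lborel) \<partial>lborel)"
      define err where "err = K * (B - hardy_tail \<alpha> (sqrt (1 + 1 / \<delta>)))"
      have err: "0 \<le> err"
        using K(1) hardy_tail_limit(2)[OF \<alpha>, of "sqrt (1 + 1 / \<delta>)"] by (simp add: err_def B_def)
      have cancel: "ennreal ((u x)\<^sup>2 / w x) * ennreal (w x * z) = ennreal ((u x)\<^sup>2 * z)" if "norm x < 1" for x z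
        using wpos[OF that] by (simp flip: ennreal_mult')
      have "A \<le> (\<integral>\<^sup>+x. ennreal ((u x)\<^sup>2 * (1 - (norm x)\<^sup>2) powr - \<alpha>) * ennreal (K * (1 + 1 / \<delta>) powr (\<alpha> / 2)) \<partial>lborel)"
        unfolding A_def
      proof (rule nn_integral_mono)
        fix x :: 'a
        show "ennreal ((u x)\<^sup>2 / w x) * (\<integral>\<^sup>+y. ennreal (w y) * k x y * indicator (far \<delta>) (x, y) \<partial>lborel) \<le>
          ennreal ((u x)\<^sup>2 * (1 - (norm x)\<^sup>2) powr - \<alpha>) * ennreal (K * (1 + 1 / \<delta>) powr (\<alpha> / 2))"
        proof (cases "norm x < 1")
          case True
          from mult_left_mono[OF K(2)[OF True \<delta>], of "ennreal ((u x)\<^sup>2 / w x)"] show ?thesis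
            unfolding mult.assoc[of "w x"] cancel[OF True] by (simp add: mult.assoc flip: ennreal_mult')
        qed (simp add: u0)
      qed
      also have "\<dots> = H * ennreal (K * (1 + 1 / \<delta>) powr (\<alpha> / 2))"
        unfolding H_def by (rule nn_integral_multc) measurable
      finally have A: "A < \<infinity>" using h(2) by (auto simp: ennreal_mult_less_top intro: le_less_trans)
      have "A + M = (\<integral>\<^sup>+x. ennreal ((u x)\<^sup>2 / w x) * (\<integral>\<^sup>+y. ennreal (w y) * k x y * indicator (far \<delta>) (x, y) \<partial>lborel) +
          ennreal ((u x)\<^sup>2 * (1 - (norm x)\<^sup>2) powr - \<alpha> * (c * (B - (1 + norm x) powr (\<alpha> - 1)))) \<partial>lborel)"
        unfolding A_def M_def by (rule nn_integral_add[symmetric]) measurable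
      also have "\<dots> \<le> (\<integral>\<^sup>+x. ennreal ((u x)\<^sup>2) * (\<integral>\<^sup>+y. k x y * indicator (far \<delta>) (x, y) \<partial>lborel) +
          ennreal ((u x)\<^sup>2 * (1 - (norm x)\<^sup>2) powr - \<alpha>) * ennreal err \<partial>lborel)"
      proof (rule nn_integral_mono)
        fix x :: 'a
        show "ennreal ((u x)\<^sup>2 / w x) * (\<integral>\<^sup>+y. ennreal (w y) * k x y * indicator (far \<delta>) (x, y) \<partial>lborel) +
          ennreal ((u x)\<^sup>2 * (1 - (norm x)\<^sup>2) powr - \<alpha> * (c * (B - (1 + norm x) powr (\<alpha> - 1)))) \<le>
          ennreal ((u x)\<^sup>2) * (\<integral>\<^sup>+y. k x y * indicator (far \<delta>) (x, y) \<partial>lborel) +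
          ennreal ((u x)\<^sup>2 * (1 - (norm x)\<^sup>2) powr - \<alpha>) * ennreal err"
        proof (cases "norm x < 1")
          case True
          have 1: "ennreal ((u x)\<^sup>2 / w x) * ennreal (w x) = ennreal ((u x)\<^sup>2)"
            using cancel[OF True, of 1] by simp
          from mult_left_mono[OF K(3)[OF True \<delta>], of "ennreal ((u x)\<^sup>2 / w x)"] show ?thesis
            unfolding mult.assoc[of "w x"] cancel[OF True] distrib_left mult.assoc[symmetric, of _ "ennreal (w x)"] 1
            by (simp add: mult.assoc err_def flip: ennreal_mult')
        qed (simp add: u0)
      qed
      also have "\<dots> = P + H * ennreal err"
        unfolding P_def H_def by (subst nn_integral_add) (auto simp: nn_integral_multc)
      finally have AM: "A + M \<le> P + H * ennreal err" .
      let ?D = "\<integral>\<^sup>+x. \<integral>\<^sup>+y. d x y * indicator (far \<delta>) (x, y) \<partial>lborel \<partial>lborel"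
      let ?E = "\<integral>\<^sup>+x. \<integral>\<^sup>+y. ennreal ((u x - u y)\<^sup>2) * k x y * indicator (far \<delta>) (x, y) \<partial>lborel \<partial>lborel"
      have id: "?E + 2 * A = ?D + 2 * P"
        using ground_state_truncated[of u \<alpha> \<delta>] unfolding A_def P_def d_def k_def w_def by measurable
      have "2 * A + (?D + 2 * M) = ?D + 2 * (A + M)" by (simp add: distrib_left ac_simps)
      also have "\<dots> \<le> ?D + 2 * (P + H * ennreal err)" by (intro add_left_mono mult_left_mono AM) simp
      also have "\<dots> = ?D + 2 * P + 2 * (H * ennreal err)" by (simp add: distrib_left ac_simps)
      also have "\<dots> = 2 * A + (?E + 2 * (H * ennreal err))" unfolding id[symmetric] by (simp add: ac_simps)
      finally have "?D + 2 * M \<le> ?E + 2 * (H * ennreal err)"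
        using A by (subst (asm) ennreal_add_left_cancel_le) (auto simp: ennreal_mult_eq_top_iff)
      also have "2 * (H * ennreal err) = ennreal (2 * err * h)"
        using h err by (simp add: ennreal_mult mult_ac)
      also have "?E \<le> E"
        unfolding E_def by (intro nn_integral_mono) (auto simp: far_def split: split_indicator)
      finally show ?thesis by (simp add: err_def add_right_mono)
    qed
    \<comment> \<open>Chosen so that \<open>sqrt (1 + 1 / dd j)\<close> is at least j, which puts
      \<open>hardy_tail\<close> there between its value at j and its limit B. The sequence
      decreases, as monotone convergence requires.\<close>
    define dd where "dd j = 1 / (real (Suc j))\<^sup>2" for j :: nat
    have dd: "0 < dd j" for j by (simp add: dd_def)
    have dd_anti: "dd j \<le> dd i" if "i \<le> j" for i j
      unfolding dd_def using that by (intro divide_left_mono power_mono) auto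
    have dd_0: "dd \<longlonglongrightarrow> 0" 
    using tendsto_power[OF LIMSEQ_inverse_real_of_nat, of 2]
    by (simp add: dd_def[abs_def] power_inverse flip: inverse_eq_divide)
    have far_mono: "far (dd i) \<subseteq> (far (dd j) :: ('a \<times> 'a) set)" if "i \<le> j" for i j
    proof (clarsimp simp: far_def)
      fix x y :: 'a
      assume *: "norm x < 1" "norm y < 1" "dd i * (1 - (norm x)\<^sup>2) * (1 - (norm y)\<^sup>2) < (norm (x - y))\<^sup>2"
      have "dd j * (1 - (norm x)\<^sup>2) * (1 - (norm y)\<^sup>2) \<le> dd i * (1 - (norm x)\<^sup>2) * (1 - (norm y)\<^sup>2)"
        using dd_anti[OF that] one_minus_norm_sq_pos[OF *(1)] one_minus_norm_sq_pos[OF *(2)]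
        by (intro mult_right_mono) auto
      then show "dd j * (1 - (norm x)\<^sup>2) * (1 - (norm y)\<^sup>2) < (norm (x - y))\<^sup>2" using * by linarith
    qed
    have pt_lim: "(\<lambda>j. d x y * indicator (far (dd j)) (x, y)) \<longlonglongrightarrow>
        d x y * indicator (ball 0 1) y * indicator (ball 0 1) x" for x y
    proof (cases "norm x < 1 \<and> norm y < 1 \<and> x \<noteq> y")
      case True
      have "(\<lambda>j. dd j * (1 - (norm x)\<^sup>2) * (1 - (norm y)\<^sup>2)) \<longlonglongrightarrow> 0 * (1 - (norm x)\<^sup>2) * (1 - (norm y)\<^sup>2)"
        by (intro tendsto_intros dd_0)
      then have "\<forall>\<^sub>F j in sequentially. dd j * (1 - (norm x)\<^sup>2) * (1 - (norm y)\<^sup>2) < (norm (x - y))\<^sup>2"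
        using True by (intro order_tendstoD) auto
      then have "\<forall>\<^sub>F j in sequentially. (x, y) \<in> far (dd j)"
        by eventually_elim (use True in \<open>simp add: far_def\<close>)
      then have "\<forall>\<^sub>F j in sequentially. d x y * indicator (far (dd j)) (x, y) =
          d x y * indicator (ball 0 1) y * indicator (ball 0 1) x"
        by eventually_elim (use True in simp)
      then show ?thesis by (rule tendsto_eventually)
    next
      case False
      \<comment> \<open>A point (x, x) is never far, so on the diagonal the truncated indicators do
        not converge to the indicator of the ball; there the integrand vanishes instead.\<close>
      have "d x x = 0" by (simp add: d_def)
      moreover have "(x, y) \<in> far (dd j) \<Longrightarrow> norm x < 1 \<and> norm y < 1" for j
        by (simp add: far_def)
      ultimately show ?thesis using False
        by (intro tendsto_eventually always_eventually allI) (auto split: split_indicator)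
    qed
    have mono: "d x y * indicator (far (dd i)) (x, y) \<le> d x y * indicator (far (dd j)) (x, y)" if "i \<le> j" for i j x y
      using far_mono[OF that] by (intro mult_left_mono) (auto split: split_indicator)
    have lim1: "(\<lambda>j. \<integral>\<^sup>+y. d x y * indicator (far (dd j)) (x, y) \<partial>lborel) \<longlonglongrightarrow>
        (\<integral>\<^sup>+y. d x y * indicator (ball 0 1) y * indicator (ball 0 1) x \<partial>lborel)" for x
      by (rule nn_integral_LIMSEQ) (auto simp: incseq_def le_fun_def intro!: mono pt_lim)
    have lim2: "(\<lambda>j. \<integral>\<^sup>+x. \<integral>\<^sup>+y. d x y * indicator (far (dd j)) (x, y) \<partial>lborel \<partial>lborel) \<longlonglongrightarrow> D"
      unfolding D_def
      by (rule nn_integral_LIMSEQ) (auto simp: incseq_def le_fun_def intro!: mono lim1 nn_integral_mono)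
    have lim3: "(\<lambda>j. (\<integral>\<^sup>+x. \<integral>\<^sup>+y. d x y * indicator (far (dd j)) (x, y) \<partial>lborel \<partial>lborel) + 2 * M) \<longlonglongrightarrow> D + 2 * M"
      by (intro tendsto_add tendsto_const lim2)
    have "(\<lambda>j. 2 * (K * (B - hardy_tail \<alpha> (sqrt (1 + 1 / dd j)))) * h) \<longlonglongrightarrow> 2 * (K * (B - B)) * h"
    proof (intro tendsto_intros)
      show "(\<lambda>j. hardy_tail \<alpha> (sqrt (1 + 1 / dd j))) \<longlonglongrightarrow> B"
      proof (rule tendsto_sandwich)
        show "(\<lambda>j. hardy_tail \<alpha> (real j)) \<longlonglongrightarrow> B" unfolding B_def by (rule hardy_tail_limit(1)[OF \<alpha>])
        show "\<forall>\<^sub>F j in sequentially. hardy_tail \<alpha> (real j) \<le> hardy_tail \<alpha> (sqrt (1 + 1 / dd j))"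
          by (intro always_eventually allI hardy_tail_mono[OF \<alpha>(1)] real_le_rsqrt)
             (auto simp: dd_def power2_eq_square algebra_simps)
        show "\<forall>\<^sub>F j in sequentially. hardy_tail \<alpha> (sqrt (1 + 1 / dd j)) \<le> B"
          unfolding B_def by (intro always_eventually allI hardy_tail_limit(2)[OF \<alpha>])
      qed simp
    qed
    then have "(\<lambda>j. E + ennreal (2 * (K * (B - hardy_tail \<alpha> (sqrt (1 + 1 / dd j)))) * h)) \<longlonglongrightarrow> E + ennreal (2 * (K * (B - B)) * h)"
      by (intro tendsto_add tendsto_const tendsto_ennrealI)
    from LIMSEQ_le[OF lim3 this] trunc[OF dd]
    have "D + 2 * M \<le> E + ennreal (2 * (K * (B - B)) * h)" by blast
    then have "D + 2 * M \<le> E" by simp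
    then have "ennreal (1 / 2) * (D + 2 * M) \<le> ennreal (1 / 2) * E" by (rule mult_left_mono) simp
    moreover have "ennreal (1 / 2) * 2 = 1"
      using ennreal_mult[of "1 / 2" 2] by simp
    ultimately have DM: "ennreal (1 / 2) * D + M \<le> ennreal (1 / 2) * E"
      by (simp only: distrib_left mult.assoc[symmetric] mult_1_left)
    have "ennreal (2 powr \<alpha> * kappa DIM('a) \<alpha>) * H + ennreal c0 * (\<integral>\<^sup>+x. ennreal ((u x)\<^sup>2) \<partial>lborel) =
       (\<integral>\<^sup>+x. ennreal (2 powr \<alpha> * kappa DIM('a) \<alpha>) * ennreal ((u x)\<^sup>2 * (1 - (norm x)\<^sup>2) powr - \<alpha>) +
          ennreal c0 * ennreal ((u x)\<^sup>2) \<partial>lborel)"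
      unfolding H_def by (simp add: nn_integral_add nn_integral_cmult)
    also have "\<dots> \<le> M"
      unfolding M_def
    proof (rule nn_integral_mono)
      fix x :: 'a
      show "ennreal (2 powr \<alpha> * kappa DIM('a) \<alpha>) * ennreal ((u x)\<^sup>2 * (1 - (norm x)\<^sup>2) powr - \<alpha>) +
          ennreal c0 * ennreal ((u x)\<^sup>2) \<le>
        ennreal ((u x)\<^sup>2 * (1 - (norm x)\<^sup>2) powr - \<alpha> * (c * (B - (1 + norm x) powr (\<alpha> - 1))))"
      proof (cases "norm x < 1")
        case True
        let ?a = "1 - (norm x)\<^sup>2"
        have a: "0 < ?a" "?a \<le> 1" using one_minus_norm_sq_pos[OF True] by auto
        \<comment> \<open>Since \<alpha> > 1 and 0 < a \<le> 1, the product of a with a^(-\<alpha>)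
          is still at least 1: the gain of order a survives the singular weight as a plain multiple
          of u^2.\<close>
        have "?a powr \<alpha> \<le> ?a powr 1" using a \<alpha> by (intro powr_mono') auto
        then have "1 \<le> ?a powr - \<alpha> * ?a" using a by (simp add: powr_minus field_simps)
        then have "c0 \<le> ?a powr - \<alpha> * (c * ((\<alpha> - 1) / 4 * ?a))"
          using mult_left_mono[of 1 "?a powr - \<alpha> * ?a" c0] c0 by (simp add: c0_def mult_ac)
        also have "\<dots> \<le> ?a powr - \<alpha> * (c * (2 powr (\<alpha> - 1) - (1 + norm x) powr (\<alpha> - 1)))"
          using powr_gap[of "\<alpha> - 1" "norm x"] \<alpha> True c by (intro mult_left_mono) auto
        finally have "(u x)\<^sup>2 * c0 \<le> (u x)\<^sup>2 * (?a powr - \<alpha> * (c * (2 powr (\<alpha> - 1) - (1 + norm x) powr (\<alpha> - 1))))"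
          by (rule mult_left_mono) simp
        then have "2 powr \<alpha> * kappa DIM('a) \<alpha> * ((u x)\<^sup>2 * ?a powr - \<alpha>) + c0 * (u x)\<^sup>2 \<le>
            (u x)\<^sup>2 * ?a powr - \<alpha> * (c * (B - (1 + norm x) powr (\<alpha> - 1)))"
          unfolding kappa by (simp add: algebra_simps)
        moreover have "0 \<le> 2 powr \<alpha> * kappa DIM('a) \<alpha>" unfolding kappa using c B by simp
        ultimately show ?thesis using c0
          by (simp add: ennreal_leI flip: ennreal_mult' ennreal_plus)
      qed (simp add: u0)
    qed
    finally have "ennreal (1 / 2) * D + (ennreal (2 powr \<alpha> * kappa DIM('a) \<alpha>) * H +
        ennreal c0 * (\<integral>\<^sup>+x. ennreal ((u x)\<^sup>2) \<partial>lborel)) \<le> ennreal (1 / 2) * E"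
      using DM by (meson add_left_mono order_trans)
    moreover have "D = (\<integral>\<^sup>+x. ground_form \<alpha> u x * indicator (ball 0 1) x \<partial>lborel)"
      unfolding D_def
    proof (rule nn_integral_cong)
      fix x :: 'a
      have "d x y * indicator (ball 0 1) y = ennreal ((u x / ball_weight \<alpha> x - u y / ball_weight \<alpha> y)\<^sup>2 *
          (ball_weight \<alpha> x * ball_weight \<alpha> y) * norm (x - y) powr - ?\<beta>) * indicator (ball 0 1) y" for y
        unfolding d_def k_def w_def by (subst ennreal_mult[symmetric]) (auto simp: ball_weight_def)
      then show "(\<integral>\<^sup>+y. d x y * indicator (ball 0 1) y * indicator (ball 0 1) x \<partial>lborel) =
          ground_form \<alpha> u x * indicator (ball 0 1) x"
        unfolding ground_form_def by (cases "x \<in> ball 0 1") simp_all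
    qed
    moreover have "E = (\<integral>\<^sup>+x. (\<integral>\<^sup>+y. ennreal ((u x - u y)\<^sup>2 / norm (x - y) powr ?\<beta>) *
        indicator (ball 0 1) y \<partial>lborel) * indicator (ball 0 1) x \<partial>lborel)"
      unfolding E_def
    proof (rule nn_integral_cong)
      fix x :: 'a
      have "ennreal ((u x - u y)\<^sup>2) * k x y = ennreal ((u x - u y)\<^sup>2 / norm (x - y) powr ?\<beta>)" for y
        unfolding k_def by (subst ennreal_mult[symmetric]) (simp_all only: powr_minus divide_inverse zero_le_power2 powr_ge_zero inverse_nonnegative_iff_nonnegative)
      then show "(\<integral>\<^sup>+y. ennreal ((u x - u y)\<^sup>2) * k x y * indicator (ball 0 1) y * indicator (ball 0 1) x \<partial>lborel) =
          (\<integral>\<^sup>+y. ennreal ((u x - u y)\<^sup>2 / norm (x - y) powr ?\<beta>) * indicator (ball 0 1) y \<partial>lborel) * indicator (ball 0 1) x"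
        by (cases "x \<in> ball 0 1") simp_all
    qed
    ultimately show ?thesis unfolding energy_def H_def by (simp only: add.assoc)
  qed
  then show ?thesis by (rule that[OF c0])
qed

section \<open>The weighted Sobolev inequality\<close>

lemma ball_in_borel [measurable]: "ball c r \<in> sets borel"
  by simp

text \<open>The choice of centre gives 1 - |y| \<ge> (1 - R / 2) (1 - |x|), and R \<le> 1 makes the
  first factor at least 1 / 2. Passing from 1 - |x| to 1 - |x|^2 costs another factor of at most 2,
  hence the 4. A ball centred at x itself could leave the unit ball or touch the sphere, where the
  weight degenerates.\<close>

lemma ball_towards_centre:
  fixes x y :: "'a::euclidean_space"
  assumes x: "norm x < 1" and R: "0 < R" "R \<le> 1" and y: "y \<in> ball ((1 - R / 2) *\<^sub>R x) (R / 2)"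
    and \<alpha>: "1 < \<alpha>"
  shows "norm y < 1" "norm (x - y) \<le> R"
    "ball_weight \<alpha> x \<le> 4 powr ((\<alpha> - 1) / 2) * ball_weight \<alpha> y"
proof -
  let ?c = "(1 - R / 2) *\<^sub>R x"
  have d: "norm (?c - y) < R / 2" using y by (simp add: dist_norm)
  have "norm y \<le> norm ?c + norm (?c - y)" using norm_triangle_ineq4[of ?c "?c - y"] by simp
  also have "norm ?c = (1 - R / 2) * norm x" using R by simp
  finally have 1: "norm y \<le> (1 - R / 2) * norm x + R / 2" using d by linarith
  have "0 \<le> (1 - R) * (1 - norm x)" using R x by simp
  then have 2: "(1 - norm x) / 2 \<le> 1 - norm y" using 1 by (simp add: field_simps)
  have "0 < (1 - norm x) / 2" using x by simp
  from less_le_trans[OF this 2] show y1: "norm y < 1" by simp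
  have "norm (x - y) \<le> norm (x - ?c) + norm (?c - y)" using norm_triangle_ineq[of "x - ?c" "?c - y"] by simp
  also have "x - ?c = (R / 2) *\<^sub>R x" by (simp add: scaleR_diff_left)
  also have "norm \<dots> \<le> R / 2" using R x by (simp add: mult_left_le)
  finally show "norm (x - y) \<le> R" using d by linarith
  have "1 - (norm x)\<^sup>2 \<le> 2 * (1 - norm x)" 
    using zero_le_power2[of "1 - norm x"] by (simp add: power2_eq_square algebra_simps)
  also have "\<dots> \<le> 4 * (1 - norm y)" using 2 by simp
  also have "\<dots> \<le> 4 * (1 - (norm y)\<^sup>2)"
    using mult_left_le[of "norm y" "norm y"] y1 by (simp add: power2_eq_square)
  finally have "(1 - (norm x)\<^sup>2) powr ((\<alpha> - 1) / 2) \<le> (4 * (1 - (norm y)\<^sup>2)) powr ((\<alpha> - 1) / 2)"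
    using one_minus_norm_sq_pos[OF x] \<alpha> by (intro powr_mono2) auto
  also have "\<dots> = 4 powr ((\<alpha> - 1) / 2) * (1 - (norm y)\<^sup>2) powr ((\<alpha> - 1) / 2)"
    using one_minus_norm_sq_pos[OF y1] by (intro powr_mult)
  finally show "ball_weight \<alpha> x \<le> 4 powr ((\<alpha> - 1) / 2) * ball_weight \<alpha> y"
    unfolding ball_weight_def .
qed

text \<open>With $p = w(x)$ and $q = w(y)$; the factor \<open>K\<close> leaves room for the kernel, which is at least
  $R^{-n-\alpha}$ at distance at most $R$.\<close>

lemma square_le_ground_density:
  fixes a b p q m K :: real
  assumes "0 < p" "0 < q" "p \<le> m * q" "1 \<le> K"
  shows "a\<^sup>2 \<le> 2 * m * K * ((a / p - b / q)\<^sup>2 * (p * q)) + 2 * m\<^sup>2 * b\<^sup>2"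
proof -
  let ?s = "p * (a / p - b / q)" and ?t = "p / q * b"
  have m: "0 < m" using assms by (smt (verit) mult_nonpos_nonneg)
  have "a\<^sup>2 = (?s + ?t)\<^sup>2" using assms by (simp add: field_simps)
  also have "\<dots> \<le> 2 * ?s\<^sup>2 + 2 * ?t\<^sup>2" 
    using zero_le_power2[of "?s - ?t"] by (simp only: power2_sum power2_diff)
  also have "?s\<^sup>2 = p * p * (a / p - b / q)\<^sup>2" by (simp add: power2_eq_square)
  also have "\<dots> \<le> p * (m * q) * (a / p - b / q)\<^sup>2" using assms by (intro mult_right_mono mult_left_mono) auto
  also have "\<dots> = m * ((a / p - b / q)\<^sup>2 * (p * q)) * 1" by simp
  also have "\<dots> \<le> m * ((a / p - b / q)\<^sup>2 * (p * q)) * K" using assms m by (intro mult_left_mono) auto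
  also have "?t\<^sup>2 \<le> m\<^sup>2 * b\<^sup>2"
  proof -
    have "p / q \<le> m" using assms by (simp add: field_simps)
    then have "(p / q)\<^sup>2 \<le> m\<^sup>2" using assms by (intro power_mono) auto
    then show ?thesis by (simp only: power_mult_distrib) (rule mult_right_mono, auto)
  qed
  finally show ?thesis by (simp add: mult_ac)
qed

lemma ennreal_le_mult_add:
  assumes "a \<le> c * x + d * y" "0 \<le> c" "0 \<le> x" "0 \<le> d" "0 \<le> y"
  shows "ennreal a \<le> ennreal c * ennreal x + ennreal d * ennreal y"
  using assms by (simp add: ennreal_leI flip: ennreal_mult ennreal_plus)

text \<open>\<open>square_le_ground_density\<close> integrated in y over the shifted ball. S is any
  bound for the local integral of u^2, because two are used later: one from the q-norm for arbitrary
  R, and the full integral for R = 1.\<close>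

lemma ground_form_mean_value:
  fixes u :: "'a::euclidean_space \<Rightarrow> real"
  assumes \<alpha>: "1 < \<alpha>" and [measurable]: "u \<in> borel_measurable borel"
    and x: "norm x < 1" and R: "0 < R" "R \<le> 1"
    and g: "ground_form \<alpha> u x = ennreal g" "0 \<le> g"
    and S: "(\<integral>\<^sup>+y. ennreal ((u y)\<^sup>2) * indicator (ball ((1 - R / 2) *\<^sub>R x) (R / 2)) y \<partial>lborel) \<le> ennreal S" "0 \<le> S"
  shows "unit_ball_vol DIM('a) * (R / 2) ^ DIM('a) * (u x)\<^sup>2 \<le>
    2 * 4 powr ((\<alpha> - 1) / 2) * R powr (real DIM('a) + \<alpha>) * g + 2 * (4 powr ((\<alpha> - 1) / 2))\<^sup>2 * S"
proof -
  let ?A = "ball ((1 - R / 2) *\<^sub>R x) (R / 2)" and ?m = "4 powr ((\<alpha> - 1) / 2) :: real"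
  let ?\<beta> = "real DIM('a) + \<alpha>" and ?w = "ball_weight \<alpha> :: 'a \<Rightarrow> real"
  let ?V = "unit_ball_vol DIM('a) * (R / 2) ^ DIM('a)"
  define F where "F y = (u x / ?w x - u y / ?w y)\<^sup>2 * (?w x * ?w y) * norm (x - y) powr - ?\<beta>" for y
  have [measurable]: "F \<in> borel_measurable borel" unfolding F_def by measurable
  let ?C = "2 * ?m * R powr ?\<beta>"
  have wpos: "0 < ?w z" if "norm z < 1" for z
    using one_minus_norm_sq_pos[OF that] by (simp add: ball_weight_def)
  have pt: "(u x)\<^sup>2 \<le> ?C * F y + 2 * ?m\<^sup>2 * (u y)\<^sup>2" if y: "y \<in> ?A" for y
  proof (cases "y = x")
    case True
    \<comment> \<open>At y = x the kernel has the default value \<open>0 powr _ = 0\<close>, so its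
      lower bound fails there; the second summand alone suffices.\<close>
    have "1 \<le> ?m" using \<alpha> by (simp add: ge_one_powr_ge_zero)
    then have "1 \<le> ?m\<^sup>2" by simp
    then have "1 * (u x)\<^sup>2 \<le> 2 * ?m\<^sup>2 * (u x)\<^sup>2" by (intro mult_right_mono) auto
    then show ?thesis using True by (simp add: F_def)
  next
    case False
    note b = ball_towards_centre[OF x R y \<alpha>]
    have "norm (x - y) powr ?\<beta> \<le> R powr ?\<beta>" using b(2) \<alpha> by (intro powr_mono2) auto
    then have "1 \<le> R powr ?\<beta> * norm (x - y) powr - ?\<beta>"
      unfolding powr_minus using False by (simp add: pos_le_divide_eq flip: divide_inverse)
    from square_le_ground_density[OF wpos[OF x] wpos[OF b(1)] b(3) this, of "u x" "u y"]
    show ?thesis by (simp add: F_def mult_ac)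
  qed
  have "ennreal (?V * (u x)\<^sup>2) = (\<integral>\<^sup>+y. ennreal ((u x)\<^sup>2) * indicator ?A y \<partial>lborel)"
    using R by (simp add: nn_integral_cmult_indicator emeasure_ball mult.commute ennreal_mult' flip: ennreal_mult')
  also have "\<dots> \<le> (\<integral>\<^sup>+y. ennreal ?C * (ennreal (F y) * indicator (ball 0 1) y) +
      ennreal (2 * ?m\<^sup>2) * (ennreal ((u y)\<^sup>2) * indicator ?A y) \<partial>lborel)"
  proof (rule nn_integral_mono)
    fix y :: 'a
    show "ennreal ((u x)\<^sup>2) * indicator ?A y \<le> ennreal ?C * (ennreal (F y) * indicator (ball 0 1) y) +
      ennreal (2 * ?m\<^sup>2) * (ennreal ((u y)\<^sup>2) * indicator ?A y)"
    proof (cases "y \<in> ?A")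
      case True
      have "norm y < 1" by (rule ball_towards_centre[OF x R True \<alpha>])
      moreover have "0 \<le> F y" by (simp add: F_def ball_weight_def)
      ultimately have "ennreal ((u x)\<^sup>2) \<le> ennreal ?C * ennreal (F y) + ennreal (2 * ?m\<^sup>2) * ennreal ((u y)\<^sup>2)"
        by (intro ennreal_le_mult_add pt[OF True]) simp_all
      then show ?thesis using True \<open>norm y < 1\<close> by simp
    qed simp
  qed
  also have "\<dots> = ennreal ?C * ground_form \<alpha> u x + ennreal (2 * ?m\<^sup>2) * (\<integral>\<^sup>+y. ennreal ((u y)\<^sup>2) * indicator ?A y \<partial>lborel)"
  proof -
    have "ground_form \<alpha> u x = (\<integral>\<^sup>+y. ennreal (F y) * indicator (ball 0 1) y \<partial>lborel)"
      by (simp only: ground_form_def F_def)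
    moreover have "(\<integral>\<^sup>+y. ennreal ?C * (ennreal (F y) * indicator (ball 0 1) y) \<partial>lborel) =
        ennreal ?C * (\<integral>\<^sup>+y. ennreal (F y) * indicator (ball 0 1) y \<partial>lborel)"
      by (rule nn_integral_cmult) measurable
    moreover have "(\<integral>\<^sup>+y. ennreal (2 * ?m\<^sup>2) * (ennreal ((u y)\<^sup>2) * indicator ?A y) \<partial>lborel) =
        ennreal (2 * ?m\<^sup>2) * (\<integral>\<^sup>+y. ennreal ((u y)\<^sup>2) * indicator ?A y \<partial>lborel)"
      by (rule nn_integral_cmult) measurable
    moreover have "(\<integral>\<^sup>+y. ennreal ?C * (ennreal (F y) * indicator (ball 0 1) y) +
        ennreal (2 * ?m\<^sup>2) * (ennreal ((u y)\<^sup>2) * indicator ?A y) \<partial>lborel) =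
      (\<integral>\<^sup>+y. ennreal ?C * (ennreal (F y) * indicator (ball 0 1) y) \<partial>lborel) +
      (\<integral>\<^sup>+y. ennreal (2 * ?m\<^sup>2) * (ennreal ((u y)\<^sup>2) * indicator ?A y) \<partial>lborel)"
      by (rule nn_integral_add) measurable
    ultimately show ?thesis by (simp only:)
  qed
  also have "\<dots> \<le> ennreal ?C * ennreal g + ennreal (2 * ?m\<^sup>2) * ennreal S"
    unfolding g by (intro add_left_mono mult_left_mono S) simp
  also have "\<dots> = ennreal (?C * g + 2 * ?m\<^sup>2 * S)"
    using g S by (simp add: ennreal_mult)
  finally have *: "ennreal (?V * (u x)\<^sup>2) \<le> ennreal (?C * g + 2 * ?m\<^sup>2 * S)" .
  have "0 \<le> ?C * g + 2 * ?m\<^sup>2 * S" using g S by simp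
  with * show ?thesis by (simp only: ennreal_le_iff)
qed

lemma nn_integral_square_le:
  fixes u :: "'a::euclidean_space \<Rightarrow> real"
  assumes q: "2 < q" and [measurable]: "u \<in> borel_measurable borel" "A \<in> sets borel"
    and Y: "(\<integral>\<^sup>+y. ennreal (\<bar>u y\<bar> powr q) \<partial>lborel) = ennreal Y" "0 < Y"
    and V: "emeasure lborel A = ennreal V" "0 < V"
  shows "(\<integral>\<^sup>+y. ennreal ((u y)\<^sup>2) * indicator A y \<partial>lborel) \<le> ennreal (2 * V * (Y / V) powr (2 / q))"
proof -
  \<comment> \<open>Splitting at the level $|u|^2 = l$ replaces Hoelder's inequality.\<close>
  define l where "l = (Y / V) powr (2 / q)"
  have l: "0 < l" using Y V by (simp add: l_def)
  have pt: "t\<^sup>2 \<le> l + l powr (1 - q / 2) * \<bar>t\<bar> powr q" for t :: real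
  proof (cases "t\<^sup>2 \<le> l")
    case False
    then have t: "0 < \<bar>t\<bar>" using l by auto
    have "t\<^sup>2 = (t\<^sup>2) powr (1 - q / 2) * (t\<^sup>2) powr (q / 2)"
      using t by (simp flip: powr_add)
    also have "(t\<^sup>2) powr (q / 2) = \<bar>t\<bar> powr q"
      using power2_powr[OF t, of "q / 2"] by simp
    also have "(t\<^sup>2) powr (1 - q / 2) * \<bar>t\<bar> powr q \<le> l powr (1 - q / 2) * \<bar>t\<bar> powr q"
      using False l q by (intro mult_right_mono powr_mono2') auto
    finally show ?thesis using l by simp
  qed (simp add: add_increasing2)
  have "(\<integral>\<^sup>+y. ennreal ((u y)\<^sup>2) * indicator A y \<partial>lborel) \<le>
      (\<integral>\<^sup>+y. ennreal l * indicator A y + ennreal (l powr (1 - q / 2)) * ennreal (\<bar>u y\<bar> powr q) \<partial>lborel)"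
  proof (rule nn_integral_mono)
    fix y
    show "ennreal ((u y)\<^sup>2) * indicator A y \<le>
      ennreal l * indicator A y + ennreal (l powr (1 - q / 2)) * ennreal (\<bar>u y\<bar> powr q)"
      using pt[of "u y"] l by (auto simp: ennreal_leI simp flip: ennreal_mult ennreal_plus split: split_indicator)
  qed
  also have "\<dots> = ennreal (l * V + l powr (1 - q / 2) * Y)"
    using l Y V by (simp add: nn_integral_add nn_integral_cmult nn_integral_cmult_indicator ennreal_mult)
  also have "l powr (1 - q / 2) * Y = l * V"
  proof -
    have "l powr (q / 2) = Y / V" using q Y V by (simp add: l_def powr_powr)
    then have "l powr (1 - q / 2) = l / (Y / V)"
      using l by (simp only: powr_diff powr_one less_imp_le)
    then show ?thesis using Y V by simp
  qed
  finally show ?thesis by (simp add: l_def mult_ac)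
qed

text \<open>U stands for u(x)^2, g for the energy density, Z for the squared q-norm and s for q / 2.
  The two R-dependent terms balance at R^n = Z / g, which is at most 1 exactly when Z \<le> g.
  Otherwise g < Z, and g^s \<le> g Z^(s - 1) makes the bound for R = 1 as good.\<close>

lemma optimise_radius:
  fixes n \<alpha> C g Q Z U :: real
  assumes \<alpha>: "0 < \<alpha>" "\<alpha> < n" and nn: "0 < C" "0 \<le> g" "0 \<le> Q" "0 < Z" "0 \<le> U"
    and R: "\<And>R. 0 < R \<Longrightarrow> R \<le> 1 \<Longrightarrow> U \<le> C * (R powr \<alpha> * g + R powr (\<alpha> - n) * Z)"
    and 1: "U \<le> C * (g + Q)"
  defines "s \<equiv> n / (n - \<alpha>)"
  shows "U powr s \<le> (2 * C) powr s * (g * Z powr (s - 1) + Q powr s)"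
proof -
  have s: "1 < s" using \<alpha> by (simp add: s_def)
  have s1: "s - 1 = \<alpha> / (n - \<alpha>)" using \<alpha> by (simp add: s_def field_simps)
  show ?thesis
  proof (cases "Z \<le> g")
    case True
    then have g: "0 < g" using nn by simp
    \<comment> \<open>Both terms equal Z^(\<alpha> / n) g^(1 - \<alpha> / n) at this radius, and (1
      - \<alpha> / n) s = 1 makes the result linear in g.\<close>
    define r where "r = (Z / g) powr (1 / n)"
    have r: "0 < r" "r \<le> 1" using True nn g \<alpha> by (auto simp: r_def intro!: powr_le1)
    have "r powr \<alpha> * g = Z powr (\<alpha> / n) * g powr (1 - \<alpha> / n)"
      using g nn by (simp add: r_def powr_powr powr_divide powr_diff)
    moreover have "r powr (\<alpha> - n) * Z = Z powr (\<alpha> / n) * g powr (1 - \<alpha> / n)"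
      using g nn \<alpha> by (simp add: r_def powr_powr powr_divide powr_diff diff_divide_distrib)
    ultimately have "U \<le> 2 * C * (Z powr (\<alpha> / n) * g powr (1 - \<alpha> / n))"
      using R[OF r] by simp
    then have "U powr s \<le> (2 * C * (Z powr (\<alpha> / n) * g powr (1 - \<alpha> / n))) powr s"
      using s nn by (intro powr_mono2) auto
    also have "\<dots> = (2 * C) powr s * (Z powr (\<alpha> / n * s) * g powr ((1 - \<alpha> / n) * s))"
      using nn by (simp add: powr_mult powr_powr)
    also have "\<alpha> / n * s = s - 1" unfolding s1 using \<alpha> by (simp add: s_def)
    also have "(1 - \<alpha> / n) * s = 1" using \<alpha> by (simp add: s_def field_simps)
    finally show ?thesis using nn g by (simp add: distrib_left mult_ac add_increasing2)
  next
    case False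
    have "U \<le> 2 * C * max g Q" using 1 nn by (smt (verit) mult_left_mono mult.assoc mult.commute distrib_left)
    then have "U powr s \<le> (2 * C * max g Q) powr s" using s nn by (intro powr_mono2) auto
    also have "\<dots> = (2 * C) powr s * (max g Q) powr s" using nn by (simp add: powr_mult)
    also have "(max g Q) powr s \<le> g powr s + Q powr s" by (simp add: max_def)
    also have "g powr s \<le> g * Z powr (s - 1)"
    proof -
      have "g powr s = g * g powr (s - 1)" using nn by (cases "g = 0") (auto simp: powr_mult_base)
      also have "\<dots> \<le> g * Z powr (s - 1)" using False nn s by (intro mult_left_mono powr_mono2) auto
      finally show ?thesis .
    qed
    finally show ?thesis using nn by simp
  qed
qed

text \<open>If Z exceeded K (D + Q) with K = C (2 + V) + 1, then D and Q would be at most Z / K, and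
  by homogeneity the right-hand side at most C (2 + V) / K times Z^s, which is less than Z^s. The
  added 1 makes this strict and also gives K \<ge> 1, so that K^s \<ge> K.\<close>

lemma absorb_powers:
  fixes s C D Q V Z :: real
  assumes "1 < s" "0 < C" "0 \<le> D" "0 \<le> Q" "0 \<le> V" "0 < Z"
    and le: "Z powr s \<le> C * (2 * D * Z powr (s - 1) + V * Q powr s)"
  shows "Z \<le> (C * (2 + V) + 1) * (D + Q)"
proof (rule ccontr)
  define K where "K = C * (2 + V) + 1"
  have K: "1 \<le> K" using assms by (simp add: K_def)
  assume "\<not> Z \<le> (C * (2 + V) + 1) * (D + Q)"
  then have "K * (D + Q) < Z" by (simp add: K_def)
  then have "D + Q < Z / K" using K by (simp add: field_simps)
  then have DQ: "D \<le> Z / K" "Q \<le> Z / K" using assms by linarith+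
  have "D * Z powr (s - 1) \<le> Z / K * Z powr (s - 1)" using DQ by (intro mult_right_mono) auto
  also have "\<dots> = Z powr s / K" using assms by (simp add: powr_diff)
  finally have 1: "D * Z powr (s - 1) \<le> Z powr s / K" .
  have "Q powr s \<le> (Z / K) powr s" using DQ assms by (intro powr_mono2) auto
  also have "\<dots> = Z powr s / K powr s" using K assms by (simp add: powr_divide)
  also have "\<dots> \<le> Z powr s / K powr 1" using K assms by (intro divide_left_mono powr_mono mult_pos_pos) auto
  finally have "Q powr s \<le> Z powr s / K" using K by simp
  then have "V * Q powr s \<le> V * (Z powr s / K)" using assms by (intro mult_left_mono) auto
  with 1 have "2 * D * Z powr (s - 1) + V * Q powr s \<le> (2 + V) * (Z powr s / K)" 
    by (simp only: distrib_right mult.assoc)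
  then have "C * (2 * D * Z powr (s - 1) + V * Q powr s) \<le> C * ((2 + V) * (Z powr s / K))"
    using assms by (intro mult_left_mono) auto
  with le have "Z powr s \<le> (C * (2 + V)) / K * Z powr s" by simp
  also have "\<dots> < 1 * Z powr s" 
  proof (rule mult_strict_right_mono)
    have "C * (2 + V) < K" by (simp add: K_def)
    then show "C * (2 + V) / K < 1" using K by (simp add: divide_less_eq_1)
  qed (use assms in simp)
  finally show False by simp
qed

lemma ground_form_measurable [measurable]:
  assumes [measurable]: "u \<in> borel_measurable borel"
  shows "ground_form \<alpha> u \<in> borel_measurable borel"
  unfolding ground_form_def[abs_def] by measurable

text \<open>The criticality of q enters through 2 / q = (n - \<alpha>) / n: the mean of u^2 over a
  ball of radius R is bounded by R^(\<alpha> - n) times the squared q-norm, the scaling that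
  \<open>optimise_radius\<close> expects.\<close>

lemma ground_form_pointwise:
  fixes \<alpha> :: real
  assumes \<alpha>: "1 < \<alpha>" "\<alpha> < 2" and n: "2 \<le> DIM('a::euclidean_space)"
  defines "q \<equiv> 2 * real DIM('a) / (real DIM('a) - \<alpha>)"
  obtains C where "0 < C" "\<And>(u::'a \<Rightarrow> real) x g Q Y. u \<in> borel_measurable borel \<Longrightarrow> norm x < 1 \<Longrightarrow>
    ground_form \<alpha> u x = ennreal g \<Longrightarrow> 0 \<le> g \<Longrightarrow> (\<integral>\<^sup>+x. ennreal ((u x)\<^sup>2) \<partial>lborel) = ennreal Q \<Longrightarrow> 0 \<le> Q \<Longrightarrow>
    (\<integral>\<^sup>+x. ennreal (\<bar>u x\<bar> powr q) \<partial>lborel) = ennreal Y \<Longrightarrow> 0 < Y \<Longrightarrow>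
    \<bar>u x\<bar> powr q \<le> C * (g * (Y powr (2 / q)) powr (q / 2 - 1) + Q powr (q / 2))"
proof -
  define d where "d = real DIM('a)"
  have d: "\<alpha> < d" "0 < d" using n \<alpha> by (auto simp: d_def)
  define V where "V = unit_ball_vol DIM('a)"
  have V: "0 < V" by (simp add: V_def)
  define m where "m = (4 powr ((\<alpha> - 1) / 2) :: real)"
  have m: "0 < m" by (simp add: m_def)
  have q: "2 < q" "q / 2 = d / (d - \<alpha>)" "2 / q = (d - \<alpha>) / d"
    using d \<alpha> by (auto simp: q_def d_def[symmetric] field_simps)
  define W where "W = V / 2 ^ DIM('a)"
  have W: "0 < W" using V by (simp add: W_def)
  \<comment> \<open>One summand for each use: the energy term, the mean of u^2 bounded through the
    q-norm, and the mean bounded by the full integral at R = 1. W is the volume of a ball of radius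
    1 / 2.\<close>
  define C where "C = 2 * m / W + 4 * m\<^sup>2 * W powr - (2 / q) + 2 * m\<^sup>2 / W"
  have C: "0 < C" using m W by (auto simp: C_def intro!: add_pos_pos)
  have C_ge: "2 * m / W \<le> C" "4 * m\<^sup>2 * W powr - (2 / q) \<le> C" "2 * m\<^sup>2 / W \<le> C"
    using m W by (auto simp: C_def)
  have "\<bar>u x\<bar> powr q \<le> (2 * C) powr (q / 2) * (g * (Y powr (2 / q)) powr (q / 2 - 1) + Q powr (q / 2))"
    if u [measurable]: "u \<in> borel_measurable borel" and x: "norm x < 1"
      and g: "ground_form \<alpha> u x = ennreal g" "0 \<le> g"
      and Q: "(\<integral>\<^sup>+x. ennreal ((u x)\<^sup>2) \<partial>lborel) = ennreal Q" "0 \<le> Q"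
      and Y: "(\<integral>\<^sup>+x. ennreal (\<bar>u x\<bar> powr q) \<partial>lborel) = ennreal Y" "0 < Y"
    for u :: "'a \<Rightarrow> real" and x g Q Y
  proof -
    define Z where "Z = Y powr (2 / q)"
    have Z: "0 < Z" using Y by (simp add: Z_def)
    have vol: "unit_ball_vol DIM('a) * (R / 2) ^ DIM('a) = W * R powr d" if "0 < R" for R
      using that by (simp add: W_def V_def d_def powr_realpow power_divide)
    have mean: "(u x)\<^sup>2 \<le> 2 * m / W * R powr \<alpha> * g + 2 * m\<^sup>2 * S / (W * R powr d)"
      if R: "0 < R" "R \<le> 1" and S: "(\<integral>\<^sup>+y. ennreal ((u y)\<^sup>2) *
        indicator (ball ((1 - R / 2) *\<^sub>R x) (R / 2)) y \<partial>lborel) \<le> ennreal S" "0 \<le> S" for R S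
    proof -
      have "(W * R powr d) * (u x)\<^sup>2 \<le> 2 * m * R powr (d + \<alpha>) * g + 2 * m\<^sup>2 * S"
        using ground_form_mean_value[OF \<alpha>(1) u x R g S] unfolding vol[OF R(1)] m_def d_def .
      then have "(u x)\<^sup>2 \<le> (2 * m * R powr (d + \<alpha>) * g + 2 * m\<^sup>2 * S) / (W * R powr d)"
        using W R by (simp add: field_simps)
      also have "\<dots> = 2 * m / W * R powr \<alpha> * g + 2 * m\<^sup>2 * S / (W * R powr d)"
        using W R by (simp add: powr_add field_simps)
      finally show ?thesis .
    qed
    have "((u x)\<^sup>2) powr (d / (d - \<alpha>)) \<le> (2 * C) powr (d / (d - \<alpha>)) *
        (g * Z powr (d / (d - \<alpha>) - 1) + Q powr (d / (d - \<alpha>)))"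
    proof (rule optimise_radius)
      fix R :: real assume R: "0 < R" "R \<le> 1"
      let ?v = "W * R powr d"
      have v: "0 < ?v" using W R by simp
      have "emeasure lborel (ball ((1 - R / 2) *\<^sub>R x) (R / 2)) = ennreal ?v"
        using R by (simp add: emeasure_ball vol)
      from nn_integral_square_le[OF q(1) u _ Y this v]
      have "(u x)\<^sup>2 \<le> 2 * m / W * R powr \<alpha> * g + 2 * m\<^sup>2 * (2 * ?v * (Y / ?v) powr (2 / q)) / ?v"
        using v by (intro mean R) auto
      also have "2 * m\<^sup>2 * (2 * ?v * (Y / ?v) powr (2 / q)) / ?v = 4 * m\<^sup>2 * (Y / ?v) powr (2 / q)"
        using v by simp
      also have "(Y / ?v) powr (2 / q) = W powr - (2 / q) * (R powr (\<alpha> - d) * Z)"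
      proof -
        have "(Y / ?v) powr (2 / q) = Z / (W powr (2 / q) * (R powr d) powr (2 / q))"
          using Y W R by (simp only: powr_divide powr_mult Z_def)
        also have "(R powr d) powr (2 / q) = R powr (d - \<alpha>)"
          unfolding powr_powr q(3) using d by simp
        also have "Z / (W powr (2 / q) * R powr (d - \<alpha>)) = W powr - (2 / q) * (R powr (\<alpha> - d) * Z)"
          using R by (simp add: powr_minus_divide powr_diff)
        finally show ?thesis .
      qed
      also have "2 * m / W * R powr \<alpha> * g \<le> C * R powr \<alpha> * g"
        using g C_ge by (intro mult_right_mono) auto
      also have "4 * m\<^sup>2 * (W powr - (2 / q) * (R powr (\<alpha> - d) * Z)) \<le> C * (R powr (\<alpha> - d) * Z)"
        unfolding mult.assoc[symmetric, of _ "W powr - (2 / q)"] using Z C_ge by (intro mult_right_mono) auto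
      finally show "(u x)\<^sup>2 \<le> C * (R powr \<alpha> * g + R powr (\<alpha> - d) * Z)"
        by (simp add: distrib_left mult.assoc)
    next
      \<comment> \<open>The case R = 1, with the integral over the ball enlarged to the whole
        space.\<close>
      have "(u x)\<^sup>2 \<le> 2 * m / W * 1 powr \<alpha> * g + 2 * m\<^sup>2 * Q / (W * 1 powr d)"
      proof (rule mean)
        show "(\<integral>\<^sup>+y. ennreal ((u y)\<^sup>2) * indicator (ball ((1 - 1 / 2) *\<^sub>R x) (1 / 2)) y \<partial>lborel) \<le> ennreal Q"
          unfolding Q(1)[symmetric] by (intro nn_integral_mono) (auto split: split_indicator)
      qed (use Q in auto)
      also have "\<dots> = 2 * m / W * g + 2 * m\<^sup>2 / W * Q" by simp
      also have "\<dots> \<le> C * g + C * Q" using C_ge g Q by (intro add_mono mult_right_mono)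
      finally show "(u x)\<^sup>2 \<le> C * (g + Q)" by (simp add: distrib_left)
    qed (use \<alpha> d C g Q Z in auto)
    moreover have "((u x)\<^sup>2) powr (q / 2) = \<bar>u x\<bar> powr q"
      using power2_powr[of "\<bar>u x\<bar>" "q / 2"] by (cases "u x = 0") auto
    ultimately show ?thesis unfolding q(2)[symmetric] Z_def by simp
  qed
  moreover have "0 < (2 * C) powr (q / 2)" using C by simp
  ultimately show ?thesis using that by blast
qed

text \<open>Let Z be the squared q-norm. Integrating the pointwise bound over the ball gives Y =
  Z^(q/2) on the left and, on the right, the energy times the lower power Z^(q/2 - 1). Since Y is
  finite, \<open>absorb_powers\<close> can divide that power out.\<close>

lemma weighted_sobolev:
  fixes \<alpha> :: real
  assumes \<alpha>: "1 < \<alpha>" "\<alpha> < 2" and n: "2 \<le> DIM('a::euclidean_space)"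
  defines "q \<equiv> 2 * real DIM('a) / (real DIM('a) - \<alpha>)"
  obtains C where "0 < C" "\<And>(u::'a \<Rightarrow> real) D Q Y. u \<in> borel_measurable borel \<Longrightarrow>
    (\<forall>x. 1 \<le> norm x \<longrightarrow> u x = 0) \<Longrightarrow>
    ennreal (1 / 2) * (\<integral>\<^sup>+x. ground_form \<alpha> u x * indicator (ball 0 1) x \<partial>lborel) = ennreal D \<Longrightarrow> 0 \<le> D \<Longrightarrow>
    (\<integral>\<^sup>+x. ennreal ((u x)\<^sup>2) \<partial>lborel) = ennreal Q \<Longrightarrow> 0 \<le> Q \<Longrightarrow>
    (\<integral>\<^sup>+x. ennreal (\<bar>u x\<bar> powr q) \<partial>lborel) = ennreal Y \<Longrightarrow> 0 \<le> Y \<Longrightarrow> Y powr (2 / q) \<le> C * (D + Q)"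
proof -
  obtain C where C: "0 < C" "\<And>(u::'a \<Rightarrow> real) x g Q Y. u \<in> borel_measurable borel \<Longrightarrow> norm x < 1 \<Longrightarrow>
    ground_form \<alpha> u x = ennreal g \<Longrightarrow> 0 \<le> g \<Longrightarrow> (\<integral>\<^sup>+x. ennreal ((u x)\<^sup>2) \<partial>lborel) = ennreal Q \<Longrightarrow> 0 \<le> Q \<Longrightarrow>
    (\<integral>\<^sup>+x. ennreal (\<bar>u x\<bar> powr q) \<partial>lborel) = ennreal Y \<Longrightarrow> 0 < Y \<Longrightarrow>
    \<bar>u x\<bar> powr q \<le> C * (g * (Y powr (2 / q)) powr (q / 2 - 1) + Q powr (q / 2))"
    by (rule ground_form_pointwise[OF \<alpha> n, folded q_def]) (rule that; assumption)
  define V where "V = unit_ball_vol DIM('a)"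
  have V: "0 \<le> V" by (simp add: V_def)
  have q: "1 < q / 2" "0 < q" using n \<alpha> by (auto simp: q_def field_simps)
  let ?K = "C * (2 + V) + 1"
  have K: "0 < ?K" using C V by (simp add: add_nonneg_pos)
  have "Y powr (2 / q) \<le> ?K * (D + Q)"
    if u [measurable]: "u \<in> borel_measurable borel" and u0: "\<forall>x. 1 \<le> norm x \<longrightarrow> u x = 0"
      and D: "ennreal (1 / 2) * (\<integral>\<^sup>+x. ground_form \<alpha> u x * indicator (ball 0 1) x \<partial>lborel) = ennreal D" "0 \<le> D"
      and Q: "(\<integral>\<^sup>+x. ennreal ((u x)\<^sup>2) \<partial>lborel) = ennreal Q" "0 \<le> Q"
      and Y: "(\<integral>\<^sup>+x. ennreal (\<bar>u x\<bar> powr q) \<partial>lborel) = ennreal Y" "0 \<le> Y"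
    for u :: "'a \<Rightarrow> real" and D Q Y
  proof (cases "Y = 0")
    case True
    then show ?thesis using K D Q by simp
  next
    case False
    with Y have Y0: "0 < Y" by simp
    define Z where "Z = Y powr (2 / q)"
    have Z: "0 < Z" using Y0 by (simp add: Z_def)
    define c1 where "c1 = C * Z powr (q / 2 - 1)"
    define c2 where "c2 = C * Q powr (q / 2)"
    have c: "0 < c1" "0 \<le> c2" using C Z by (auto simp: c1_def c2_def)
    have two: "2 * ennreal (1 / 2) = 1" using ennreal_mult[of 2 "1 / 2"] by simp
    have G: "(\<integral>\<^sup>+x. ground_form \<alpha> u x * indicator (ball 0 1) x \<partial>lborel) = ennreal (2 * D)"
    proof -
      have "(\<integral>\<^sup>+x. ground_form \<alpha> u x * indicator (ball 0 1) x \<partial>lborel) =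
          2 * (ennreal (1 / 2) * (\<integral>\<^sup>+x. ground_form \<alpha> u x * indicator (ball 0 1) x \<partial>lborel))"
        by (simp only: mult.assoc[symmetric] two mult_1_left)
      then show ?thesis unfolding D(1) using D(2) by (simp add: ennreal_mult)
    qed
    have "ennreal Y \<le> (\<integral>\<^sup>+x. ennreal c1 * (ground_form \<alpha> u x * indicator (ball 0 1) x) +
        ennreal c2 * indicator (ball (0::'a) 1) x \<partial>lborel)"
      unfolding Y(1)[symmetric]
    proof (rule nn_integral_mono)
      fix x :: 'a
      show "ennreal (\<bar>u x\<bar> powr q) \<le> ennreal c1 * (ground_form \<alpha> u x * indicator (ball 0 1) x) +
        ennreal c2 * indicator (ball 0 1) x"
      proof (cases "norm x < 1")
        case True
        show ?thesis
        proof (cases "ground_form \<alpha> u x")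
          case (real g)
          from C(2)[OF u True real(2,1) Q Y(1) Y0]
          have "\<bar>u x\<bar> powr q \<le> c1 * g + c2 * 1"
            unfolding c1_def c2_def Z_def by (simp add: distrib_left mult_ac)
          then have "ennreal (\<bar>u x\<bar> powr q) \<le> ennreal c1 * ennreal g + ennreal c2 * ennreal 1"
            by (rule ennreal_le_mult_add) (use c real in auto)
          then show ?thesis using True real by simp
        next
          case top
          \<comment> \<open>An infinite density makes the bound trivial, because c1 > 0.\<close>
          then show ?thesis using True c by (simp add: ennreal_mult_top)
        qed
      qed (simp add: u0)
    qed
    also have "\<dots> = ennreal c1 * ennreal (2 * D) + ennreal c2 * ennreal V"
    proof -
      have "(\<integral>\<^sup>+x. ennreal c1 * (ground_form \<alpha> u x * indicator (ball 0 1) x) \<partial>lborel) =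
          ennreal c1 * (\<integral>\<^sup>+x. ground_form \<alpha> u x * indicator (ball 0 1) x \<partial>lborel)"
        by (rule nn_integral_cmult) measurable
      moreover have "(\<integral>\<^sup>+x. ennreal c2 * indicator (ball (0::'a) 1) x \<partial>lborel) = ennreal c2 * emeasure lborel (ball (0::'a) 1)"
        by (rule nn_integral_cmult_indicator) simp
      moreover have "emeasure lborel (ball (0::'a) 1) = ennreal V" by (simp add: emeasure_ball V_def)
      ultimately show ?thesis by (subst nn_integral_add) (simp_all add: G)
    qed
    also have "\<dots> = ennreal (C * (2 * D * Z powr (q / 2 - 1) + V * Q powr (q / 2)))"
    proof -
      have "C * (2 * D * Z powr (q / 2 - 1) + V * Q powr (q / 2)) = c1 * (2 * D) + c2 * V"
        unfolding c1_def c2_def by (simp only: distrib_left mult_ac)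
      moreover have "ennreal (c1 * (2 * D) + c2 * V) = ennreal c1 * ennreal (2 * D) + ennreal c2 * ennreal V"
        using c D V by (subst ennreal_plus) (auto simp: ennreal_mult'')
      ultimately show ?thesis by simp
    qed
    finally have *: "ennreal Y \<le> ennreal (C * (2 * D * Z powr (q / 2 - 1) + V * Q powr (q / 2)))" .
    have "Y \<le> C * (2 * D * Z powr (q / 2 - 1) + V * Q powr (q / 2))"
    proof -
      have "0 \<le> C * (2 * D * Z powr (q / 2 - 1) + V * Q powr (q / 2))"
        using C(1) D(2) V by simp
      with * show ?thesis by (simp only: ennreal_le_iff)
    qed
    moreover have "Z powr (q / 2) = Y" using q Y0 by (simp add: Z_def powr_powr)
    ultimately show ?thesis
      unfolding Z_def[symmetric] by (intro absorb_powers[OF q(1) C(1) D(2) Q(2) V Z]) simp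
  qed
  then show ?thesis using that[OF K] by blast
qed

section \<open>Scaling and conclusion\<close>

lemma powr_integral_finite:
  fixes u :: "'a::euclidean_space \<Rightarrow> real"
  assumes "u \<in> Cc (ball 0 1)" "0 < q"
  shows "(\<integral>\<^sup>+x. ennreal (\<bar>u x\<bar> powr q) \<partial>lborel) < \<infinity>"
proof -
  obtain M r where M: "0 \<le> M" "\<And>x. \<bar>u x\<bar> \<le> M" "0 \<le> r" "r < 1" "\<And>x. r < norm x \<Longrightarrow> u x = 0"
    using Cc_ball_bounded[OF assms(1)] by blast
  have "(\<integral>\<^sup>+x. ennreal (\<bar>u x\<bar> powr q) \<partial>lborel) \<le> (\<integral>\<^sup>+x. ennreal (M powr q) * indicator (ball (0::'a) 1) x \<partial>lborel)"
  proof (rule nn_integral_mono)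
    fix x :: 'a
    show "ennreal (\<bar>u x\<bar> powr q) \<le> ennreal (M powr q) * indicator (ball 0 1) x"
      using M assms by (cases "norm x < 1") (auto intro!: ennreal_leI powr_mono2)
  qed
  also have "\<dots> < \<infinity>"
    using emeasure_bounded_finite[OF bounded_ball, of "0::'a" 1]
    by (simp add: nn_integral_cmult_indicator ennreal_mult_less_top)
  finally show ?thesis .
qed

lemma unit_ball_inequality:
  fixes \<alpha> :: real
  assumes \<alpha>: "1 < \<alpha>" "\<alpha> < 2" and n: "2 \<le> DIM('a::euclidean_space)"
  defines "q \<equiv> 2 * real DIM('a) / (real DIM('a) - \<alpha>)"
  obtains c where "0 < c" "\<And>(u::'a \<Rightarrow> real) H Y. u \<in> Cc (ball 0 1) \<Longrightarrow>
    (\<integral>\<^sup>+x. ennreal ((u x)\<^sup>2 * (1 - (norm x)\<^sup>2) powr - \<alpha>) \<partial>lborel) = ennreal H \<Longrightarrow> 0 \<le> H \<Longrightarrow>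
    (\<integral>\<^sup>+x. ennreal (\<bar>u x\<bar> powr q) \<partial>lborel) = ennreal Y \<Longrightarrow> 0 \<le> Y \<Longrightarrow>
    ennreal (2 powr \<alpha> * kappa DIM('a) \<alpha> * H + c * Y powr (2 / q)) \<le> energy (ball 0 1) \<alpha> u"
proof -
  let ?k = "2 powr \<alpha> * kappa DIM('a) \<alpha>"
  obtain c0 where c0: "0 < c0" "\<And>u::'a \<Rightarrow> real. u \<in> Cc (ball 0 1) \<Longrightarrow>
    ennreal (1 / 2) * (\<integral>\<^sup>+x. ground_form \<alpha> u x * indicator (ball 0 1) x \<partial>lborel) +
    ennreal ?k * (\<integral>\<^sup>+x. ennreal ((u x)\<^sup>2 * (1 - (norm x)\<^sup>2) powr - \<alpha>) \<partial>lborel) +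
    ennreal c0 * (\<integral>\<^sup>+x. ennreal ((u x)\<^sup>2) \<partial>lborel) \<le> energy (ball 0 1) \<alpha> u"
    by (rule hardy_ground_state[OF \<alpha>, where 'a = 'a]) (rule that; assumption)
  obtain C where C: "0 < C" "\<And>(u::'a \<Rightarrow> real) D Q Y. u \<in> borel_measurable borel \<Longrightarrow>
    (\<forall>x. 1 \<le> norm x \<longrightarrow> u x = 0) \<Longrightarrow>
    ennreal (1 / 2) * (\<integral>\<^sup>+x. ground_form \<alpha> u x * indicator (ball 0 1) x \<partial>lborel) = ennreal D \<Longrightarrow> 0 \<le> D \<Longrightarrow>
    (\<integral>\<^sup>+x. ennreal ((u x)\<^sup>2) \<partial>lborel) = ennreal Q \<Longrightarrow> 0 \<le> Q \<Longrightarrow>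
    (\<integral>\<^sup>+x. ennreal (\<bar>u x\<bar> powr q) \<partial>lborel) = ennreal Y \<Longrightarrow> 0 \<le> Y \<Longrightarrow> Y powr (2 / q) \<le> C * (D + Q)"
    by (rule weighted_sobolev[OF \<alpha> n, folded q_def]) (rule that; assumption)
  \<comment> \<open>The Hardy step leaves D + c0 Q, whereas the Sobolev step consumes a multiple of
    D + Q; the minimum fits the second into the first.\<close>
  define c where "c = min 1 c0 / C"
  have c: "0 < c" using c0(1) C(1) by (simp add: c_def)
  have "ennreal (?k * H + c * Y powr (2 / q)) \<le> energy (ball 0 1) \<alpha> u"
    if u: "u \<in> Cc (ball 0 1)"
      and H: "(\<integral>\<^sup>+x. ennreal ((u x)\<^sup>2 * (1 - (norm x)\<^sup>2) powr - \<alpha>) \<partial>lborel) = ennreal H" "0 \<le> H"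
      and Y: "(\<integral>\<^sup>+x. ennreal (\<bar>u x\<bar> powr q) \<partial>lborel) = ennreal Y" "0 \<le> Y"
    for u :: "'a \<Rightarrow> real" and H Y
  proof -
    have meas: "u \<in> borel_measurable borel" by (rule Cc_measurable[OF u])
    have u0: "u x = 0" if "1 \<le> norm x" for x using u that by (force simp: Cc_def)
    have "(\<integral>\<^sup>+x. ennreal ((u x)\<^sup>2) \<partial>lborel) = (\<integral>\<^sup>+x. ennreal ((u x)\<^sup>2 * (1 - (norm x)\<^sup>2) powr - 0) \<partial>lborel)"
    proof (rule nn_integral_cong)
      show "ennreal ((u x)\<^sup>2) = ennreal ((u x)\<^sup>2 * (1 - (norm x)\<^sup>2) powr - 0)" for x
        using u0[of x] one_minus_norm_sq_pos[of x] by (cases "norm x < 1") auto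
    qed
    also have "\<dots> < \<infinity>" by (rule hardy_integral_finite[OF u]) simp
    finally obtain Q where Q: "(\<integral>\<^sup>+x. ennreal ((u x)\<^sup>2) \<partial>lborel) = ennreal Q" "0 \<le> Q"
      by (cases "\<integral>\<^sup>+x. ennreal ((u x)\<^sup>2) \<partial>lborel") auto
    let ?D = "ennreal (1 / 2) * (\<integral>\<^sup>+x. ground_form \<alpha> u x * indicator (ball 0 1) x \<partial>lborel)"
    from c0(2)[OF u] have le: "?D + ennreal ?k * ennreal H + ennreal c0 * ennreal Q \<le> energy (ball 0 1) \<alpha> u"
      unfolding H Q .
    show ?thesis
    proof (cases "?D = \<infinity>")
      case True
      then have "energy (ball 0 1) \<alpha> u = \<infinity>" using le by (simp add: top_unique)
      then show ?thesis by simp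
    next
      case False
      then obtain D where D: "?D = ennreal D" "0 \<le> D" by (cases ?D) auto
      have "c * Y powr (2 / q) \<le> c * (C * (D + Q))"
        using C(2)[OF meas _ D Q Y] u0 c by (intro mult_left_mono) auto
      also have "\<dots> = min 1 c0 * D + min 1 c0 * Q" using C(1) by (simp add: c_def distrib_left)
      also have "\<dots> \<le> 1 * D + c0 * Q" using D Q by (intro add_mono mult_right_mono) auto
      finally have "?k * H + c * Y powr (2 / q) \<le> ?k * H + (D + c0 * Q)" by simp
      then have "ennreal (?k * H + c * Y powr (2 / q)) \<le> ennreal (?k * H + (D + c0 * Q))" by (rule ennreal_leI)
      \<comment> \<open>The sign of ?k is not at hand here. If ?k H is negative, dropping it only
        enlarges the real number, and \<open>ennreal\<close> maps it to 0.\<close>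
      also have "\<dots> \<le> ennreal (?k * H) + ennreal (D + c0 * Q)"
      proof (cases "0 \<le> ?k * H")
        case True
        then show ?thesis using D Q c0(1) by (subst ennreal_plus) auto
      next
        case False
        then have "ennreal (?k * H + (D + c0 * Q)) \<le> ennreal (D + c0 * Q)" by (intro ennreal_leI) linarith
        then show ?thesis by (simp add: add_increasing)
      qed
      also have "\<dots> = ennreal D + ennreal ?k * ennreal H + ennreal c0 * ennreal Q"
      proof -
        have "ennreal (?k * H) = ennreal ?k * ennreal H" by (rule ennreal_mult''[OF H(2)])
        moreover have "ennreal (D + c0 * Q) = ennreal D + ennreal c0 * ennreal Q"
          using D(2) Q(2) c0(1) by (subst ennreal_plus) (auto simp: ennreal_mult'')
        ultimately show ?thesis by (simp only: ac_simps)
      qed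
      finally show ?thesis using le unfolding D by (rule order_trans)
    qed
  qed
  then show ?thesis by (rule that[OF c])
qed

section \<open>Behaviour under dilation\<close>

lemma Cc_scale:
  fixes u :: "'a::euclidean_space \<Rightarrow> real"
  assumes "u \<in> Cc (ball 0 r)" "0 < r"
  shows "(\<lambda>x. u (r *\<^sub>R x)) \<in> Cc (ball 0 1)"
proof -
  from assms obtain K where u: "continuous_on UNIV u" and K: "compact K" "K \<subseteq> ball 0 r" "\<And>x. x \<notin> K \<Longrightarrow> u x = 0"
    by (auto simp: Cc_def)
  let ?K = "(\<lambda>x. (1 / r) *\<^sub>R x) ` K"
  have "compact ?K" by (intro compact_scaling K)
  moreover have "?K \<subseteq> ball 0 1" using K(2) assms(2) by (auto simp: field_simps)
  moreover have "u (r *\<^sub>R x) = 0" if "x \<notin> ?K" for x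
  proof (rule K(3))
    show "r *\<^sub>R x \<notin> K" using that assms(2) by (auto simp: image_iff)
  qed
  moreover have "continuous_on UNIV (\<lambda>x. u (r *\<^sub>R x))"
    by (rule continuous_on_compose2[OF u]) (auto intro: continuous_intros)
  ultimately show ?thesis unfolding Cc_def by blast
qed

lemma indicator_ball_scale:
  fixes x :: "'a::euclidean_space"
  assumes "0 < r"
  shows "indicator (ball 0 r) (r *\<^sub>R x) = indicator (ball 0 1) x"
  using assms by (simp add: indicator_def)

lemma nn_integral_scale:
  fixes f :: "'a::euclidean_space \<Rightarrow> ennreal"
  assumes "f \<in> borel_measurable borel" "0 < r"
  shows "(\<integral>\<^sup>+x. f x \<partial>lborel) = ennreal (r powr real DIM('a)) * (\<integral>\<^sup>+x. f (r *\<^sub>R x) \<partial>lborel)"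
  using nn_integral_lborel_affine[OF assms(1), of r 0] assms(2) by (simp add: powr_realpow)

text \<open>Each of the two integrations contributes r^n and the kernel r^(-n - \<alpha>). The Hardy
  and the Sobolev term have the same degree n - \<alpha>, so the constant for the unit ball serves
  all r.\<close>

lemma energy_scale:
  fixes u :: "'a::euclidean_space \<Rightarrow> real"
  assumes [measurable]: "u \<in> borel_measurable borel" and r: "0 < r"
  shows "energy (ball 0 r) \<alpha> u = ennreal (r powr (real DIM('a) - \<alpha>)) * energy (ball 0 1) \<alpha> (\<lambda>x. u (r *\<^sub>R x))"
proof -
  let ?n = "real DIM('a)"
  let ?f = "\<lambda>x y. ennreal ((u x - u y)\<^sup>2 / norm (x - y) powr (?n + \<alpha>))"
  let ?g = "\<lambda>x y. ennreal ((u (r *\<^sub>R x) - u (r *\<^sub>R y))\<^sup>2 / norm (x - y) powr (?n + \<alpha>))"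
  have fg: "?f (r *\<^sub>R x) (r *\<^sub>R y) = ennreal (r powr - (?n + \<alpha>)) * ?g x y" for x y
  proof -
    have "norm (r *\<^sub>R x - r *\<^sub>R y) powr (?n + \<alpha>) = r powr (?n + \<alpha>) * norm (x - y) powr (?n + \<alpha>)"
      using r by (simp add: powr_mult flip: scaleR_diff_right)
    moreover have "A / (B * C) = inverse B * (A / C)" for A B C :: real by (simp add: divide_inverse)
    ultimately show ?thesis by (simp only: powr_minus ennreal_mult'[symmetric] inverse_nonnegative_iff_nonnegative powr_ge_zero)
  qed
  have inner: "(\<integral>\<^sup>+y. ?f (r *\<^sub>R x) y * indicator (ball 0 r) y \<partial>lborel) =
      ennreal (r powr - \<alpha>) * (\<integral>\<^sup>+y. ?g x y * indicator (ball 0 1) y \<partial>lborel)" for x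
  proof -
    have "(\<integral>\<^sup>+y. ?f (r *\<^sub>R x) y * indicator (ball 0 r) y \<partial>lborel) =
        ennreal (r powr ?n) * (\<integral>\<^sup>+y. ?f (r *\<^sub>R x) (r *\<^sub>R y) * indicator (ball 0 r) (r *\<^sub>R y) \<partial>lborel)"
      by (rule nn_integral_scale[OF _ r]) measurable
    also have "(\<integral>\<^sup>+y. ?f (r *\<^sub>R x) (r *\<^sub>R y) * indicator (ball 0 r) (r *\<^sub>R y) \<partial>lborel) =
        (\<integral>\<^sup>+y. ennreal (r powr - (?n + \<alpha>)) * (?g x y * indicator (ball 0 1) y) \<partial>lborel)"
      unfolding fg indicator_ball_scale[OF r] mult.assoc ..
    also have "\<dots> = ennreal (r powr - (?n + \<alpha>)) * (\<integral>\<^sup>+y. ?g x y * indicator (ball 0 1) y \<partial>lborel)"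
      by (rule nn_integral_cmult) measurable
    also have "ennreal (r powr ?n) * \<dots> = ennreal (r powr ?n * r powr - (?n + \<alpha>)) * (\<integral>\<^sup>+y. ?g x y * indicator (ball 0 1) y \<partial>lborel)"
      by (simp only: ennreal_mult' powr_ge_zero mult.assoc)
    also have "r powr ?n * r powr - (?n + \<alpha>) = r powr - \<alpha>" by (simp flip: powr_add)
    finally show ?thesis .
  qed
  have "(\<integral>\<^sup>+x. (\<integral>\<^sup>+y. ?f x y * indicator (ball 0 r) y \<partial>lborel) * indicator (ball 0 r) x \<partial>lborel) =
      ennreal (r powr ?n) * (\<integral>\<^sup>+x. (\<integral>\<^sup>+y. ?f (r *\<^sub>R x) y * indicator (ball 0 r) y \<partial>lborel) * indicator (ball 0 r) (r *\<^sub>R x) \<partial>lborel)"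
    by (rule nn_integral_scale[OF _ r]) measurable
  also have "(\<integral>\<^sup>+x. (\<integral>\<^sup>+y. ?f (r *\<^sub>R x) y * indicator (ball 0 r) y \<partial>lborel) * indicator (ball 0 r) (r *\<^sub>R x) \<partial>lborel) =
      (\<integral>\<^sup>+x. ennreal (r powr - \<alpha>) * ((\<integral>\<^sup>+y. ?g x y * indicator (ball 0 1) y \<partial>lborel) * indicator (ball 0 1) x) \<partial>lborel)"
    unfolding inner indicator_ball_scale[OF r] mult.assoc ..
  also have "\<dots> = ennreal (r powr - \<alpha>) * (\<integral>\<^sup>+x. (\<integral>\<^sup>+y. ?g x y * indicator (ball 0 1) y \<partial>lborel) * indicator (ball 0 1) x \<partial>lborel)"
    by (rule nn_integral_cmult) measurable
  finally have "energy (ball 0 r) \<alpha> u = ennreal (1 / 2) * (ennreal (r powr ?n) * (ennreal (r powr - \<alpha>) *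
      (\<integral>\<^sup>+x. (\<integral>\<^sup>+y. ?g x y * indicator (ball 0 1) y \<partial>lborel) * indicator (ball 0 1) x \<partial>lborel)))"
    unfolding energy_def by simp
  also have "\<dots> = ennreal (r powr ?n * r powr - \<alpha>) * energy (ball 0 1) \<alpha> (\<lambda>x. u (r *\<^sub>R x))"
    unfolding energy_def by (simp only: ennreal_mult' powr_ge_zero mult_ac)
  finally show ?thesis by (simp flip: powr_add)
qed

theorem theorem2p3:
  fixes \<alpha> :: real
  assumes "1 < \<alpha>" "\<alpha> < 2" "DIM('a::euclidean_space) \<ge> 2"
  shows "\<exists>c>0. \<forall>r::real. \<forall>u::'a \<Rightarrow> real. 0 < r \<longrightarrow> u \<in> Cc (ball 0 r) \<longrightarrow>
     ennreal (2 powr \<alpha> * kappa DIM('a) \<alpha> *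
        (LINT x : ball 0 r | lborel. (u x)^2 * r powr \<alpha> * (r^2 - (norm x)^2) powr (- \<alpha>))
      + c * (LINT x : ball 0 r | lborel. \<bar>u x\<bar> powr (2 * real DIM('a) / (real DIM('a) - \<alpha>)))
            powr (2 / (2 * real DIM('a) / (real DIM('a) - \<alpha>))))
     \<le> energy (ball 0 r) \<alpha> u"
proof -
  let ?n = "real DIM('a)"
  define q where "q = 2 * ?n / (?n - \<alpha>)"
  have q: "0 < q" "2 / q = (?n - \<alpha>) / ?n" using assms by (auto simp: q_def field_simps)
  let ?k = "2 powr \<alpha> * kappa DIM('a) \<alpha>"
  obtain c where c: "0 < c" "\<And>(u::'a \<Rightarrow> real) H Y. u \<in> Cc (ball 0 1) \<Longrightarrow>
    (\<integral>\<^sup>+x. ennreal ((u x)\<^sup>2 * (1 - (norm x)\<^sup>2) powr - \<alpha>) \<partial>lborel) = ennreal H \<Longrightarrow> 0 \<le> H \<Longrightarrow>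
    (\<integral>\<^sup>+x. ennreal (\<bar>u x\<bar> powr q) \<partial>lborel) = ennreal Y \<Longrightarrow> 0 \<le> Y \<Longrightarrow>
    ennreal (?k * H + c * Y powr (2 / q)) \<le> energy (ball 0 1) \<alpha> u"
    by (rule unit_ball_inequality[OF assms, folded q_def]) (rule that; assumption)
  have "ennreal (?k * (LINT x : ball 0 r | lborel. (u x)^2 * r powr \<alpha> * (r^2 - (norm x)^2) powr (- \<alpha>))
      + c * (LINT x : ball 0 r | lborel. \<bar>u x\<bar> powr q) powr (2 / q)) \<le> energy (ball 0 r) \<alpha> u"
    if r: "0 < r" and u: "u \<in> Cc (ball 0 r)" for r and u :: "'a \<Rightarrow> real"
  proof -
    have [measurable]: "u \<in> borel_measurable borel" by (rule Cc_measurable[OF u])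
    define v where "v x = u (r *\<^sub>R x)" for x
    have v: "v \<in> Cc (ball 0 1)" unfolding v_def[abs_def] by (rule Cc_scale[OF u r])
    have [measurable]: "v \<in> borel_measurable borel" by (rule Cc_measurable[OF v])
    have v0: "v x = 0" if "\<not> norm x < 1" for x using v that by (force simp: Cc_def)
    obtain H where H: "(\<integral>\<^sup>+x. ennreal ((v x)\<^sup>2 * (1 - (norm x)\<^sup>2) powr - \<alpha>) \<partial>lborel) = ennreal H" "0 \<le> H"
      using hardy_integral_finite[OF v, of \<alpha>] assms
      by (cases "\<integral>\<^sup>+x. ennreal ((v x)\<^sup>2 * (1 - (norm x)\<^sup>2) powr - \<alpha>) \<partial>lborel") auto
    obtain Y where Y: "(\<integral>\<^sup>+x. ennreal (\<bar>v x\<bar> powr q) \<partial>lborel) = ennreal Y" "0 \<le> Y"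
      using powr_integral_finite[OF v q(1)] by (cases "\<integral>\<^sup>+x. ennreal (\<bar>v x\<bar> powr q) \<partial>lborel") auto
    \<comment> \<open>Used twice: s is r^(-\<alpha>) for the Hardy integrand, where r^\<alpha> meets
      r^(-2 \<alpha>) from the weight, and 1 for the power of u.\<close>
    have scaled: "(LINT x : ball 0 r | lborel. f x) = r powr ?n * s * I"
      if [measurable]: "f \<in> borel_measurable borel" and f: "\<And>x. 0 \<le> f x" "0 \<le> s" "0 \<le> I"
        "\<And>x. norm x < 1 \<Longrightarrow> f (r *\<^sub>R x) = s * g x"
        and g: "(\<integral>\<^sup>+x. ennreal (g x) \<partial>lborel) = ennreal I" "\<And>x. \<not> norm x < 1 \<Longrightarrow> g x = 0" "g \<in> borel_measurable borel"
      for f g :: "'a \<Rightarrow> real" and s I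
    proof -
      note [measurable] = g(3)
      have "(LINT x : ball 0 r | lborel. f x) = enn2real (\<integral>\<^sup>+x. ennreal (indicator (ball 0 r) x * f x) \<partial>lborel)"
        unfolding set_lebesgue_integral_def real_scaleR_def
        by (rule integral_eq_nn_integral) (auto simp: f)
      also have "(\<integral>\<^sup>+x. ennreal (indicator (ball 0 r) x * f x) \<partial>lborel) =
          ennreal (r powr ?n) * (\<integral>\<^sup>+x. ennreal (indicator (ball 0 r) (r *\<^sub>R x) * f (r *\<^sub>R x)) \<partial>lborel)"
        by (rule nn_integral_scale[OF _ r]) measurable
      also have "(\<integral>\<^sup>+x. ennreal (indicator (ball 0 r) (r *\<^sub>R x) * f (r *\<^sub>R x)) \<partial>lborel) =
          (\<integral>\<^sup>+x. ennreal s * ennreal (g x) \<partial>lborel)"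
      proof (rule nn_integral_cong)
        show "ennreal (indicator (ball 0 r) (r *\<^sub>R x) * f (r *\<^sub>R x)) = ennreal s * ennreal (g x)" for x
          unfolding indicator_ball_scale[OF r] using f g(2)[of x] by (cases "norm x < 1") (auto simp: ennreal_mult')
      qed
      also have "\<dots> = ennreal s * ennreal I" by (simp add: nn_integral_cmult g)
      also have "enn2real (ennreal (r powr ?n) * (ennreal s * ennreal I)) = r powr ?n * s * I"
        using f by (simp add: mult.assoc flip: ennreal_mult)
      finally show ?thesis .
    qed
    have "(LINT x : ball 0 r | lborel. (u x)^2 * r powr \<alpha> * (r^2 - (norm x)^2) powr (- \<alpha>)) = r powr ?n * r powr - \<alpha> * H"
    proof (rule scaled[OF _ _ _ H(2) _ H(1)])
      fix x :: 'a assume x: "norm x < 1"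
      have "r\<^sup>2 - (norm (r *\<^sub>R x))\<^sup>2 = r\<^sup>2 * (1 - (norm x)\<^sup>2)" by (simp add: power_mult_distrib algebra_simps)
      moreover have "(r\<^sup>2) powr - \<alpha> = r powr - \<alpha> * r powr - \<alpha>"
        using r by (simp add: power2_powr flip: powr_add)
      moreover have "r powr \<alpha> * r powr - \<alpha> = 1" using r by (simp flip: powr_add)
      ultimately show "(u (r *\<^sub>R x))\<^sup>2 * r powr \<alpha> * (r\<^sup>2 - (norm (r *\<^sub>R x))\<^sup>2) powr - \<alpha> =
          r powr - \<alpha> * ((v x)\<^sup>2 * (1 - (norm x)\<^sup>2) powr - \<alpha>)"
        by (simp add: v_def powr_mult mult.assoc[symmetric] mult.commute[of _ "r powr \<alpha>"])
    qed (auto simp: v0)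
    moreover have "(LINT x : ball 0 r | lborel. \<bar>u x\<bar> powr q) = r powr ?n * 1 * Y"
      by (rule scaled[OF _ _ _ Y(2) _ Y(1)]) (auto simp: v_def[symmetric] v0)
    \<comment> \<open>Criticality again: n * 2 / q = n - \<alpha>, the degree of the energy.\<close>
    moreover have "(r powr ?n * Y) powr (2 / q) = r powr (?n - \<alpha>) * Y powr (2 / q)"
    proof -
      have "?n * (2 / q) = ?n - \<alpha>" using assms unfolding q(2) by simp
      then show ?thesis by (simp only: powr_mult powr_powr)
    qed
    moreover have "r powr ?n * r powr - \<alpha> = r powr (?n - \<alpha>)" by (simp flip: powr_add)
    ultimately have "?k * (LINT x : ball 0 r | lborel. (u x)^2 * r powr \<alpha> * (r^2 - (norm x)^2) powr (- \<alpha>))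
      + c * (LINT x : ball 0 r | lborel. \<bar>u x\<bar> powr q) powr (2 / q) = r powr (?n - \<alpha>) * (?k * H + c * Y powr (2 / q))"
      by (simp add: distrib_left mult_ac)
    also have "ennreal \<dots> = ennreal (r powr (?n - \<alpha>)) * ennreal (?k * H + c * Y powr (2 / q))"
      by (simp only: ennreal_mult' powr_ge_zero)
    also have "\<dots> \<le> ennreal (r powr (?n - \<alpha>)) * energy (ball 0 1) \<alpha> v"
      by (intro mult_left_mono c(2)[OF v H Y]) simp
    also have "\<dots> = energy (ball 0 r) \<alpha> u"
      unfolding v_def[abs_def] by (rule energy_scale[symmetric, OF _ r]) simp
    finally show ?thesis .
  qed
  then show ?thesis using c(1) unfolding q_def by blast
qed

end
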